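(* Let $\overline{\mathfrak{sp}(2n)}$ be the Lax operator algebra over $\mathfrak{sp}(2n)$ with Tyurin parameters $\{(\alpha_s,\gamma_s)\}$. Let $\mathcal{L}$ be a meromorphic $\mathfrak{sp}(2n)$-valued 1-form on $\Gamma$, holomorphic outside $P_\pm$ and the points $\gamma_s$, such that at every $\gamma_s$ (with local coordinate $z$ vanishing at $\gamma_s$) $$\mathcal{L}=\mathcal{L}_{-1}\frac{dz}{z}+\mathcal{L}_0\,dz+\mathcal{L}_1z\,dz+\ldots,$$ $$\mathcal{L}_{-1}=(\alpha_s\tilde\beta_s^t+\tilde\beta_s\alpha_s^t)\sigma,\quad \tilde\beta_s^t\sigma\alpha_s=1,\quad \mathcal{L}_0\alpha_s=\tilde k_s\alpha_s,\quad \alpha_s^t\sigma\mathcal{L}_1\alpha_s=0$$ for some $\tilde\beta_s\in\mathbb{C}^{2n}$ and $\tilde k_s\in\mathbb{C}$. Then for all $L,L'\in\overline{\mathfrak{sp}(2n)}$ the 1-form $\operatorname{tr}(L\,dL'-[L,L']\mathcal{L})$ is regular except at the points $P_\pm$, and the expression $$\gamma(L,L')=\operatorname{res}_{P_+}\operatorname{tr}(L\,dL'-[L,L']\mathcal{L})$$ gives a local 2-cocycle on the Lax operator algebra $\overline{\mathfrak{sp}(2n)}$.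
   Context: $\Gamma$ is a compact Riemann surface of genus $g$ with two distinct marked points $P_+,P_-$. Fix further distinct points $\gamma_s\in\Gamma\setminus\{P_+,P_-\}$, $s=1,\ldots,ng$ (weak singularities), and nonzero vectors $\alpha_s\in\mathbb{C}^{2n}$ (Tyurin parameters). Let $\sigma$ be a fixed nondegenerate skew-symmetric complex $2n\times 2n$ matrix; $\mathfrak{sp}(2n)=\{X : X^t=-\sigma X\sigma^{-1}\}$. The Lax operator algebra $\overline{\mathfrak{sp}(2n)}$ is the Lie algebra, under pointwise bracket, of meromorphic functions $L:\Gamma\to\mathfrak{sp}(2n)$, holomorphic outside $P_\pm$ and the $\gamma_s$ (arbitrary finite-order poles at $P_\pm$), such that at every $\gamma_s$ (write $\alpha=\alpha_s$) one has $L=L_{-2}z^{-2}+L_{-1}z^{-1}+L_0+L_1z+O(z^2)$ with $$L_{-2}=\nu\alpha\alpha^t\sigma,\quad L_{-1}=(\alpha\beta^t+\beta\alpha^t)\sigma,\quad \beta^t\sigma\alpha=0,\quad L_0\alpha=k\alpha,\quad \alpha^t\sigma L_1\alpha=0$$ for some $\nu,k\in\mathbb{C}$, $\beta\in\mathbb{C}^{2n}$ depending on $L$ and $s$. Homogeneous subspaces: $\mathfrak{g}_m$ ($m\in\mathbb{Z}$) consists of $L\in\overline{\mathfrak{sp}(2n)}$ of order at least $m$ at $P_+$ and at least $-m-g$ at $P_-$ (and poles of order at most two at the $\gamma_s$). A 2-cocycle on a Lie algebra is an antisymmetric bilinear form $\chi$ with $\chi([X,Y],Z)+\chi([Y,Z],X)+\chi([Z,X],Y)=0$.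 A cocycle $\chi$ is local if there are constants $\mu',\mu''$ such that $\chi(\mathfrak{g}_m,\mathfrak{g}_{m'})=0$ unless $\mu'\le m+m'\le\mu''$. *)

theory Defs
  imports "HOL-Complex_Analysis.Complex_Analysis" "HOL-Homology.Homology"
begin

section \<open>Compact Riemann surfaces\<close>

text \<open>The points of the surface are the elements of a Hausdorff type \<open>'a\<close>. A chart is a pair of
  its domain and its coordinate function; the values of the latter outside the domain are
  irrelevant.\<close>

type_synonym 'a chart = "'a set \<times> ('a \<Rightarrow> complex)"

definition chart_inv :: "'a chart \<Rightarrow> complex \<Rightarrow> 'a" where
  "chart_inv c = inv_into (fst c) (snd c)"

definition is_chart :: "('a::topological_space) chart \<Rightarrow> bool" where
  "is_chart c \<longleftrightarrow> open (fst c) \<and> open (snd c ` fst c) \<and>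
     homeomorphism (fst c) (snd c ` fst c) (snd c) (chart_inv c)"

definition compatible :: "'a chart \<Rightarrow> 'a chart \<Rightarrow> bool" where
  "compatible c d \<longleftrightarrow>
     (snd d \<circ> chart_inv c) holomorphic_on snd c ` (fst c \<inter> fst d) \<and>
     (snd c \<circ> chart_inv d) holomorphic_on snd d ` (fst c \<inter> fst d)"

text \<open>A complex structure is a maximal holomorphic atlas, so that its elements are exactly the
  local coordinates of the surface.\<close>

definition complex_structure :: "('a::topological_space) chart set \<Rightarrow> bool" where
  "complex_structure A \<longleftrightarrow>
     (\<Union>c\<in>A. fst c) = UNIV \<and> A = {c. is_chart c \<and> (\<forall>d\<in>A. compatible c d)}"

text \<open>The genus is the topological one: the first integral homology group is free abelian of
  rank \<open>2 * g\<close>.\<close>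

definition compact_riemann_surface :: "('a::t2_space) chart set \<Rightarrow> nat \<Rightarrow> bool" where
  "compact_riemann_surface A g \<longleftrightarrow>
     compact (UNIV :: 'a set) \<and> connected (UNIV :: 'a set) \<and> complex_structure A \<and>
     homology_group 1 (euclidean :: 'a topology) \<cong> free_Abelian_group {..<2 * g}"

section \<open>Meromorphic functions and 1-forms\<close>

text \<open>Here \<open>S\<close> is a (finite) set of admissible singularities. Library functions are total,
  so a meromorphic function is given the dummy value \<open>0\<close> at \<^emph>\<open>every\<close> point of \<open>S\<close>, whether or
  not it has a pole there. Thus two such functions are equal iff they are equal as meromorphic
  functions, and sums and products can be formed pointwise. All conditions at points of \<open>S\<close> are
  expressed by Laurent expansions, which do not depend on this value.\<close>

definition meromorphic_fun :: "'a chart set \<Rightarrow> 'a set \<Rightarrow> ('a \<Rightarrow> complex) \<Rightarrow> bool" where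
  "meromorphic_fun A S f \<longleftrightarrow>
     (\<forall>c\<in>A. (f \<circ> chart_inv c) meromorphic_on snd c ` fst c \<and>
             (f \<circ> chart_inv c) holomorphic_on snd c ` (fst c - S)) \<and>
     (\<forall>p\<in>S. f p = 0)"

text \<open>A 1-form is the family of its coefficients: \<open>\<omega> c p\<close> is the coefficient of \<open>dw\<close> at the point
  \<open>p\<close>, where \<open>w = snd c\<close> is the coordinate of the chart \<open>c\<close>. The coefficients transform by the
  chain rule \<open>dv = (dv/dw) dw\<close>. Values at points of \<open>S\<close> are irrelevant.\<close>

type_synonym ('a, 'b) form = "'a chart \<Rightarrow> 'a \<Rightarrow> 'b"

definition meromorphic_form :: "'a chart set \<Rightarrow> 'a set \<Rightarrow> ('a, complex) form \<Rightarrow> bool" where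
  "meromorphic_form A S \<omega> \<longleftrightarrow>
     (\<forall>c\<in>A. (\<omega> c \<circ> chart_inv c) meromorphic_on snd c ` fst c \<and>
             (\<omega> c \<circ> chart_inv c) holomorphic_on snd c ` (fst c - S)) \<and>
     (\<forall>c\<in>A. \<forall>d\<in>A. \<forall>p \<in> fst c \<inter> fst d - S.
        \<omega> c p = \<omega> d p * deriv (snd d \<circ> chart_inv c) (snd c p))"

text \<open>Regularity is up to a removable singularity.\<close>

definition regular_at :: "'a chart set \<Rightarrow> ('a, complex) form \<Rightarrow> 'a \<Rightarrow> bool" where
  "regular_at A \<omega> p \<longleftrightarrow>
     (\<forall>c\<in>A. p \<in> fst c \<longrightarrow>
        (\<exists>h. h analytic_on {snd c p} \<and>
             (\<forall>\<^sub>F w in at (snd c p). \<omega> c (chart_inv c w) = h w)))"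

definition residue_form :: "'a chart set \<Rightarrow> 'a \<Rightarrow> ('a, complex) form \<Rightarrow> complex" where
  "residue_form A p \<omega> =
     (let c = (SOME c. c \<in> A \<and> p \<in> fst c) in residue (\<omega> c \<circ> chart_inv c) (snd c p))"

section \<open>Matrices\<close>

definition cscale :: "complex \<Rightarrow> complex^'m^'m \<Rightarrow> complex^'m^'m" where
  "cscale a X = map_matrix ((*) a) X"

definition outer :: "complex^'m \<Rightarrow> complex^'m \<Rightarrow> complex^'m^'m" where
  "outer u v = (\<chi> i j. u $ i * v $ j)"

definition bilin :: "complex^'m^'m \<Rightarrow> complex^'m \<Rightarrow> complex^'m \<Rightarrow> complex" where
  "bilin B u v = scalar_product u (B *v v)"

definition sp :: "complex^'m^'m \<Rightarrow> (complex^'m^'m) set" where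
  "sp \<sigma> = {X. transpose X = - (\<sigma> ** X ** matrix_inv \<sigma>)}"

definition commutator :: "complex^'m^'m \<Rightarrow> complex^'m^'m \<Rightarrow> complex^'m^'m" where
  "commutator X Y = X ** Y - Y ** X"

text \<open>The coefficient of order \<open>k\<close> in the Laurent expansion at \<open>p\<close> of a matrix-valued function
  in powers of \<open>snd c - snd c p\<close>.\<close>

definition laurent_coeff ::
    "'a chart \<Rightarrow> 'a \<Rightarrow> ('a \<Rightarrow> complex^'m^'m) \<Rightarrow> int \<Rightarrow> complex^'m^'m" where
  "laurent_coeff c p X k =
     (\<chi> i j. fls_nth (laurent_expansion (\<lambda>w. X (chart_inv c w) $ i $ j) (snd c p)) k)"

definition order_ge :: "'a chart set \<Rightarrow> ('a \<Rightarrow> complex^'m^'m) \<Rightarrow> 'a \<Rightarrow> int \<Rightarrow> bool" where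
  "order_ge A X p m \<longleftrightarrow> (\<forall>c\<in>A. p \<in> fst c \<longrightarrow> (\<forall>k<m. laurent_coeff c p X k = 0))"

section \<open>The Lax operator algebra\<close>

definition lax_at ::
    "complex^'m^'m \<Rightarrow> 'a chart \<Rightarrow> 'a \<Rightarrow> complex^'m \<Rightarrow> ('a \<Rightarrow> complex^'m^'m) \<Rightarrow> bool" where
  "lax_at \<sigma> z p a L \<longleftrightarrow>
     (\<forall>k < -2. laurent_coeff z p L k = 0) \<and>
     (\<exists>\<nu> k \<beta>.
        laurent_coeff z p L (-2) = cscale \<nu> (outer a a ** \<sigma>) \<and>
        laurent_coeff z p L (-1) = (outer a \<beta> + outer \<beta> a) ** \<sigma> \<and>
        bilin \<sigma> \<beta> a = 0 \<and>
        laurent_coeff z p L 0 *v a = k *s a \<and>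
        bilin (\<sigma> ** laurent_coeff z p L 1) a a = 0)"

definition lax_form_at ::
    "complex^'m^'m \<Rightarrow> 'a chart \<Rightarrow> 'a \<Rightarrow> complex^'m \<Rightarrow> ('a, complex^'m^'m) form \<Rightarrow> bool" where
  "lax_form_at \<sigma> z p a \<L> \<longleftrightarrow>
     (\<forall>k < -1. laurent_coeff z p (\<L> z) k = 0) \<and>
     (\<exists>k \<beta>.
        laurent_coeff z p (\<L> z) (-1) = (outer a \<beta> + outer \<beta> a) ** \<sigma> \<and>
        bilin \<sigma> \<beta> a = 1 \<and>
        laurent_coeff z p (\<L> z) 0 *v a = k *s a \<and>
        bilin (\<sigma> ** laurent_coeff z p (\<L> z) 1) a a = 0)"

text \<open>In what follows \<open>\<gamma> s\<close>, \<open>\<alpha> s\<close> (\<open>1 \<le> s \<le> N\<close>) are the Tyurin parameters, \<open>z s\<close> is a local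
  coordinate at \<open>\<gamma> s\<close>, and \<open>P\<close>, \<open>Q\<close> stand for the marked points \<open>P\<^sub>+\<close>, \<open>P\<^sub>-\<close>.\<close>

definition sing_points :: "nat \<Rightarrow> 'a \<Rightarrow> 'a \<Rightarrow> (nat \<Rightarrow> 'a) \<Rightarrow> 'a set" where
  "sing_points N P Q \<gamma> = {P, Q} \<union> \<gamma> ` {1..N}"

definition lax_algebra ::
    "'a chart set \<Rightarrow> nat \<Rightarrow> 'a \<Rightarrow> 'a \<Rightarrow> (nat \<Rightarrow> 'a) \<Rightarrow> (nat \<Rightarrow> 'a chart) \<Rightarrow> (nat \<Rightarrow> complex^'m) \<Rightarrow>
     complex^'m^'m \<Rightarrow> ('a \<Rightarrow> complex^'m^'m) set" where
  "lax_algebra A N P Q \<gamma> z \<alpha> \<sigma> =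
     {L. (\<forall>i j. meromorphic_fun A (sing_points N P Q \<gamma>) (\<lambda>p. L p $ i $ j)) \<and>
         (\<forall>p. L p \<in> sp \<sigma>) \<and>
         (\<forall>s\<in>{1..N}. lax_at \<sigma> (z s) (\<gamma> s) (\<alpha> s) L)}"

definition lax_form ::
    "'a chart set \<Rightarrow> nat \<Rightarrow> 'a \<Rightarrow> 'a \<Rightarrow> (nat \<Rightarrow> 'a) \<Rightarrow> (nat \<Rightarrow> 'a chart) \<Rightarrow> (nat \<Rightarrow> complex^'m) \<Rightarrow>
     complex^'m^'m \<Rightarrow> ('a, complex^'m^'m) form \<Rightarrow> bool" where
  "lax_form A N P Q \<gamma> z \<alpha> \<sigma> \<L> \<longleftrightarrow>
     (\<forall>i j. meromorphic_form A (sing_points N P Q \<gamma>) (\<lambda>c p. \<L> c p $ i $ j)) \<and>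
     (\<forall>c\<in>A. \<forall>p \<in> fst c - sing_points N P Q \<gamma>. \<L> c p \<in> sp \<sigma>) \<and>
     (\<forall>s\<in>{1..N}. lax_form_at \<sigma> (z s) (\<gamma> s) (\<alpha> s) \<L>)"

text \<open>The bound on the pole order at the points \<open>\<gamma> s\<close> is already part of \<open>lax_algebra\<close>.\<close>

definition lax_homogeneous ::
    "'a chart set \<Rightarrow> nat \<Rightarrow> nat \<Rightarrow> 'a \<Rightarrow> 'a \<Rightarrow> (nat \<Rightarrow> 'a) \<Rightarrow> (nat \<Rightarrow> 'a chart) \<Rightarrow>
     (nat \<Rightarrow> complex^'m) \<Rightarrow> complex^'m^'m \<Rightarrow> int \<Rightarrow> ('a \<Rightarrow> complex^'m^'m) set" where
  "lax_homogeneous A g N P Q \<gamma> z \<alpha> \<sigma> m =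
     {L \<in> lax_algebra A N P Q \<gamma> z \<alpha> \<sigma>. order_ge A L P m \<and> order_ge A L Q (- m - int g)}"

section \<open>Local cocycles\<close>

definition bracket ::
    "('a \<Rightarrow> complex^'m^'m) \<Rightarrow> ('a \<Rightarrow> complex^'m^'m) \<Rightarrow> 'a \<Rightarrow> complex^'m^'m" where
  "bracket X Y = (\<lambda>p. commutator (X p) (Y p))"

text \<open>Antisymmetry and the Jacobi identity of the pointwise commutator are automatic.\<close>

definition lie_algebra_of_functions :: "('a \<Rightarrow> complex^'m^'m) set \<Rightarrow> bool" where
  "lie_algebra_of_functions V \<longleftrightarrow>
     (\<lambda>p. 0) \<in> V \<and>
     (\<forall>X\<in>V. \<forall>Y\<in>V. (\<lambda>p. X p + Y p) \<in> V \<and> bracket X Y \<in> V) \<and>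
     (\<forall>a. \<forall>X\<in>V. (\<lambda>p. cscale a (X p)) \<in> V)"

definition two_cocycle ::
    "('a \<Rightarrow> complex^'m^'m) set \<Rightarrow>
     (('a \<Rightarrow> complex^'m^'m) \<Rightarrow> ('a \<Rightarrow> complex^'m^'m) \<Rightarrow> complex) \<Rightarrow> bool" where
  "two_cocycle V \<eta> \<longleftrightarrow>
     lie_algebra_of_functions V \<and>
     (\<forall>X\<in>V. \<forall>Y\<in>V. \<forall>Z\<in>V.
        \<eta> (\<lambda>p. X p + Y p) Z = \<eta> X Z + \<eta> Y Z \<and> \<eta> Z (\<lambda>p. X p + Y p) = \<eta> Z X + \<eta> Z Y) \<and>
     (\<forall>a. \<forall>X\<in>V. \<forall>Y\<in>V.
        \<eta> (\<lambda>p. cscale a (X p)) Y = a * \<eta> X Y \<and> \<eta> X (\<lambda>p. cscale a (Y p)) = a * \<eta> X Y) \<and>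
     (\<forall>X\<in>V. \<forall>Y\<in>V. \<eta> X Y = - \<eta> Y X) \<and>
     (\<forall>X\<in>V. \<forall>Y\<in>V. \<forall>Z\<in>V.
        \<eta> (bracket X Y) Z + \<eta> (bracket Y Z) X + \<eta> (bracket Z X) Y = 0)"

definition local_wrt ::
    "(int \<Rightarrow> ('a \<Rightarrow> complex^'m^'m) set) \<Rightarrow>
     (('a \<Rightarrow> complex^'m^'m) \<Rightarrow> ('a \<Rightarrow> complex^'m^'m) \<Rightarrow> complex) \<Rightarrow> bool" where
  "local_wrt G \<eta> \<longleftrightarrow>
     (\<exists>\<mu>1 \<mu>2 :: int. \<forall>m m'. \<not> (\<mu>1 \<le> m + m' \<and> m + m' \<le> \<mu>2) \<longrightarrow>
        (\<forall>X \<in> G m. \<forall>Y \<in> G m'. \<eta> X Y = 0))"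

definition dform :: "('a \<Rightarrow> complex^'m^'m) \<Rightarrow> ('a, complex^'m^'m) form" where
  "dform X c p = (\<chi> i j. deriv (\<lambda>w. X (chart_inv c w) $ i $ j) (snd c p))"

definition cocycle_form ::
    "('a, complex^'m^'m) form \<Rightarrow> ('a \<Rightarrow> complex^'m^'m) \<Rightarrow> ('a \<Rightarrow> complex^'m^'m) \<Rightarrow>
     ('a, complex) form" where
  "cocycle_form \<L> L L' c p = trace (L p ** dform L' c p - bracket L L' p ** \<L> c p)"

end

(* At a weak singularity let h be the element of sp(2n) with eigenvalue -1 on alpha, 1 on a dual vector
   and 0 on the symplectic complement of the two. It grades sp(2n) by -2..2, and the Lax conditions on
   the Laurent coefficients of L say exactly that L = g M g^-1 with M holomorphic and g = z^h; those
   on the form say that it is the gauge transform under g of a holomorphic form. Hence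
   the bracket preserves the Lax conditions, and since the trace defining the cocycle is gauge
   invariant, it is regular at the weak singularities. Antisymmetry and the cocycle identity hold
   because both defects are residues of exact forms.

   For locality, the pole orders at P make the residue vanish when m + m' is large, and those at Q when
   m + m' is very negative, by the residue theorem. The latter is only needed when some entry f of
   L or L' is a nonconstant meromorphic function: nonzero constants lie in degrees between -g
   and 0 only. Given f and a form omega, let R(v) be the sum of all residues of omega / (f - v). Being
   locally a sum of integrals over fixed small circles, R is entire, and v R(v) tends to minus the sum
   of the residues of omega as v tends to infinity. By Liouville's theorem R = 0, so this sum is 0. *)

theory Submission
  imports Defs
begin

text \<open>The dual vector of the gauge transformation at \<open>\<gamma> s\<close> is not chosen
  freely: the polar part of the form supplies it, and the normalisation
  \<open>bilin \<sigma> b a = 1\<close> makes that polar part the exact negative of the logarithmic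
  derivative of the gauge transformation. All computations at a point take place in matrices over
  formal Laurent series, where a derivative visibly has residue 0; analysis enters only in the
  passage from functions to series. The residue theorem is obtained without cutting up the surface:
  only the planar residue theorem in finitely many coordinate discs is used. The complement of the
  discs is compact, so its image under f misses a neighbourhood of a suitable v0, or all large
  values; hence the poles of omega / (f - v) stay inside fixed discs while v varies. The method
  presupposes a nonconstant f, whose existence on a compact surface is a deep theorem of its own;
  the entries of L and L' supply one exactly where it is needed.\<close>

no_notation fps_nth (infixl "$" 75)

section \<open>Matrices of Laurent series\<close>

text \<open>Coefficientwise, because \<open>fls_subdegree\<close> is 0 at the zero series, whereas 0
  must have every order for sums to behave well.\<close>

definition fls_ord_ge :: "int \<Rightarrow> 'b::zero fls \<Rightarrow> bool" where
  "fls_ord_ge n f \<longleftrightarrow> (\<forall>k<n. fls_nth f k = 0)"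

lemma fls_ord_ge_0 [simp]: "fls_ord_ge n 0"
  by (simp add: fls_ord_ge_def)

lemma fls_ord_ge_mono: "fls_ord_ge n f \<Longrightarrow> m \<le> n \<Longrightarrow> fls_ord_ge m f"
  by (simp add: fls_ord_ge_def)

lemma fls_ord_ge_add: "fls_ord_ge n f \<Longrightarrow> fls_ord_ge n g \<Longrightarrow> fls_ord_ge n (f + g :: 'b::group_add fls)"
  by (simp add: fls_ord_ge_def)

lemma fls_ord_ge_diff: "fls_ord_ge n f \<Longrightarrow> fls_ord_ge n g \<Longrightarrow> fls_ord_ge n (f - g :: 'b::group_add fls)"
  by (simp add: fls_ord_ge_def)

lemma fls_ord_ge_sum:
  "(\<And>i. i \<in> I \<Longrightarrow> fls_ord_ge n (f i)) \<Longrightarrow> fls_ord_ge n (sum f I :: 'b::comm_ring_1 fls)"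
  by (simp add: fls_ord_ge_def fls_nth_sum)

lemma fls_ord_ge_iff: "f \<noteq> 0 \<Longrightarrow> fls_ord_ge n f \<longleftrightarrow> n \<le> fls_subdegree f"
  by (meson fls_eq0_below_subdegree fls_ord_ge_def fls_subdegree_geI order_less_le_trans)

lemma fls_ord_ge_mult:
  fixes f g :: "'b::idom fls"
  assumes "fls_ord_ge m f" "fls_ord_ge n g"
  shows "fls_ord_ge (m + n) (f * g)"
proof (cases "f = 0 \<or> g = 0")
  case False
  then show ?thesis using assms by (simp add: fls_ord_ge_iff)
qed auto

lemma fls_ord_ge_deriv: "fls_ord_ge n f \<Longrightarrow> fls_ord_ge (n - 1) (fls_deriv f)"
  by (simp add: fls_ord_ge_def)

text \<open>No order is lost here: the coefficient of order -1 of a derivative is 0 times the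
  constant term.\<close>

lemma fls_ord_ge_deriv_0:
  assumes "fls_ord_ge 0 f"
  shows "fls_ord_ge 0 (fls_deriv f)"
  unfolding fls_ord_ge_def
proof (intro allI impI)
  fix k :: int
  assume "k < 0"
  then show "fls_nth (fls_deriv f) k = 0"
    using assms by (cases "k = -1") (auto simp: fls_ord_ge_def)
qed

text \<open>One scaling for complex matrices and for matrices of series, so that powers of z can
  serve as scalars.\<close>

definition smul :: "'b::times \<Rightarrow> 'b^'n^'m \<Rightarrow> 'b^'n^'m" where
  "smul c F = (\<chi> i j. c * F $ i $ j)"

definition mderiv :: "complex fls^'n^'m \<Rightarrow> complex fls^'n^'m" where
  "mderiv F = (\<chi> i j. fls_deriv (F $ i $ j))"

definition mconst :: "complex^'n^'m \<Rightarrow> complex fls^'n^'m" where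
  "mconst X = (\<chi> i j. fls_const (X $ i $ j))"

definition mnth :: "complex fls^'n^'m \<Rightarrow> int \<Rightarrow> complex^'n^'m" where
  "mnth F k = (\<chi> i j. fls_nth (F $ i $ j) k)"

definition mat_ord_ge :: "int \<Rightarrow> complex fls^'n^'m \<Rightarrow> bool" where
  "mat_ord_ge n F \<longleftrightarrow> (\<forall>i j. fls_ord_ge n (F $ i $ j))"

lemma mat_ord_ge_iff: "mat_ord_ge n F \<longleftrightarrow> (\<forall>k<n. mnth F k = 0)"
  by (auto simp: mat_ord_ge_def fls_ord_ge_def mnth_def vec_eq_iff)

lemma cscale_smul: "cscale = smul"
  by (simp add: fun_eq_iff cscale_def smul_def map_matrix_def vec_eq_iff)

lemma smul_mult_left: "smul c F ** G = smul c (F ** G)" for c :: "'b::comm_semiring_1"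
  by (simp add: smul_def matrix_matrix_mult_def vec_eq_iff sum_distrib_left mult.assoc)

lemma smul_mult_right: "F ** smul c G = smul c (F ** G)" for c :: "'b::comm_semiring_1"
  by (simp add: smul_def matrix_matrix_mult_def vec_eq_iff sum_distrib_left mult.left_commute)

lemma smul_smul: "smul c (smul d F) = smul (c * d) F" for c :: "'b::comm_semiring_1"
  by (simp add: smul_def vec_eq_iff mult.assoc)

lemma smul_1 [simp]: "smul 1 F = F" for F :: "'b::comm_semiring_1^'n^'m"
  by (simp add: smul_def vec_eq_iff)

lemma smul_0_left [simp]: "smul 0 F = 0" for F :: "'b::comm_semiring_1^'n^'m"
  by (simp add: smul_def vec_eq_iff)

lemma smul_0_right [simp]: "smul c 0 = 0" for c :: "'b::comm_semiring_1"
  by (simp add: smul_def vec_eq_iff)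

lemma smul_add_right: "smul c (F + G) = smul c F + smul c G" for c :: "'b::comm_ring_1"
  by (simp add: smul_def vec_eq_iff algebra_simps)

lemma smul_diff_right: "smul c (F - G) = smul c F - smul c G" for c :: "'b::comm_ring_1"
  by (simp add: smul_def vec_eq_iff algebra_simps)

lemma smul_minus_right: "smul c (- F) = - smul c F" for c :: "'b::comm_ring_1"
  by (simp add: smul_def vec_eq_iff)

lemma smul_minus_left: "smul (- c) F = - smul c F" for c :: "'b::comm_ring_1"
  by (simp add: smul_def vec_eq_iff)

lemma trace_smul: "trace (smul c F) = c * trace F" for c :: "'b::comm_semiring_1"
  by (simp add: smul_def trace_def sum_distrib_left)

lemma matrix_uminus_left: "(- F) ** G = - (F ** G)" for F :: "'b::comm_ring_1^'n^'m"
  by (simp add: matrix_matrix_mult_def vec_eq_iff sum_negf)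

lemma matrix_uminus_right: "F ** (- G) = - (F ** G)" for F :: "'b::comm_ring_1^'n^'m"
  by (simp add: matrix_matrix_mult_def vec_eq_iff sum_negf)

lemma matrix_diff_left: "(F - F') ** G = F ** G - F' ** G" for F :: "'b::comm_ring_1^'n^'m"
  by (simp add: matrix_matrix_mult_def vec_eq_iff sum_subtractf algebra_simps)

lemma matrix_diff_right: "F ** (G - G') = F ** G - F ** G'" for F :: "'b::comm_ring_1^'n^'m"
  by (simp add: matrix_matrix_mult_def vec_eq_iff sum_subtractf algebra_simps)

lemma matrix_add_left: "(F + F') ** G = F ** G + F' ** G" for F :: "'b::comm_ring_1^'n^'m"
  by (simp add: matrix_matrix_mult_def vec_eq_iff sum.distrib algebra_simps)

lemma matrix_add_right: "F ** (G + G') = F ** G + F ** G'" for F :: "'b::comm_ring_1^'n^'m"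
  by (simp add: matrix_matrix_mult_def vec_eq_iff sum.distrib algebra_simps)

lemma matrix_zero_left [simp]: "0 ** F = (0 :: 'b^'k^'m)" for F :: "'b::comm_ring_1^'k^'n"
  by (simp add: matrix_matrix_mult_def vec_eq_iff)

lemma matrix_zero_right [simp]: "F ** 0 = (0 :: 'b^'k^'m)" for F :: "'b::comm_ring_1^'n^'m"
  by (simp add: matrix_matrix_mult_def vec_eq_iff)

lemmas matrix_ring_simps = matrix_uminus_left matrix_uminus_right matrix_diff_left matrix_diff_right
  matrix_add_left matrix_add_right matrix_mul_assoc smul_mult_left smul_mult_right smul_smul
  smul_add_right smul_diff_right smul_minus_right

lemma trace_cyclic: "trace (F ** G ** H) = trace (H ** F ** G)" for F :: "'b::comm_ring_1^'n^'n"
  by (metis matrix_mul_assoc trace_mul_sym)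

lemma mderiv_mult: "mderiv (F ** G) = mderiv F ** G + F ** mderiv G"
  by (simp add: mderiv_def matrix_matrix_mult_def vec_eq_iff fls_deriv_sum sum.distrib add.commute)

lemma mderiv_add: "mderiv (F + G) = mderiv F + mderiv G"
  by (simp add: mderiv_def vec_eq_iff)

lemma mderiv_diff: "mderiv (F - G) = mderiv F - mderiv G"
  by (simp add: mderiv_def vec_eq_iff)

lemma mderiv_smul: "mderiv (smul c F) = smul (fls_deriv c) F + smul c (mderiv F)"
  by (simp add: mderiv_def smul_def vec_eq_iff add.commute)

lemma mderiv_mconst [simp]: "mderiv (mconst X) = 0"
  by (simp add: mderiv_def mconst_def vec_eq_iff)

lemma trace_mderiv: "trace (mderiv F) = fls_deriv (trace F)"
  by (simp add: trace_def mderiv_def fls_deriv_sum)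

lemma mconst_0 [simp]: "mconst 0 = 0"
  by (simp add: mconst_def vec_eq_iff)

lemma mconst_add: "mconst (X + Y) = mconst X + mconst Y"
  by (simp add: mconst_def vec_eq_iff fls_plus_const)

lemma mconst_diff: "mconst (X - Y) = mconst X - mconst Y"
  by (simp add: mconst_def vec_eq_iff fls_minus_const)

lemma fls_const_sum: "fls_const (sum f I) = (\<Sum>i\<in>I. fls_const (f i :: complex))"
  by (induction I rule: infinite_finite_induct) (auto simp: fls_plus_const [symmetric])

lemma mconst_mult: "mconst (X ** Y) = mconst X ** mconst Y"
  by (simp add: mconst_def matrix_matrix_mult_def vec_eq_iff fls_const_sum fls_const_mult_const)

lemma mconst_1: "mconst (mat 1) = mat 1"
  by (simp add: mconst_def mat_def vec_eq_iff)

lemma mnth_mconst_mult_left: "mnth (mconst X ** F) k = X ** mnth F k"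
  by (simp add: mnth_def mconst_def matrix_matrix_mult_def vec_eq_iff fls_nth_sum)

lemma mnth_mconst_mult_right: "mnth (F ** mconst X) k = mnth F k ** X"
  by (simp add: mnth_def mconst_def matrix_matrix_mult_def vec_eq_iff fls_nth_sum)

lemma mnth_add: "mnth (F + G) k = mnth F k + mnth G k"
  by (simp add: mnth_def vec_eq_iff)

lemma mnth_0 [simp]: "mnth 0 k = 0"
  by (simp add: mnth_def vec_eq_iff)

lemma mat_ord_ge_add: "mat_ord_ge n F \<Longrightarrow> mat_ord_ge n G \<Longrightarrow> mat_ord_ge n (F + G)"
  by (simp add: mat_ord_ge_def fls_ord_ge_add)

lemma mat_ord_ge_diff: "mat_ord_ge n F \<Longrightarrow> mat_ord_ge n G \<Longrightarrow> mat_ord_ge n (F - G)"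
  by (simp add: mat_ord_ge_def fls_ord_ge_diff)

lemma mat_ord_ge_mono: "mat_ord_ge n F \<Longrightarrow> m \<le> n \<Longrightarrow> mat_ord_ge m F"
  by (auto simp: mat_ord_ge_def intro: fls_ord_ge_mono)

lemma mat_ord_ge_mult: "mat_ord_ge m F \<Longrightarrow> mat_ord_ge n G \<Longrightarrow> mat_ord_ge (m + n) (F ** G)"
  by (auto simp: mat_ord_ge_def matrix_matrix_mult_def intro!: fls_ord_ge_sum fls_ord_ge_mult)

lemma mat_ord_ge_smul: "fls_ord_ge m c \<Longrightarrow> mat_ord_ge n F \<Longrightarrow> mat_ord_ge (m + n) (smul c F)"
  by (auto simp: mat_ord_ge_def smul_def intro!: fls_ord_ge_mult)

lemma mat_ord_ge_mderiv: "mat_ord_ge n F \<Longrightarrow> mat_ord_ge (n - 1) (mderiv F)"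
  by (simp add: mat_ord_ge_def mderiv_def fls_ord_ge_deriv)

lemma mat_ord_ge_mderiv_0: "mat_ord_ge 0 F \<Longrightarrow> mat_ord_ge 0 (mderiv F)"
  by (simp add: mat_ord_ge_def mderiv_def fls_ord_ge_deriv_0)

lemma fls_ord_ge_trace: "mat_ord_ge n F \<Longrightarrow> fls_ord_ge n (trace F)"
  by (auto simp: mat_ord_ge_def trace_def intro!: fls_ord_ge_sum)

definition mcomm :: "'b::comm_ring_1^'n^'n \<Rightarrow> 'b^'n^'n \<Rightarrow> 'b^'n^'n" where
  "mcomm F G = F ** G - G ** F"

text \<open>The coefficient of the cocycle form in one coordinate: \<open>N\<close> expands the
  given form, \<open>F\<close> and \<open>G\<close> expand the two algebra elements.\<close>

definition cocycle_series :: "complex fls^'m^'m \<Rightarrow> complex fls^'m^'m \<Rightarrow> complex fls^'m^'m \<Rightarrow> complex fls" where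
  "cocycle_series N F G = trace (F ** mderiv G - mcomm F G ** N)"

section \<open>The cocycle identities for Laurent series\<close>

text \<open>The commutator terms of the two sides cancel, and what remains of their sum is d tr(F
  G).\<close>

lemma cocycle_series_antisym:
  "fls_residue (cocycle_series N F G) = - fls_residue (cocycle_series N G F)"
proof -
  have "cocycle_series N F G + cocycle_series N G F = fls_deriv (trace (F ** G))"
    unfolding cocycle_series_def trace_mderiv [symmetric] mderiv_mult mcomm_def
      matrix_diff_left trace_sub trace_add trace_mul_sym [of "mderiv F" G]
    by simp
  then have "fls_residue (cocycle_series N F G + cocycle_series N G F) = 0"
    by simp
  then show ?thesis
    by (simp add: eq_neg_iff_add_eq_0)
qed

text \<open>By the Jacobi identity the terms with \<open>N\<close> drop out. Cyclicity of the trace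
  turns the three derivative terms into the product rule for tr([F,G] H).\<close>

lemma cocycle_series_jacobi:
  "fls_residue (cocycle_series N (mcomm F G) H) + fls_residue (cocycle_series N (mcomm G H) F) +
   fls_residue (cocycle_series N (mcomm H F) G) = 0"
proof -
  have J: "trace (mcomm (mcomm F G) H ** N) + trace (mcomm (mcomm G H) F ** N) +
      trace (mcomm (mcomm H F) G ** N) = 0"
  proof -
    have "mcomm (mcomm F G) H + mcomm (mcomm G H) F + mcomm (mcomm H F) G = 0"
      unfolding mcomm_def by (simp add: matrix_ring_simps)
    then have "trace ((mcomm (mcomm F G) H + mcomm (mcomm G H) F + mcomm (mcomm H F) G) ** N) = 0"
      by (simp add: trace_0 [unfolded mat_0])
    then show ?thesis
      by (simp only: matrix_add_left trace_add)
  qed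
  have D: "trace (mcomm F G ** mderiv H) + trace (mcomm G H ** mderiv F) +
      trace (mcomm H F ** mderiv G) = fls_deriv (trace (mcomm F G ** H))"
    using trace_cyclic [of G H "mderiv F"] trace_cyclic [of G "mderiv F" H]
      trace_cyclic [of F "mderiv G" H] trace_cyclic [of F H "mderiv G"]
    unfolding trace_mderiv [symmetric] mderiv_mult mcomm_def mderiv_diff
    by (simp add: matrix_add_left matrix_diff_left matrix_mul_assoc trace_add trace_sub)
  have "cocycle_series N (mcomm F G) H + cocycle_series N (mcomm G H) F +
      cocycle_series N (mcomm H F) G = fls_deriv (trace (mcomm F G ** H))"
    unfolding cocycle_series_def trace_sub using J D by (simp add: algebra_simps)
  then have "fls_residue (cocycle_series N (mcomm F G) H + cocycle_series N (mcomm G H) F +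
      cocycle_series N (mcomm H F) G) = 0"
    by simp
  then show ?thesis by simp
qed

lemma cocycle_series_add_left:
  "cocycle_series N (F + F') G = cocycle_series N F G + cocycle_series N F' G"
  unfolding cocycle_series_def mcomm_def
  by (simp add: matrix_ring_simps trace_add trace_sub)

lemma cocycle_series_add_right:
  "cocycle_series N F (G + G') = cocycle_series N F G + cocycle_series N F G'"
  unfolding cocycle_series_def mcomm_def mderiv_add
  by (simp add: matrix_ring_simps trace_add trace_sub)

lemma cocycle_series_scale_left:
  "cocycle_series N (smul c F) G = c * cocycle_series N F G"
  unfolding cocycle_series_def mcomm_def
  by (simp add: matrix_ring_simps trace_smul trace_sub right_diff_distrib)

text \<open>Constants only: the second argument is differentiated, so a nonconstant factor would
  leave its derivative behind. The first argument admits any series as a factor.\<close>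

lemma cocycle_series_scale_right:
  "cocycle_series N F (smul (fls_const c) G) = fls_const c * cocycle_series N F G"
  unfolding cocycle_series_def mcomm_def mderiv_smul
  by (simp add: matrix_ring_simps trace_smul trace_sub trace_add right_diff_distrib)

text \<open>Differentiation costs one order and the factor \<open>N\<close> costs \<open>- c\<close>
  orders; \<open>c \<le> -1\<close> lets one bound serve both terms.\<close>

lemma cocycle_series_ord_ge:
  assumes "mat_ord_ge a F" "mat_ord_ge b G" "mat_ord_ge c N" "c \<le> -1"
  shows "fls_ord_ge (a + b + c) (cocycle_series N F G)"
proof -
  have "mat_ord_ge (a + b + c) (F ** mderiv G)"
    using mat_ord_ge_mult [OF assms(1) mat_ord_ge_mderiv [OF assms(2)]]
    by (rule mat_ord_ge_mono) (use assms(4) in simp)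
  moreover have "mat_ord_ge (a + b) (mcomm F G)"
    unfolding mcomm_def using mat_ord_ge_mult assms(1,2)
    by (metis add.commute mat_ord_ge_diff)
  then have "mat_ord_ge (a + b + c) (mcomm F G ** N)"
    using assms(3) by (rule mat_ord_ge_mult)
  ultimately show ?thesis
    unfolding cocycle_series_def by (intro fls_ord_ge_trace mat_ord_ge_diff)
qed

section \<open>The gauge transformation at a weak singularity\<close>

lemma scalar_product_commute: "scalar_product u v = scalar_product v u" for u :: "complex^'m"
  by (simp add: scalar_product_def mult.commute)

lemma scalar_product_vector_matrix: "scalar_product (u v* M) v = scalar_product u (M *v v)" for M :: "complex^'n^'m"
proof -
  have "scalar_product u (M *v v) = (\<Sum>i\<in>UNIV. \<Sum>j\<in>UNIV. u $ i * M $ i $ j * v $ j)"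
    by (simp add: scalar_product_def matrix_vector_mult_def sum_distrib_left mult.assoc)
  also have "\<dots> = (\<Sum>j\<in>UNIV. \<Sum>i\<in>UNIV. u $ i * M $ i $ j * v $ j)"
    by (rule sum.swap)
  also have "\<dots> = scalar_product (u v* M) v"
    by (simp add: scalar_product_def vector_matrix_mult_def sum_distrib_left sum_distrib_right mult_ac)
  finally show ?thesis ..
qed

lemma bilin_vector_matrix: "bilin B u v = scalar_product (u v* B) v"
  by (simp only: bilin_def scalar_product_vector_matrix)

lemma bilin_skew:
  assumes "transpose \<sigma> = - \<sigma>"
  shows "bilin \<sigma> u v = - bilin \<sigma> v u"
proof -
  have s: "\<sigma> $ i $ j = - \<sigma> $ j $ i" for i j
    using arg_cong [OF assms, of "\<lambda>B. B $ j $ i"] by (simp add: transpose_def)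
  have t: "u $ i * (\<sigma> $ i $ j * v $ j) = - (v $ j * (\<sigma> $ j $ i * u $ i))" for i j
    using arg_cong [OF s [of i j], of "\<lambda>c. u $ i * v $ j * c"] by (simp add: mult_ac)
  have "bilin \<sigma> u v = (\<Sum>i\<in>UNIV. \<Sum>j\<in>UNIV. u $ i * (\<sigma> $ i $ j * v $ j))"
    by (simp add: bilin_def scalar_product_def matrix_vector_mult_def sum_distrib_left)
  also have "\<dots> = (\<Sum>j\<in>UNIV. \<Sum>i\<in>UNIV. u $ i * (\<sigma> $ i $ j * v $ j))"
    by (rule sum.swap)
  also have "\<dots> = - (\<Sum>j\<in>UNIV. \<Sum>i\<in>UNIV. v $ j * (\<sigma> $ j $ i * u $ i))"
    unfolding sum_negf [symmetric] by (intro sum.cong refl t)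
  also have "\<dots> = - bilin \<sigma> v u"
    by (simp add: bilin_def scalar_product_def matrix_vector_mult_def sum_distrib_left)
  finally show ?thesis .
qed

lemma outer_mult_outer: "outer u v ** outer u' v' = smul (scalar_product v u') (outer u v')"
  by (simp add: outer_def smul_def matrix_matrix_mult_def scalar_product_def vec_eq_iff
      sum_distrib_left sum_distrib_right mult_ac)

lemma outer_mult: "outer u v ** X = outer u (v v* X)"
  by (simp add: outer_def matrix_matrix_mult_def vector_matrix_mult_def vec_eq_iff
      sum_distrib_left mult_ac)

lemma mult_outer: "X ** outer u v = outer (X *v u) v"
  by (simp add: outer_def matrix_matrix_mult_def matrix_vector_mult_def vec_eq_iff
      sum_distrib_left sum_distrib_right mult_ac)

lemma outer_vector: "outer u v *v w = scalar_product v w *s u"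
  by (simp add: outer_def matrix_vector_mult_def scalar_product_def vec_eq_iff sum_distrib_left mult_ac)

lemma outer_add_left: "outer (u + u') v = outer u v + outer u' v"
  by (simp add: outer_def vec_eq_iff algebra_simps)

lemma outer_add_right: "outer u (v + v') = outer u v + outer u v'"
  by (simp add: outer_def vec_eq_iff algebra_simps)

lemma outer_scale_left: "outer (c *s u) v = smul c (outer u v)"
  by (simp add: outer_def smul_def vec_eq_iff)

lemma outer_scale_right: "outer u (c *s v) = smul c (outer u v)"
  by (simp add: outer_def smul_def vec_eq_iff)

lemma outer_minus_right: "outer u (- v) = - outer u v"
  by (simp add: outer_def vec_eq_iff)

lemma outer_minus_left: "outer (- u) v = - outer u v"
  by (simp add: outer_def vec_eq_iff)

lemma scalar_product_scale_right: "scalar_product u (c *s v) = c * scalar_product u v" for c :: complex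
  by (simp add: scalar_product_def sum_distrib_left mult_ac)

lemma scalar_product_add_left: "scalar_product (u + u') v = scalar_product u v + scalar_product u' v" for u :: "complex^'m"
  by (simp add: scalar_product_def sum.distrib algebra_simps)

text \<open>The projections onto the eigenspaces of the grading element, for the eigenvalues \<open>-1\<close> (the line
  of \<open>a\<close>), \<open>1\<close> (the line of \<open>b\<close>) and \<open>0\<close>.\<close>

definition proj_neg :: "complex^'m^'m \<Rightarrow> complex^'m \<Rightarrow> complex^'m \<Rightarrow> complex^'m^'m" where
  "proj_neg \<sigma> a b = outer a (b v* \<sigma>)"

definition proj_pos :: "complex^'m^'m \<Rightarrow> complex^'m \<Rightarrow> complex^'m \<Rightarrow> complex^'m^'m" where
  "proj_pos \<sigma> a b = - outer b (a v* \<sigma>)"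

definition proj_zero :: "complex^'m^'m \<Rightarrow> complex^'m \<Rightarrow> complex^'m \<Rightarrow> complex^'m^'m" where
  "proj_zero \<sigma> a b = mat 1 - proj_neg \<sigma> a b - proj_pos \<sigma> a b"

text \<open>By skewness \<open>bilin \<sigma> a b\<close> is then -1, which explains the minus sign
  in \<open>proj_pos\<close>.\<close>

definition symp_pair :: "complex^'m^'m \<Rightarrow> complex^'m \<Rightarrow> complex^'m \<Rightarrow> bool" where
  "symp_pair \<sigma> a b \<longleftrightarrow> transpose \<sigma> = - \<sigma> \<and> bilin \<sigma> b a = 1"

lemma symp_pairD:
  assumes "symp_pair \<sigma> a b"
  shows "scalar_product (b v* \<sigma>) a = 1" "scalar_product (a v* \<sigma>) b = -1"
    "scalar_product (a v* \<sigma>) a = 0" "scalar_product (b v* \<sigma>) b = 0"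
  using assms bilin_skew [of \<sigma> a b] bilin_skew [of \<sigma> a a] bilin_skew [of \<sigma> b b]
  by (auto simp: symp_pair_def bilin_vector_matrix)

lemma proj_mult:
  assumes "symp_pair \<sigma> a b"
  shows "proj_neg \<sigma> a b ** proj_neg \<sigma> a b = proj_neg \<sigma> a b"
    "proj_pos \<sigma> a b ** proj_pos \<sigma> a b = proj_pos \<sigma> a b"
    "proj_neg \<sigma> a b ** proj_pos \<sigma> a b = 0"
    "proj_pos \<sigma> a b ** proj_neg \<sigma> a b = 0"
    "proj_zero \<sigma> a b ** proj_neg \<sigma> a b = 0"
    "proj_neg \<sigma> a b ** proj_zero \<sigma> a b = 0"
    "proj_zero \<sigma> a b ** proj_pos \<sigma> a b = 0"
    "proj_pos \<sigma> a b ** proj_zero \<sigma> a b = 0"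
    "proj_zero \<sigma> a b ** proj_zero \<sigma> a b = proj_zero \<sigma> a b"
  using symp_pairD [OF assms]
  by (simp_all add: proj_neg_def proj_pos_def proj_zero_def matrix_ring_simps outer_mult_outer
      matrix_mul_lid matrix_mul_rid smul_minus_left)

text \<open>This is z^h in its spectral decomposition, so products and derivatives reduce to
  relations between the three projections.\<close>

definition lax_gauge :: "complex^'m^'m \<Rightarrow> complex^'m \<Rightarrow> complex^'m \<Rightarrow> complex fls^'m^'m" where
  "lax_gauge \<sigma> a b = smul fls_X_inv (mconst (proj_neg \<sigma> a b)) + mconst (proj_zero \<sigma> a b) +
     smul fls_X (mconst (proj_pos \<sigma> a b))"

definition gauge_inv :: "complex^'m^'m \<Rightarrow> complex^'m \<Rightarrow> complex^'m \<Rightarrow> complex fls^'m^'m" where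
  "gauge_inv \<sigma> a b = smul fls_X (mconst (proj_neg \<sigma> a b)) + mconst (proj_zero \<sigma> a b) +
     smul fls_X_inv (mconst (proj_pos \<sigma> a b))"

lemma fls_X_X_inv [simp]: "fls_X * fls_X_inv = (1 :: complex fls)" "fls_X_inv * fls_X = (1 :: complex fls)"
  using right_inverse [of "fls_X :: complex fls"] left_inverse [of "fls_X :: complex fls"]
  by (simp_all only: fls_inverse_X fls_X_nonzero not_False_eq_True simp_thms)

lemma gauge_mult:
  assumes "symp_pair \<sigma> a b"
  shows "lax_gauge \<sigma> a b ** gauge_inv \<sigma> a b = mat 1" "gauge_inv \<sigma> a b ** lax_gauge \<sigma> a b = mat 1"
proof -
  have *: "mconst (proj_neg \<sigma> a b) + mconst (proj_zero \<sigma> a b) + mconst (proj_pos \<sigma> a b) = mat 1"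
    by (simp add: mconst_add [symmetric] proj_zero_def mconst_1)
  then show "lax_gauge \<sigma> a b ** gauge_inv \<sigma> a b = mat 1" "gauge_inv \<sigma> a b ** lax_gauge \<sigma> a b = mat 1"
    by (simp_all add: lax_gauge_def gauge_inv_def matrix_ring_simps mconst_mult [symmetric]
        proj_mult [OF assms])
qed

text \<open>The formal version of d(z^h) = h z^h dz / z; the grading element h is
  \<open>proj_pos \<sigma> a b - proj_neg \<sigma> a b\<close>.\<close>

lemma mderiv_gauge:
  assumes "symp_pair \<sigma> a b"
  shows "mderiv (lax_gauge \<sigma> a b) =
    smul fls_X_inv (mconst (proj_pos \<sigma> a b - proj_neg \<sigma> a b)) ** lax_gauge \<sigma> a b"
  unfolding lax_gauge_def mderiv_add mderiv_smul
  by (simp add: matrix_ring_simps mconst_mult [symmetric] mconst_diff proj_mult [OF assms] 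
     fls_deriv_X_inv power2_eq_square smul_minus_left)

text \<open>Recovers M from L = g M g^-1, hence the inverse on the left.\<close>

definition gauged :: "complex^'m^'m \<Rightarrow> complex^'m \<Rightarrow> complex^'m \<Rightarrow> complex fls^'m^'m \<Rightarrow> complex fls^'m^'m" where
  "gauged \<sigma> a b F = gauge_inv \<sigma> a b ** F ** lax_gauge \<sigma> a b"

lemma gauged_add: "gauged \<sigma> a b (F + G) = gauged \<sigma> a b F + gauged \<sigma> a b G"
  by (simp add: gauged_def matrix_ring_simps)

lemma gauged_diff: "gauged \<sigma> a b (F - G) = gauged \<sigma> a b F - gauged \<sigma> a b G"
  by (simp add: gauged_def matrix_ring_simps)

lemma gauged_mult:
  assumes "symp_pair \<sigma> a b"
  shows "gauged \<sigma> a b (F ** G) = gauged \<sigma> a b F ** gauged \<sigma> a b G"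
proof -
  have "gauged \<sigma> a b F ** gauged \<sigma> a b G =
      gauge_inv \<sigma> a b ** F ** (lax_gauge \<sigma> a b ** gauge_inv \<sigma> a b) ** G ** lax_gauge \<sigma> a b"
    by (simp only: gauged_def matrix_mul_assoc)
  then show ?thesis
    by (simp add: gauge_mult [OF assms] gauged_def matrix_mul_assoc matrix_mul_rid)
qed

lemma gauged_mcomm:
  assumes "symp_pair \<sigma> a b"
  shows "gauged \<sigma> a b (mcomm F G) = mcomm (gauged \<sigma> a b F) (gauged \<sigma> a b G)"
  by (simp add: mcomm_def gauged_diff gauged_mult [OF assms])

lemma trace_gauged:
  assumes "symp_pair \<sigma> a b"
  shows "trace (gauged \<sigma> a b F) = trace F"
  unfolding gauged_def trace_cyclic [of "gauge_inv \<sigma> a b"]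
  by (simp add: gauge_mult [OF assms] matrix_mul_lid)

text \<open>Below, \<open>H\<close> is the logarithmic derivative of the gauge transformation; it is minus the polar part
  that \<open>lax_form_at\<close> prescribes.\<close>

lemma gauged_mderiv:
  assumes "symp_pair \<sigma> a b"
  defines "H \<equiv> smul fls_X_inv (mconst (proj_pos \<sigma> a b - proj_neg \<sigma> a b))"
  shows "mderiv (gauged \<sigma> a b G) = gauged \<sigma> a b (mderiv G - mcomm H G)"
proof -
  define g g' where "g = lax_gauge \<sigma> a b" and "g' = gauge_inv \<sigma> a b"
  have gg: "g ** g' = mat 1" "g' ** g = mat 1"
    using gauge_mult [OF assms(1)] by (simp_all add: g_def g'_def)
  have dg: "mderiv g = H ** g"
    using mderiv_gauge [OF assms(1)] by (simp add: g_def H_def)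
  \<comment> \<open>The derivative of the inverse comes from differentiating
    \<open>g' ** g = mat 1\<close>.\<close>
  have "mderiv g' ** g + g' ** (H ** g) = 0"
    using mderiv_mult [of g' g] dg by (simp add: gg mconst_1 [symmetric])
  then have "(mderiv g' ** g + g' ** (H ** g)) ** g' = 0"
    by simp
  then have "mderiv g' ** (g ** g') + g' ** H ** (g ** g') = 0"
    by (simp only: matrix_add_left matrix_mul_assoc)
  then have dg': "mderiv g' = - (g' ** H)"
    by (simp add: gg matrix_mul_rid eq_neg_iff_add_eq_0)
  show ?thesis
    unfolding gauged_def g_def [symmetric] g'_def [symmetric] mderiv_mult dg dg' mcomm_def
    by (simp add: matrix_ring_simps)
qed

text \<open>Gauging changes the derivative of \<open>G\<close> by a commutator with
  \<open>H\<close>. Under the trace that commutator moves over to \<open>F\<close> and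
  \<open>G\<close>, where it is absorbed by replacing \<open>N\<close> with \<open>N + H\<close>:
  the usual transformation of a connection.\<close>

lemma cocycle_series_gauged:
  assumes "symp_pair \<sigma> a b"
  defines "H \<equiv> smul fls_X_inv (mconst (proj_pos \<sigma> a b - proj_neg \<sigma> a b))"
  shows "cocycle_series N F G =
    cocycle_series (gauged \<sigma> a b (N + H)) (gauged \<sigma> a b F) (gauged \<sigma> a b G)"
proof -
  \<comment> \<open>Invariance of the trace form under the adjoint action.\<close>
  have *: "trace (F ** mcomm H G) = - trace (mcomm F G ** H)"
    using trace_cyclic [of F G H] trace_cyclic [of F H G] trace_cyclic [of G F H]
    by (simp add: mcomm_def matrix_ring_simps trace_sub)
  have "cocycle_series (gauged \<sigma> a b (N + H)) (gauged \<sigma> a b F) (gauged \<sigma> a b G) =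
     trace (gauged \<sigma> a b (F ** (mderiv G - mcomm H G) - mcomm F G ** (N + H)))"
    unfolding cocycle_series_def H_def gauged_mderiv [OF assms(1)]
    by (simp only: gauged_mult [OF assms(1)] gauged_mcomm [OF assms(1)] gauged_diff)
  also have "\<dots> = cocycle_series N F G"
    unfolding trace_gauged [OF assms(1)] cocycle_series_def using *
    by (simp add: matrix_diff_right matrix_add_right trace_sub trace_add)
  finally show ?thesis ..
qed

section \<open>The Lax conditions as regularity after gauging\<close>

lemma vector_matrix_add_left: "(u + v) v* M = u v* M + v v* M" for M :: "complex^'n^'m"
  by (simp add: vector_matrix_mult_def vec_eq_iff sum.distrib algebra_simps)

lemma vector_matrix_minus_left: "(- u) v* M = - (u v* M)" for M :: "complex^'n^'m"
  by (simp add: vector_matrix_mult_def vec_eq_iff sum_negf)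

lemma vector_matrix_minus_right: "u v* (- M) = - (u v* M)" for M :: "complex^'n^'m"
  by (simp add: vector_matrix_mult_def vec_eq_iff sum_negf)

lemma matrix_vector_mult_minus_left: "(- M) *v u = - (M *v u)" for M :: "complex^'n^'m"
  by (simp add: matrix_vector_mult_def vec_eq_iff sum_negf)

lemma vector_matrix_scale_left: "(c *s u) v* M = c *s (u v* M)" for M :: "complex^'n^'m"
  by (simp add: vector_matrix_mult_def vec_eq_iff sum_distrib_left mult_ac)

lemma outer_0_left: "outer 0 v = 0"
  by (simp add: outer_def vec_eq_iff)

lemma scalar_product_0_right: "scalar_product u 0 = 0"
  by (simp add: scalar_product_def)

text \<open>The relation defining \<open>sp\<close>, multiplied by \<open>\<sigma>\<close> from the
  right. In this form it is linear with constant coefficients and passes directly to Laurent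
  coefficients.\<close>

definition sp_like :: "complex^'m^'m \<Rightarrow> complex^'m^'m \<Rightarrow> bool" where
  "sp_like \<sigma> X \<longleftrightarrow> transpose X ** \<sigma> = - (\<sigma> ** X)"

text \<open>Skewness with respect to \<open>\<sigma>\<close>, phrased for row vectors. It converts
  what is known about the columns of a Laurent coefficient into information about its rows.\<close>

lemma sp_likeD:
  assumes "sp_like \<sigma> X"
  shows "(v v* \<sigma>) v* X = - ((X *v v) v* \<sigma>)"
proof -
  have "(v v* \<sigma>) v* X = v v* (\<sigma> ** X)"
    by (simp add: vector_matrix_mul_assoc)
  also have "\<sigma> ** X = - (transpose X ** \<sigma>)"
    using assms by (simp add: sp_like_def)
  also have "v v* (- (transpose X ** \<sigma>)) = - ((v v* transpose X) v* \<sigma>)"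
    by (simp only: vector_matrix_minus_right vector_matrix_mul_assoc)
  also have "v v* transpose X = X *v v"
    by (metis transpose_matrix_vector transpose_transpose)
  finally show ?thesis .
qed

text \<open>The conditions of \<open>lax_at\<close> as a property of a series alone, so that they
  can be tested on formal products and sums.\<close>

definition lax_series :: "complex^'m^'m \<Rightarrow> complex^'m \<Rightarrow> complex fls^'m^'m \<Rightarrow> bool" where
  "lax_series \<sigma> a F \<longleftrightarrow> (\<forall>k < -2. mnth F k = 0) \<and>
     (\<exists>\<nu> k \<beta>.
        mnth F (-2) = cscale \<nu> (outer a a ** \<sigma>) \<and>
        mnth F (-1) = (outer a \<beta> + outer \<beta> a) ** \<sigma> \<and>
        bilin \<sigma> \<beta> a = 0 \<and>
        mnth F 0 *v a = k *s a \<and>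
        bilin (\<sigma> ** mnth F 1) a a = 0)"

lemma mnth_smul_X: "mnth (smul fls_X F) k = mnth F (k - 1)"
  by (simp add: mnth_def smul_def fls_X_times_conv_shift vec_eq_iff)

lemma mnth_smul_X_inv: "mnth (smul fls_X_inv F) k = mnth F (k + 1)"
  by (simp add: mnth_def smul_def fls_X_inv_times_conv_shift vec_eq_iff)

lemma mnth_gauged:
  defines "n \<equiv> proj_neg" and "z \<equiv> proj_zero" and "p \<equiv> proj_pos"
  shows "mnth (gauged \<sigma> a b F) k =
    n \<sigma> a b ** mnth F k ** n \<sigma> a b + n \<sigma> a b ** mnth F (k - 1) ** z \<sigma> a b +
    n \<sigma> a b ** mnth F (k - 2) ** p \<sigma> a b +
    z \<sigma> a b ** mnth F (k + 1) ** n \<sigma> a b + z \<sigma> a b ** mnth F k ** z \<sigma> a b +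
    z \<sigma> a b ** mnth F (k - 1) ** p \<sigma> a b +
    p \<sigma> a b ** mnth F (k + 2) ** n \<sigma> a b + p \<sigma> a b ** mnth F (k + 1) ** z \<sigma> a b +
    p \<sigma> a b ** mnth F k ** p \<sigma> a b"
  unfolding gauged_def lax_gauge_def gauge_inv_def n_def z_def p_def
  by (simp add: matrix_add_left matrix_add_right smul_mult_left smul_mult_right smul_add_right
      mnth_add mnth_smul_X mnth_smul_X_inv mnth_mconst_mult_left mnth_mconst_mult_right algebra_simps)

text \<open>A block mapping weight \<open>j\<close> to weight \<open>i\<close> is multiplied by \<open>z\<close> to the power \<open>j - i\<close>, so it
  must vanish to order \<open>i - j\<close>; this is the form in which the Lax conditions are checked.\<close>

lemma gauged_regular_iff:
  assumes "symp_pair \<sigma> a b"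
  defines "n \<equiv> proj_neg \<sigma> a b" and "z \<equiv> proj_zero \<sigma> a b" and "p \<equiv> proj_pos \<sigma> a b"
  shows "mat_ord_ge 0 (gauged \<sigma> a b F) \<longleftrightarrow>
    (\<forall>k<0. n ** mnth F k ** n = 0 \<and> n ** mnth F (k - 1) ** z = 0 \<and> n ** mnth F (k - 2) ** p = 0 \<and>
      z ** mnth F (k + 1) ** n = 0 \<and> z ** mnth F k ** z = 0 \<and> z ** mnth F (k - 1) ** p = 0 \<and>
      p ** mnth F (k + 2) ** n = 0 \<and> p ** mnth F (k + 1) ** z = 0 \<and> p ** mnth F k ** p = 0)"
    (is "?L \<longleftrightarrow> ?R")
proof
  assume ?L
  show ?R
  proof (intro allI impI)
    fix k :: int
    assume "k < 0"
    then have eq: "mnth (gauged \<sigma> a b F) k = 0"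
      using \<open>?L\<close> by (simp add: mat_ord_ge_iff)
    note pm = proj_mult [OF assms(1), folded n_def z_def p_def]
    have pm': "M ** n ** n = M ** n" "M ** n ** z = 0" "M ** n ** p = 0"
      "M ** z ** n = 0" "M ** z ** z = M ** z" "M ** z ** p = 0"
      "M ** p ** n = 0" "M ** p ** z = 0" "M ** p ** p = M ** p" for M
      unfolding matrix_mul_assoc [symmetric] pm by simp_all
    \<comment> \<open>Sandwiching between two projections isolates one block of the nine-term
      sum.\<close>
    have "A ** mnth (gauged \<sigma> a b F) k ** B = 0" for A B
      by (simp add: eq)
    from this [of n n] this [of n z] this [of n p] this [of z n] this [of z z] this [of z p]
      this [of p n] this [of p z] this [of p p]
    show "n ** mnth F k ** n = 0 \<and> n ** mnth F (k - 1) ** z = 0 \<and> n ** mnth F (k - 2) ** p = 0 \<and>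
      z ** mnth F (k + 1) ** n = 0 \<and> z ** mnth F k ** z = 0 \<and> z ** mnth F (k - 1) ** p = 0 \<and>
      p ** mnth F (k + 2) ** n = 0 \<and> p ** mnth F (k + 1) ** z = 0 \<and> p ** mnth F k ** p = 0"
      unfolding mnth_gauged n_def [symmetric] z_def [symmetric] p_def [symmetric]
      by (simp add: matrix_add_left matrix_add_right matrix_mul_assoc pm pm')
  qed
next
  assume ?R
  then show ?L
    unfolding mat_ord_ge_iff mnth_gauged n_def z_def p_def by simp
qed

lemma matrix_nine_terms:
  fixes X :: "complex^'m^'m" and \<sigma> :: "complex^'m^'m" and a b :: "complex^'m"
  defines "n \<equiv> proj_neg \<sigma> a b" and "z \<equiv> proj_zero \<sigma> a b" and "p \<equiv> proj_pos \<sigma> a b"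
  shows "X = n ** X ** n + n ** X ** z + n ** X ** p + z ** X ** n + z ** X ** z + z ** X ** p +
    p ** X ** n + p ** X ** z + p ** X ** p"
proof -
  have 1: "n + z + p = mat 1"
    by (simp add: n_def z_def p_def proj_zero_def)
  have "X = (n + z + p) ** X ** (n + z + p)"
    unfolding 1 by (simp add: matrix_mul_lid matrix_mul_rid)
  then show ?thesis
    by (simp add: matrix_add_left matrix_add_right algebra_simps)
qed

text \<open>Each Lax condition disposes of certain blocks. The double pole maps \<open>b\<close> to
  the line of \<open>a\<close> and does nothing else. As \<open>\<beta>\<close> is
  \<open>\<sigma>\<close>-orthogonal to \<open>a\<close>, the residue consists of blocks that lower
  the weight. The constant term preserves the line of \<open>a\<close> and, by skewness, its
  \<open>\<sigma>\<close>-orthogonal complement. The last condition removes the block from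
  \<open>a\<close> to \<open>b\<close> at order 1.\<close>

lemma lax_series_imp_gauged_regular:
  assumes sp: "symp_pair \<sigma> a b" and sl: "\<And>k. sp_like \<sigma> (mnth F k)" and lax: "lax_series \<sigma> a F"
  shows "mat_ord_ge 0 (gauged \<sigma> a b F)"
proof -
  define n z p where "n = proj_neg \<sigma> a b" and "z = proj_zero \<sigma> a b" and "p = proj_pos \<sigma> a b"
  note pm = proj_mult [OF sp, folded n_def z_def p_def]
  note D = symp_pairD [OF sp]
  note smp = n_def proj_neg_def p_def proj_pos_def outer_mult mult_outer outer_vector outer_mult_outer
  obtain \<nu> k \<beta> where L:
    "\<And>j. j < -2 \<Longrightarrow> mnth F j = 0"
    "mnth F (-2) = smul \<nu> (outer a (a v* \<sigma>))"
    "mnth F (-1) = outer a (\<beta> v* \<sigma>) + outer \<beta> (a v* \<sigma>)"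
    "scalar_product (\<beta> v* \<sigma>) a = 0" "mnth F 0 *v a = k *s a"
    "scalar_product (a v* \<sigma>) (mnth F 1 *v a) = 0"
    using lax unfolding lax_series_def cscale_smul
    by (auto simp: outer_mult matrix_add_left bilin_vector_matrix vector_matrix_mul_assoc [symmetric]
        scalar_product_vector_matrix)
  have b0: "scalar_product (a v* \<sigma>) \<beta> = 0"
    using bilin_skew [of \<sigma> a \<beta>] sp L(4) by (simp add: symp_pair_def bilin_vector_matrix)
  have pav: "n *v a = a" "p *v a = 0"
    using D by (simp_all add: n_def p_def proj_neg_def proj_pos_def matrix_vector_mult_minus_left outer_vector)
  then have "z *v a = 0"
    by (simp add: z_def proj_zero_def n_def [symmetric] p_def [symmetric] matrix_vector_mult_diff_rdistrib)
  then have za: "z ** outer a v = 0" for v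
    by (simp add: mult_outer outer_0_left)
  have pa: "p ** outer a v = 0" for v
    by (simp add: mult_outer pav outer_0_left)
  have az: "outer v (a v* \<sigma>) ** z = 0" for v
    using D by (simp add: z_def proj_zero_def smp matrix_ring_simps smul_minus_left outer_0_left outer_minus_left)
  have an: "outer v (a v* \<sigma>) ** n = 0" for v
    using D by (simp add: smp outer_0_left)
  have m3: "A ** mnth F j ** B = 0" if "j < -2" for A B j
    using L(1) [OF that] by simp
  have m2: "z ** mnth F (-2) = 0" "p ** mnth F (-2) = 0" "A ** mnth F (-2) ** n = 0"
    "A ** mnth F (-2) ** z = 0" for A
    unfolding matrix_mul_assoc [symmetric, of A]
    using za pa an az by (simp_all add: L(2) smul_mult_left smul_mult_right)
  have m1: "A ** mnth F (-1) ** n = 0" for A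
    unfolding matrix_mul_assoc [symmetric, of A]
    using an L(4) by (simp add: L(3) matrix_add_left) (simp add: smp outer_0_left)
  have m1': "p ** mnth F (-1) = 0"
    using pa b0 by (simp add: L(3) matrix_add_right)
      (simp add: smp matrix_vector_mult_minus_left outer_0_left)
  have m1'': "z ** mnth F (-1) ** z = 0"
    using za az by (simp add: L(3) matrix_add_right matrix_add_left)
       (simp add: matrix_mul_assoc [symmetric])
  have m0: "A ** mnth F 0 ** n = smul k (A ** n)" for A
    unfolding matrix_mul_assoc [symmetric, of A]
    by (simp add: n_def proj_neg_def mult_outer L(5) outer_scale_left smul_mult_right)
  \<comment> \<open>By skewness the eigenvector \<open>a\<close> yields the left eigenvector
    \<open>a v* \<sigma>\<close>, with the opposite eigenvalue.\<close>
  have m0': "p ** mnth F 0 = smul (- k) p"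
    using sp_likeD [OF sl [of 0], of a] L(5)
    by (simp add: p_def proj_pos_def outer_mult matrix_uminus_left outer_minus_right
        vector_matrix_scale_left outer_scale_right smul_minus_right smul_minus_left)
  have m_1: "p ** mnth F 1 ** n = 0"
    using L(6) by (simp add: smp matrix_uminus_left scalar_product_vector_matrix
        matrix_vector_mult_minus_left outer_0_left)
  show ?thesis
    unfolding gauged_regular_iff [OF sp] n_def [symmetric] z_def [symmetric] p_def [symmetric]
  proof (intro allI impI)
    fix j :: int
    assume "j < 0"
    \<comment> \<open>For \<open>j < -4\<close> even the largest index involved,
      \<open>j + 2\<close>, lies below -2.\<close>
    then consider "j = -1" | "j = -2" | "j = -3" | "j = -4" | "j < -4" by linarith
    then show "n ** mnth F j ** n = 0 \<and> n ** mnth F (j - 1) ** z = 0 \<and> n ** mnth F (j - 2) ** p = 0 \<and>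
      z ** mnth F (j + 1) ** n = 0 \<and> z ** mnth F j ** z = 0 \<and> z ** mnth F (j - 1) ** p = 0 \<and>
      p ** mnth F (j + 2) ** n = 0 \<and> p ** mnth F (j + 1) ** z = 0 \<and> p ** mnth F j ** p = 0"
      by cases (simp_all add: m3 m2 m1 m1' m1'' m0 m0' m_1 pm smul_mult_left)
  qed
qed

text \<open>The witnesses are read off from the values of the coefficients at \<open>a\<close> and
  \<open>b\<close>. That a single \<open>\<beta>\<close> accounts for both outer blocks of the
  residue is due to skewness, which determines one of them by the other.\<close>

lemma gauged_regular_imp_lax_series:
  assumes sp: "symp_pair \<sigma> a b" and sl: "\<And>k. sp_like \<sigma> (mnth F k)"
    and reg: "mat_ord_ge 0 (gauged \<sigma> a b F)"
  shows "lax_series \<sigma> a F"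
proof -
  define n z p where "n = proj_neg \<sigma> a b" and "z = proj_zero \<sigma> a b" and "p = proj_pos \<sigma> a b"
  note D = symp_pairD [OF sp]
  note smp = n_def proj_neg_def p_def proj_pos_def outer_mult mult_outer outer_vector outer_mult_outer
  have R: "n ** mnth F k ** n = 0 \<and> n ** mnth F (k - 1) ** z = 0 \<and> n ** mnth F (k - 2) ** p = 0 \<and>
      z ** mnth F (k + 1) ** n = 0 \<and> z ** mnth F k ** z = 0 \<and> z ** mnth F (k - 1) ** p = 0 \<and>
      p ** mnth F (k + 2) ** n = 0 \<and> p ** mnth F (k + 1) ** z = 0 \<and> p ** mnth F k ** p = 0"
    if "k < 0" for k
    using reg that unfolding gauged_regular_iff [OF sp] n_def [symmetric] z_def [symmetric] p_def [symmetric]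
    by blast
  have nn: "n ** mnth F j ** n = 0" and zz: "z ** mnth F j ** z = 0" and pp: "p ** mnth F j ** p = 0"
    if "j < 0" for j
    using R [OF that] by auto
  have nz: "n ** mnth F j ** z = 0" and zp: "z ** mnth F j ** p = 0" if "j < -1" for j
    using R [of "j + 1"] that by auto
  have np: "n ** mnth F j ** p = 0" if "j < -2" for j
    using R [of "j + 2"] that by auto
  have zn: "z ** mnth F j ** n = 0" and pz: "p ** mnth F j ** z = 0" if "j < 1" for j
    using R [of "j - 1"] that by auto
  have pn: "p ** mnth F j ** n = 0" if "j < 2" for j
    using R [of "j - 2"] that by auto
  have sum: "n + z + p = mat 1"
    by (simp add: n_def z_def p_def proj_zero_def)
  note nine = matrix_nine_terms [of _ \<sigma> a b, folded n_def z_def p_def]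
  have Xn: "X ** n = n ** X ** n + z ** X ** n + p ** X ** n" for X
    by (metis (no_types) matrix_add_left matrix_mul_lid sum)
  have Xp: "X ** p = n ** X ** p + z ** X ** p + p ** X ** p" for X
    by (metis (no_types) matrix_add_left matrix_mul_lid sum)
  have nX: "n ** X = n ** X ** n + n ** X ** z + n ** X ** p" for X
    by (metis (no_types) matrix_add_right matrix_mul_rid sum)
  have na: "n *v a = a"
    using D by (simp add: n_def proj_neg_def outer_vector)
  have L3: "mnth F j = 0" if "j < -2" for j
    using that by (subst nine) (simp add: nn zz pp nz zp np zn pz pn)
  \<comment> \<open>Only the block from \<open>b\<close> to \<open>a\<close> survives at order -2;
    the sign is that of \<open>proj_pos\<close>.\<close>
  define \<nu> where "\<nu> = - scalar_product (b v* \<sigma>) (mnth F (-2) *v b)"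
  have L2: "mnth F (-2) = smul \<nu> (outer a (a v* \<sigma>))"
  proof -
    have "mnth F (-2) = n ** mnth F (-2) ** p"
      by (subst nine) (simp add: nn zz pp nz zp zn pz pn)
    also have "\<dots> = smul \<nu> (outer a (a v* \<sigma>))"
      by (simp add: smp \<nu>_def matrix_uminus_right smul_minus_left scalar_product_vector_matrix
          outer_scale_left)
    finally show ?thesis .
  qed
  define X where "X = mnth F (-1)"
  define t where "t = scalar_product (b v* \<sigma>) (X *v b)"
  \<comment> \<open>The vector \<open>X *v b\<close> alone would give both terms of the residue up
    to a multiple \<open>t\<close> of the block from \<open>b\<close> to \<open>a\<close>, which
    each term contains once. Half of the correction goes to each term.\<close>
  define \<beta> where "\<beta> = - (X *v b) + (t / 2) *s a"
  have bs: "\<beta> v* \<sigma> = - ((X *v b) v* \<sigma>) + (t / 2) *s (a v* \<sigma>)"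
    by (simp only: \<beta>_def vector_matrix_add_left vector_matrix_minus_left vector_matrix_scale_left)
  have slX: "(b v* \<sigma>) v* X = - ((X *v b) v* \<sigma>)"
    using sp_likeD [OF sl] by (simp add: X_def)
  have npX: "n ** X ** p = - smul t (outer a (a v* \<sigma>))"
    by (simp add: smp t_def matrix_uminus_right scalar_product_vector_matrix outer_scale_left)
  have L1: "X = outer a (\<beta> v* \<sigma>) + outer \<beta> (a v* \<sigma>)"
  proof -
    \<comment> \<open>The surviving blocks are those from zero and \<open>b\<close> to
      \<open>a\<close> and from \<open>b\<close> to zero. The one from \<open>b\<close> to
      \<open>a\<close> is contained in both \<open>n ** X\<close> and \<open>X ** p\<close>.\<close>
    have "X = n ** X + X ** p - n ** X ** p"
    proof -
      have 1: "n ** X = n ** X ** z + n ** X ** p"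
        by (rule trans [OF nX]) (simp add: X_def nn)
      have 2: "X ** p = n ** X ** p + z ** X ** p"
        by (rule trans [OF Xp]) (simp add: X_def pp)
      have "X = n ** X ** z + n ** X ** p + z ** X ** p"
        by (rule trans [OF nine]) (simp add: X_def nn zz pp zn pz pn)
      also have "\<dots> = (n ** X ** z + n ** X ** p) + (n ** X ** p + z ** X ** p) - n ** X ** p"
        by simp
      finally show ?thesis
        unfolding 1 [symmetric] 2 [symmetric] .
    qed
    also have "\<dots> = outer a (- ((X *v b) v* \<sigma>)) - outer (X *v b) (a v* \<sigma>) + smul t (outer a (a v* \<sigma>))"
      unfolding npX by (simp add: smp matrix_uminus_right slX)
    also have "\<dots> = outer a (\<beta> v* \<sigma>) + outer \<beta> (a v* \<sigma>)"
      by (simp only: bs, simp only: \<beta>_def outer_add_right outer_add_left outer_minus_left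
          outer_scale_left outer_scale_right)
         (simp add: smul_def vec_eq_iff)
    finally show ?thesis .
  qed
  have "X ** n = 0"
    unfolding Xn [of X] by (simp add: X_def nn zn pn)
  then have Xa: "X *v a = 0"
    by (metis matrix_vector_mul_assoc matrix_vector_mult_0 na)
  have L1': "scalar_product (\<beta> v* \<sigma>) a = 0"
  proof -
    have "scalar_product (- ((X *v b) v* \<sigma>)) a = 0"
      unfolding slX [symmetric] scalar_product_vector_matrix [of _ X] Xa by (simp add: scalar_product_def)
    then show ?thesis using D
      by (simp only: bs scalar_product_add_left) (simp add: scalar_product_commute [of _ a] scalar_product_scale_right)
  qed
  define \<kappa> where "\<kappa> = scalar_product (b v* \<sigma>) (mnth F 0 *v a)"
  have L0: "mnth F 0 *v a = \<kappa> *s a"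
  proof -
    have "mnth F 0 ** n = n ** mnth F 0 ** n"
      unfolding Xn [of "mnth F 0"] by (simp add: zn pn)
    then have "mnth F 0 *v a = (n ** mnth F 0 ** n) *v a"
      by (metis matrix_vector_mul_assoc na)
    also have "\<dots> = n *v (mnth F 0 *v a)"
      by (simp add: matrix_vector_mul_assoc [symmetric] na)
    also have "\<dots> = \<kappa> *s a"
      by (simp add: n_def proj_neg_def outer_vector \<kappa>_def)
    finally show ?thesis .
  qed
  have "(p ** mnth F 1 ** n) *v a = 0"
    by (simp add: pn)
  then have "p *v (mnth F 1 *v a) = 0"
    by (simp add: matrix_vector_mul_assoc [symmetric] na)
  then have "outer b (a v* \<sigma>) *v (mnth F 1 *v a) = 0"
    by (simp add: p_def proj_pos_def matrix_vector_mult_minus_left)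
  then have "scalar_product (a v* \<sigma>) (scalar_product (a v* \<sigma>) (mnth F 1 *v a) *s b) = 0"
    by (metis outer_vector scalar_product_0_right)
  then have L_1: "scalar_product (a v* \<sigma>) (mnth F 1 *v a) = 0"
    using D by (simp add: scalar_product_scale_right)
  show ?thesis
    unfolding lax_series_def cscale_smul
    using L3 L2 L1 L1' L0 L_1
    by (intro conjI exI [of _ \<nu>] exI [of _ \<kappa>] exI [of _ \<beta>])
       (auto simp: outer_mult matrix_add_left bilin_vector_matrix vector_matrix_mul_assoc [symmetric]
        scalar_product_vector_matrix X_def)
qed

section \<open>Residues and changes of coordinate\<close>

lemma fls_compose_fps_X_inv:
  assumes "T \<noteq> 0"
  shows "fls_compose_fps fls_X_inv T = inverse (fps_to_fls T :: complex fls)"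
  using fls_compose_fps_shift [OF assms, of 1 "1 :: complex fls"]
  by (simp add: fls_X_inv_conv_shift_1 power_int_minus)

text \<open>The chain rule is known for power series and is checked directly for 1/z. By the product
  rule the series satisfying it are closed under multiplication, and every Laurent series is a power
  series times a power of 1/z.\<close>

lemma fls_deriv_compose_fps:
  fixes T :: "complex fps"
  assumes T: "T \<noteq> 0" "fps_nth T 0 = 0"
  shows "fls_deriv (fls_compose_fps G T) = fls_compose_fps (fls_deriv G) T * fps_to_fls (fps_deriv T)"
proof -
  let ?C = "\<lambda>G. fls_deriv (fls_compose_fps G T) = fls_compose_fps (fls_deriv G) T * fps_to_fls (fps_deriv T)"
  have mult: "?C (F * G)" if "?C F" "?C G" for F G
    using that T by (simp add: fls_compose_fps_mult fls_compose_fps_add algebra_simps)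
  have fps: "?C (fps_to_fls g)" for g
    using T by (simp add: fls_deriv_fps_to_fls fps_compose_deriv fls_times_fps_to_fls)
  have "fls_deriv (inverse (fps_to_fls T)) = - fps_to_fls (fps_deriv T) * inverse (fps_to_fls T) ^ 2"
    by (simp add: fls_inverse_deriv fls_deriv_fps_to_fls)
  then have inv: "?C fls_X_inv"
    using T by (simp add: fls_compose_fps_X_inv fls_compose_fps_power)
  have pow: "?C (fls_X_inv ^ n)" for n
  proof (induction n)
    case (Suc n)
    show ?case unfolding power_Suc by (rule mult [OF inv Suc])
  qed simp
  obtain g n where G: "G = fps_to_fls g * fls_X_inv ^ n"
  proof -
    \<comment> \<open>For a series without a pole, \<open>nat\<close> makes \<open>n\<close> equal
      to 0.\<close>
    define n where "n = nat (- fls_subdegree G)"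
    have "G = fls_shift (int n) (fls_shift (- int n) G)"
      by simp
    also have "fls_shift (- int n) G = fps_to_fls (fls_regpart (fls_shift (- int n) G))"
      by (rule fls_eqI) (auto simp: n_def)
    finally have "G = fps_to_fls (fls_regpart (fls_shift (- int n) G)) * fls_X_inv ^ n"
      by (simp add: fls_X_inv_power_times_conv_shift)
    then show ?thesis by (rule that)
  qed
  show ?thesis
    unfolding G by (rule mult [OF fps pow])
qed

text \<open>Up to a derivative, which substitution turns into another derivative, \<open>F\<close>
  is its residue times 1/z. That part becomes dT/T, whose residue is the order of vanishing of
  \<open>T\<close>, here 1.\<close>

lemma fls_residue_compose_fps:
  fixes T :: "complex fps"
  assumes T: "fps_nth T 0 = 0" "fps_nth T 1 \<noteq> 0"
  shows "fls_residue (fls_compose_fps F T * fps_to_fls (fps_deriv T)) = fls_residue F"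
proof -
  define r where "r = fls_residue F"
  have T0: "T \<noteq> 0" using T by auto
  have sub: "subdegree T = 1"
    using T by (intro subdegreeI) auto
  have "fls_residue (F - fls_const r * fls_X_inv) = 0"
    by (simp add: r_def)
  then obtain G where "fls_deriv G = F - fls_const r * fls_X_inv"
    using fls_residue_nonzero_ex_antiderivative by blast
  then have F: "F = fls_deriv G + fls_const r * fls_X_inv"
    by (simp add: algebra_simps)
  have "fls_compose_fps F T * fps_to_fls (fps_deriv T) =
      fls_deriv (fls_compose_fps G T) +
      fls_const r * (inverse (fps_to_fls T) * fls_deriv (fps_to_fls T))"
    unfolding F using T T0
    by (simp add: fls_compose_fps_add fls_compose_fps_mult fls_compose_fps_X_inv
        fls_deriv_compose_fps fls_deriv_fps_to_fls algebra_simps)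
  then have "fls_residue (fls_compose_fps F T * fps_to_fls (fps_deriv T)) =
      fls_residue (fls_const r * (inverse (fps_to_fls T) * fls_deriv (fps_to_fls T)))"
    by simp
  also have "\<dots> = r * fls_residue (inverse (fps_to_fls T) * fls_deriv (fps_to_fls T))"
    by (rule fls_residue_fls_const_times)
  also have "\<dots> = r"
    unfolding fls_residue_deriv_times_inverse_eq_subdegree
    by (simp add: fls_subdegree_fls_to_fps sub)
  finally show ?thesis by (simp add: r_def)
qed

lemma residue_change_of_coordinate:
  assumes h: "h meromorphic_on {t z0}" and t: "t analytic_on {z0}" and d: "deriv t z0 \<noteq> 0"
  shows "residue (\<lambda>w. h (t w) * deriv t w) z0 = residue h (t z0)"
proof -
  obtain F where F: "(\<lambda>x. h (t z0 + x)) has_laurent_expansion F"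
    using h by (auto simp: meromorphic_on_def)
  have "(\<lambda>x. t (z0 + x) - t z0) has_fps_expansion fps_expansion t z0 - fps_const (t z0)"
    by (intro fps_expansion_intros analytic_at_imp_has_fps_expansion t)
  then obtain T where T: "(\<lambda>x. t (z0 + x) - t z0) has_fps_expansion T"
    by blast
  have T0: "fps_nth T 0 = 0"
    using has_fps_expansion_imp_0_eq_fps_nth_0 [OF T] by simp
  have T1: "fps_nth T 1 = deriv t z0"
  proof -
    have "fps_nth T 1 = deriv (\<lambda>x. t (z0 + x) - t z0) 0"
      using fps_nth_fps_expansion [OF T, of 1] by simp
    also have "\<dots> = deriv t z0"
    proof (rule DERIV_imp_deriv)
      have "(t has_field_derivative deriv t z0) (at (0 + z0))"
        using t by (simp add: analytic_on_imp_differentiable_at DERIV_deriv_iff_field_differentiable)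
      then have "((\<lambda>x. t (z0 + x)) has_field_derivative deriv t z0) (at 0)"
        unfolding DERIV_shift by (simp add: add.commute)
      then show "((\<lambda>x. t (z0 + x) - t z0) has_field_derivative deriv t z0) (at 0)"
        by (auto intro!: derivative_eq_intros)
    qed
    finally show ?thesis .
  qed
  have Tl: "(\<lambda>x. t (z0 + x) - t z0) has_laurent_expansion fps_to_fls T"
    by (rule has_laurent_expansion_fps [OF T])
  have "((\<lambda>x. h (t z0 + x)) \<circ> (\<lambda>x. t (z0 + x) - t z0)) has_laurent_expansion fls_compose_fps F T"
    using T0 T1 d by (intro has_laurent_expansion_compose F Tl) auto
  then have 1: "(\<lambda>x. h (t (z0 + x))) has_laurent_expansion fls_compose_fps F T"
    by (simp add: o_def)
  obtain r where r: "r > 0" "t holomorphic_on ball z0 r"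
    using t by (auto simp: analytic_on_def)
  have 2: "(\<lambda>x. deriv t (z0 + x)) has_laurent_expansion fls_deriv (fps_to_fls T)"
  proof (rule has_laurent_expansion_deriv' [OF Tl])
    fix x assume "x \<in> ball 0 r - {0 :: complex}"
    then have "(t has_field_derivative deriv t (z0 + x)) (at (z0 + x))"
      by (intro holomorphic_derivI [OF r(2)]) (auto simp: dist_norm)
    then have "((\<lambda>x. t (z0 + x)) has_field_derivative deriv t (z0 + x)) (at x)"
      by (subst (asm) add.commute, subst (asm) DERIV_shift) (simp add: add.commute)
    then show "((\<lambda>x. t (z0 + x) - t z0) has_field_derivative deriv t (z0 + x)) (at x)"
      by (auto intro!: derivative_eq_intros)
  qed (use r in auto)
  have "residue (\<lambda>w. h (t w) * deriv t w) z0 =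
      fls_residue (fls_compose_fps F T * fls_deriv (fps_to_fls T))"
    by (rule has_laurent_expansion_residue) (intro laurent_expansion_intros 1 2)
  also have "\<dots> = fls_residue F"
    using fls_residue_compose_fps [OF T0, of F] T1 d by (simp add: fls_deriv_fps_to_fls)
  also have "\<dots> = residue h (t z0)"
    using has_laurent_expansion_residue [OF F] by simp
  finally show ?thesis .
qed

section \<open>Charts\<close>

lemma chart_inv_snd: "is_chart c \<Longrightarrow> p \<in> fst c \<Longrightarrow> chart_inv c (snd c p) = p"
  by (auto simp: is_chart_def homeomorphism_def)

lemma snd_chart_inv: "is_chart c \<Longrightarrow> w \<in> snd c ` fst c \<Longrightarrow> snd c (chart_inv c w) = w"
  by (auto simp: is_chart_def homeomorphism_def)

lemma chart_inv_mem: "is_chart c \<Longrightarrow> w \<in> snd c ` fst c \<Longrightarrow> chart_inv c w \<in> fst c"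
  by (auto simp: is_chart_def homeomorphism_def)

lemma open_snd_image:
  assumes "is_chart c" "open W"
  shows "open (snd c ` (fst c \<inter> W))"
proof -
  have "snd c ` (fst c \<inter> W) = (snd c ` fst c) \<inter> chart_inv c -` W"
    using assms(1) by (auto simp: chart_inv_snd chart_inv_mem) 
  also have "open \<dots>"
    using assms by (intro continuous_open_preimage) (auto simp: is_chart_def homeomorphism_def)
  finally show ?thesis .
qed

lemma open_chart_inv_image:
  assumes "is_chart c" "open W" "W \<subseteq> snd c ` fst c"
  shows "open (chart_inv c ` W)"
proof -
  have "chart_inv c ` W = fst c \<inter> snd c -` W"
    using assms(1,3) by (auto simp: chart_inv_snd chart_inv_mem snd_chart_inv subset_iff image_iff) (metis chart_inv_snd)
  also have "open \<dots>"
    using assms by (intro continuous_open_preimage) (auto simp: is_chart_def homeomorphism_def)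
  finally show ?thesis .
qed

text \<open>Moves statements about punctured neighbourhoods between the surface and a coordinate
  plane; limits, expansions and residues depend on nothing else.\<close>

lemma eventually_at_chart:
  assumes c: "is_chart c" "p \<in> fst c"
  shows "(\<forall>\<^sub>F y in at p. R y) \<longleftrightarrow> (\<forall>\<^sub>F w in at (snd c p). R (chart_inv c w))"
proof
  assume "\<forall>\<^sub>F y in at p. R y"
  then obtain W where W: "open W" "p \<in> W" "\<And>y. y \<in> W \<Longrightarrow> y \<noteq> p \<Longrightarrow> R y"
    by (auto simp: eventually_at_topological)
  have "R (chart_inv c w)" if "w \<in> snd c ` (fst c \<inter> W)" "w \<noteq> snd c p" for w
    using that c by (auto simp: chart_inv_snd intro!: W(3))
  then show "\<forall>\<^sub>F w in at (snd c p). R (chart_inv c w)"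
    unfolding eventually_at_topological
    using open_snd_image [OF c(1) W(1)] c(2) W(2) by blast
next
  assume "\<forall>\<^sub>F w in at (snd c p). R (chart_inv c w)"
  then obtain W where W: "open W" "snd c p \<in> W" "\<And>w. w \<in> W \<Longrightarrow> w \<noteq> snd c p \<Longrightarrow> R (chart_inv c w)"
    by (auto simp: eventually_at_topological)
  have 1: "R y" if y: "y \<in> chart_inv c ` (W \<inter> snd c ` fst c)" "y \<noteq> p" for y
  proof -
    obtain x where x: "x \<in> W" "x \<in> snd c ` fst c" "y = chart_inv c x"
      using y(1) by blast
    have "x \<noteq> snd c p"
      using y(2) x(3) c by (auto simp: chart_inv_snd)
    then show ?thesis using W(3) x by blast
  qed
  have 2: "open (chart_inv c ` (W \<inter> snd c ` fst c))"
    using c W(1) by (intro open_chart_inv_image) (auto simp: is_chart_def)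
  have 3: "p \<in> chart_inv c ` (W \<inter> snd c ` fst c)"
    using c W(2) by (metis IntI chart_inv_snd imageI)
  show "\<forall>\<^sub>F y in at p. R y"
    unfolding eventually_at_topological using 1 2 3 by blast
qed

lemma complex_structureD:
  assumes "complex_structure A"
  shows "c \<in> A \<Longrightarrow> is_chart c" "c \<in> A \<Longrightarrow> d \<in> A \<Longrightarrow> compatible c d" "\<exists>c\<in>A. p \<in> fst c"
  using assms unfolding complex_structure_def by (blast, blast, blast)

text \<open>Charts transport the absence of isolated points from the plane. This is needed for
  uniqueness of limits on the surface.\<close>

lemma at_neq_bot_surface:
  fixes A :: "('a::t2_space) chart set"
  assumes "complex_structure A"
  shows "at (p :: 'a) \<noteq> bot"
proof -
  obtain c where c: "c \<in> A" "p \<in> fst c" "is_chart c"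
    using complex_structureD [OF assms] by metis
  have "\<not> (\<forall>\<^sub>F y in at p. False)"
    unfolding eventually_at_chart [OF c(3,2)] by simp
  then show ?thesis by auto
qed

definition transition :: "'a chart \<Rightarrow> 'a chart \<Rightarrow> complex \<Rightarrow> complex" where
  "transition c d = snd d \<circ> chart_inv c"

lemma transition_chart:
  assumes "complex_structure A" "c \<in> A" "d \<in> A" "p \<in> fst c" "p \<in> fst d"
  shows "transition c d (snd c p) = snd d p" "transition c d analytic_on {snd c p}"
    "deriv (transition c d) (snd c p) \<noteq> 0"
    "chart_inv d (transition c d (snd c p)) = p"
proof -
  have ch: "is_chart c" "is_chart d" and comp: "compatible c d"
    using complex_structureD [OF assms(1)] assms by auto
  show "transition c d (snd c p) = snd d p" "chart_inv d (transition c d (snd c p)) = p"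
    using ch assms by (simp_all add: transition_def chart_inv_snd)
  have op: "open (snd c ` (fst c \<inter> fst d))"
    using ch by (intro open_snd_image) (auto simp: is_chart_def)
  have hol: "transition c d holomorphic_on snd c ` (fst c \<inter> fst d)"
    using comp by (simp add: compatible_def transition_def)
  have mem: "snd c p \<in> snd c ` (fst c \<inter> fst d)"
    using assms by auto
  show "transition c d analytic_on {snd c p}"
    using hol op mem analytic_at by blast
  have "inj_on (transition c d) (snd c ` (fst c \<inter> fst d))"
    using ch unfolding inj_on_def transition_def
    by (auto simp: chart_inv_snd) (metis chart_inv_snd)
  \<comment> \<open>An injective holomorphic map has no critical points.\<close>
  then show "deriv (transition c d) (snd c p) \<noteq> 0"
    by (rule holomorphic_injective_imp_regular [OF hol op _ mem])
qed

lemma eventually_at_not_in_finite: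
  fixes p :: "'a::t1_space"
  assumes "finite S"
  shows "\<forall>\<^sub>F y in at p. y \<notin> S"
proof -
  have "open (- (S - {p}))"
    using assms by (intro open_Compl finite_imp_closed) auto
  then show ?thesis
    unfolding eventually_at_topological by (intro exI [of _ "- (S - {p})"]) auto
qed

lemma eventually_at_chart_domain:
  fixes p :: "'a::t1_space"
  assumes "is_chart c" "p \<in> fst c" "is_chart d" "p \<in> fst d" "finite S"
  shows "\<forall>\<^sub>F y in at p. y \<in> fst c \<inter> fst d - S"
proof -
  have "\<forall>\<^sub>F y in at p. y \<in> fst c \<inter> fst d"
    by (rule eventually_at_in_open') (use assms in \<open>auto simp: is_chart_def\<close>)
  then show ?thesis
    using eventually_at_not_in_finite [OF assms(5), of p] by eventually_elim auto
qed

text \<open>The transformation law is given off \<open>S\<close> only. As \<open>S\<close> is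
  finite, it holds on a punctured neighbourhood of every point, including the points of
  \<open>S\<close>.\<close>

lemma eventually_form_transition:
  fixes p :: "'a::t2_space"
  assumes "complex_structure A" "finite S" "c \<in> A" "d \<in> A" "p \<in> fst c" "p \<in> fst d"
    and tr: "\<And>q. q \<in> fst c \<inter> fst d - S \<Longrightarrow> \<omega> c q = \<omega> d q * deriv (snd d \<circ> chart_inv c) (snd c q)"
  shows "\<forall>\<^sub>F w in at (snd c p). \<omega> c (chart_inv c w) =
    \<omega> d (chart_inv d (transition c d w)) * deriv (transition c d) w"
proof -
  have ch: "is_chart c" "is_chart d"
    using complex_structureD [OF assms(1)] assms by auto
  have "\<forall>\<^sub>F q in at p. \<omega> c q = \<omega> d (chart_inv d (transition c d (snd c q))) * deriv (transition c d) (snd c q)"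
    using eventually_at_chart_domain [OF ch(1) assms(5) ch(2) assms(6,2)]
  proof eventually_elim
    case (elim q)
    then have "chart_inv d (transition c d (snd c q)) = q"
      using ch by (simp add: transition_def chart_inv_snd)
    then show ?case using tr [OF elim] by (simp add: transition_def)
  qed
  then have 1: "\<forall>\<^sub>F w in at (snd c p). \<omega> c (chart_inv c w) =
      \<omega> d (chart_inv d (transition c d (snd c (chart_inv c w)))) * deriv (transition c d) (snd c (chart_inv c w))"
    by (subst (asm) eventually_at_chart [OF ch(1) assms(5)])
  have "\<forall>\<^sub>F w in at (snd c p). w \<in> snd c ` fst c"
    by (rule eventually_at_in_open') (use assms ch in \<open>auto simp: is_chart_def\<close>)
  then show ?thesis using 1
    by eventually_elim (simp add: snd_chart_inv [OF ch(1)])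
qed

section \<open>Residues of meromorphic forms\<close>

lemma residue_form_chart_independent:
  fixes p :: "'a::t2_space"
  assumes "complex_structure A" "finite S" "meromorphic_form A S \<omega>" "c \<in> A" "d \<in> A" "p \<in> fst c" "p \<in> fst d"
  shows "residue (\<omega> c \<circ> chart_inv c) (snd c p) = residue (\<omega> d \<circ> chart_inv d) (snd d p)"
proof -
  note t = transition_chart [OF assms(1,4,5,6,7)]
  have "residue (\<omega> c \<circ> chart_inv c) (snd c p) =
      residue (\<lambda>w. (\<omega> d \<circ> chart_inv d) (transition c d w) * deriv (transition c d) w) (snd c p)"
  proof (rule residue_cong)
    have "\<omega> c q = \<omega> d q * deriv (snd d \<circ> chart_inv c) (snd c q)" if "q \<in> fst c \<inter> fst d - S" for q
      using assms(3-5) that unfolding meromorphic_form_def by blast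
    then show "\<forall>\<^sub>F w in at (snd c p). (\<omega> c \<circ> chart_inv c) w =
        (\<omega> d \<circ> chart_inv d) (transition c d w) * deriv (transition c d) w"
      unfolding o_apply [of "\<omega> c"] o_apply [of "\<omega> d"] by (intro eventually_form_transition [OF assms(1,2,4,5,6,7)])
  qed simp
  also have "\<dots> = residue (\<omega> d \<circ> chart_inv d) (transition c d (snd c p))"
  proof (rule residue_change_of_coordinate [OF _ t(2,3)])
    have "(\<omega> d \<circ> chart_inv d) meromorphic_on snd d ` fst d"
      using assms by (auto simp: meromorphic_form_def)
    then show "(\<omega> d \<circ> chart_inv d) meromorphic_on {transition c d (snd c p)}"
      by (rule meromorphic_on_subset) (use assms t in auto)
  qed
  finally show ?thesis by (simp add: t)
qed

text \<open>Frees residues from the chart picked by \<open>SOME\<close> in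
  \<open>residue_form\<close>.\<close>

lemma residue_form_eq:
  fixes p :: "'a::t2_space"
  assumes "complex_structure A" "finite S" "meromorphic_form A S \<omega>" "c \<in> A" "p \<in> fst c"
  shows "residue_form A p \<omega> = residue (\<omega> c \<circ> chart_inv c) (snd c p)"
proof -
  define d where "d = (SOME c. c \<in> A \<and> p \<in> fst c)"
  have d: "d \<in> A \<and> p \<in> fst d"
    unfolding d_def by (rule someI [of _ c]) (use assms in auto)
  show ?thesis
    unfolding residue_form_def Let_def d_def [symmetric]
    by (rule residue_form_chart_independent [OF assms(1-3)]) (use d assms in auto)
qed

text \<open>\<open>E\<close> may reach beyond the disc, since a chart domain can contain further
  singularities; the circle winds 0 times around those.\<close>

lemma contour_integral_circlepath_residues:
  assumes "open V" "cball z0 r \<subseteq> V" "r > 0" "finite E" "h holomorphic_on V - E" "sphere z0 r \<inter> E = {}"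
  shows "contour_integral (circlepath z0 r) h = 2 * pi * \<i> * (\<Sum>y\<in>E \<inter> ball z0 r. residue h y)"
proof -
  \<comment> \<open>The planar residue theorem wants a connected domain, but the image of a chart
    need not be connected.\<close>
  define C where "C = connected_component_set V z0"
  have C: "open C" "connected C" "C \<subseteq> V"
    using assms(1) by (auto simp: C_def open_connected_component connected_component_subset)
  have cb: "cball z0 r \<subseteq> C"
    unfolding C_def by (rule connected_component_maximal) (use assms in auto)
  have "contour_integral (circlepath z0 r) h =
      2 * pi * \<i> * (\<Sum>y\<in>E \<inter> C. winding_number (circlepath z0 r) y * residue h y)"
  proof (rule Residue_theorem)
    show "h holomorphic_on C - E \<inter> C"
      by (rule holomorphic_on_subset [OF assms(5)]) (use C in auto)
    show "path_image (circlepath z0 r) \<subseteq> C - E \<inter> C"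
      using assms(3,6) cb by auto
    show "\<forall>z. z \<notin> C \<longrightarrow> winding_number (circlepath z0 r) z = 0"
    proof (intro allI impI)
      fix z assume "z \<notin> C"
      then show "winding_number (circlepath z0 r) z = 0"
        by (intro winding_number_zero_outside [of _ "cball z0 r"]) (use cb assms(3) in auto)
    qed
  qed (use C assms in auto)
  also have "(\<Sum>y\<in>E \<inter> C. winding_number (circlepath z0 r) y * residue h y) =
      (\<Sum>y\<in>E \<inter> ball z0 r. winding_number (circlepath z0 r) y * residue h y)"
  proof (rule sum.mono_neutral_right)
    show "\<forall>y\<in>E \<inter> C - E \<inter> ball z0 r. winding_number (circlepath z0 r) y * residue h y = 0"
    proof
      fix y assume y: "y \<in> E \<inter> C - E \<inter> ball z0 r"
      then have "y \<notin> cball z0 r"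
        using assms(6) by (auto simp: sphere_def)
      then have "winding_number (circlepath z0 r) y = 0"
        by (intro winding_number_zero_outside [of _ "cball z0 r"]) (use assms(3) in auto)
      then show "winding_number (circlepath z0 r) y * residue h y = 0" by simp
    qed
  qed (use assms(4) cb in auto)
  also have "\<dots> = (\<Sum>y\<in>E \<inter> ball z0 r. residue h y)"
    by (rule sum.cong) (auto simp: winding_number_circlepath dist_norm norm_minus_commute)
  finally show ?thesis .
qed

section \<open>The residue theorem\<close>

text \<open>Disjointness is demanded of the closed discs, so that every boundary circle avoids all
  the open discs making up \<open>disc_union\<close>.\<close>

definition disc_system :: "('a::t2_space) chart set \<Rightarrow> 'a set \<Rightarrow> ('a \<Rightarrow> 'a chart) \<Rightarrow> ('a \<Rightarrow> real) \<Rightarrow> bool" where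
  "disc_system A T c r \<longleftrightarrow>
     (\<forall>p\<in>T. c p \<in> A \<and> p \<in> fst (c p) \<and> r p > 0 \<and> cball (snd (c p) p) (r p) \<subseteq> snd (c p) ` fst (c p)) \<and>
     (\<forall>p\<in>T. \<forall>q\<in>T. p \<noteq> q \<longrightarrow> chart_inv (c p) ` cball (snd (c p) p) (r p) \<inter>
        chart_inv (c q) ` cball (snd (c q) q) (r q) = {})"

definition disc_union :: "'a set \<Rightarrow> ('a \<Rightarrow> 'a chart) \<Rightarrow> ('a \<Rightarrow> real) \<Rightarrow> 'a set" where
  "disc_union T c r = (\<Union>p\<in>T. chart_inv (c p) ` ball (snd (c p) p) (r p))"

lemma finite_disjoint_neighbourhoods:
  fixes T :: "'a::t2_space set"
  assumes "finite T"
  obtains N where "\<And>p. p \<in> T \<Longrightarrow> open (N p) \<and> p \<in> N p"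
    "\<And>p q. p \<in> T \<Longrightarrow> q \<in> T \<Longrightarrow> p \<noteq> q \<Longrightarrow> N p \<inter> N q = {}"
proof -
  have "\<exists>U V. open U \<and> open V \<and> p \<in> U \<and> q \<in> V \<and> U \<inter> V = {}" if "p \<noteq> q" for p q :: 'a
    using hausdorff [OF that] by blast
  then obtain U V where UV: "\<And>p q :: 'a. p \<noteq> q \<Longrightarrow>
      open (U p q) \<and> open (V p q) \<and> p \<in> U p q \<and> q \<in> V p q \<and> U p q \<inter> V p q = {}"
    by metis
  \<comment> \<open>The separating pairs are not chosen symmetrically in \<open>p\<close> and
    \<open>q\<close>, so both orders are intersected: \<open>N p\<close> lies in
    \<open>U p q\<close> and \<open>N q\<close> in \<open>V p q\<close>.\<close>
  define N where "N p = (\<Inter>q\<in>T - {p}. U p q \<inter> V q p)" for p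
  show ?thesis
  proof (rule that)
    fix p assume "p \<in> T"
    have "open (U p q \<inter> V q p) \<and> p \<in> U p q \<inter> V q p" if "q \<noteq> p" for q
      using UV [of p q] UV [of q p] that by auto
    then show "open (N p) \<and> p \<in> N p"
      using assms unfolding N_def by (auto intro!: open_INT)
  next
    show "N p \<inter> N q = {}" if "p \<in> T" "q \<in> T" "p \<noteq> q" for p q
      using that UV [OF that(3)] by (auto simp: N_def)
  qed
qed

lemma disc_system_exists:
  fixes A :: "('a::t2_space) chart set"
  assumes A: "complex_structure A" and T: "finite T"
  obtains c r where "disc_system A T c r"
proof -
  obtain N where N: "\<And>p. p \<in> T \<Longrightarrow> open (N p) \<and> p \<in> N p"
    "\<And>p q. p \<in> T \<Longrightarrow> q \<in> T \<Longrightarrow> p \<noteq> q \<Longrightarrow> N p \<inter> N q = {}"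
    using finite_disjoint_neighbourhoods [OF T] by blast
  have "\<forall>p. \<exists>c. c \<in> A \<and> p \<in> fst c"
    using complex_structureD(3) [OF A] by blast
  then obtain c where c: "\<And>p. c p \<in> A \<and> p \<in> fst (c p)"
    by metis
  have ch: "is_chart (c p)" for p
    using c complex_structureD(1) [OF A] by blast
  have "\<exists>r>0. cball (snd (c p) p) r \<subseteq> snd (c p) ` (fst (c p) \<inter> N p)" if p: "p \<in> T" for p
  proof -
    have "open (snd (c p) ` (fst (c p) \<inter> N p))"
      using N(1) [OF p] ch by (intro open_snd_image) auto
    moreover have "snd (c p) p \<in> snd (c p) ` (fst (c p) \<inter> N p)"
      using N(1) [OF p] c by auto
    ultimately show ?thesis
      by (metis open_contains_cball)
  qed
  then obtain r where r: "\<And>p. p \<in> T \<Longrightarrow> r p > 0 \<and> cball (snd (c p) p) (r p) \<subseteq> snd (c p) ` (fst (c p) \<inter> N p)"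
    by metis
  have sub: "chart_inv (c p) ` cball (snd (c p) p) (r p) \<subseteq> N p" if p: "p \<in> T" for p
  proof
    fix y assume "y \<in> chart_inv (c p) ` cball (snd (c p) p) (r p)"
    then obtain x where "x \<in> fst (c p) \<inter> N p" "y = chart_inv (c p) (snd (c p) x)"
      using r [OF p] by blast
    then show "y \<in> N p"
      by (simp add: chart_inv_snd [OF ch])
  qed
  have sub': "cball (snd (c p) p) (r p) \<subseteq> snd (c p) ` fst (c p)" if "p \<in> T" for p
    using r [OF that] by blast
  have "disc_system A T c r"
    unfolding disc_system_def
  proof (intro conjI ballI impI)
    fix p q assume "p \<in> T" "q \<in> T" "p \<noteq> q"
    then show "chart_inv (c p) ` cball (snd (c p) p) (r p) \<inter> chart_inv (c q) ` cball (snd (c q) q) (r q) = {}"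
      using sub N(2) by blast
  qed (use c r sub' in auto)
  then show ?thesis by (rule that)
qed

lemma disc_systemD:
  assumes "disc_system A T c r" "p \<in> T"
  shows "c p \<in> A" "p \<in> fst (c p)" "r p > 0" "cball (snd (c p) p) (r p) \<subseteq> snd (c p) ` fst (c p)"
  using assms unfolding disc_system_def by blast+

lemma disc_system_disjoint:
  assumes "disc_system A T c r" "p \<in> T" "q \<in> T" "x \<in> cball (snd (c p) p) (r p)"
    "y \<in> cball (snd (c q) q) (r q)" "chart_inv (c p) x = chart_inv (c q) y"
  shows "p = q"
proof (rule ccontr)
  assume "p \<noteq> q"
  then have "chart_inv (c p) ` cball (snd (c p) p) (r p) \<inter> chart_inv (c q) ` cball (snd (c q) q) (r q) = {}"
    using assms(1-3) unfolding disc_system_def by blast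
  then show False
    using imageI [OF assms(4), of "chart_inv (c p)"] imageI [OF assms(5), of "chart_inv (c q)"] assms(6)
    by auto
qed

lemma disc_union_open:
  assumes "complex_structure A" "disc_system A T c r"
  shows "open (disc_union T c r)" "T \<subseteq> disc_union T c r"
proof -
  show "open (disc_union T c r)"
    unfolding disc_union_def
  proof (intro open_UN ballI open_chart_inv_image)
    fix p assume "p \<in> T"
    then show "is_chart (c p)" "ball (snd (c p) p) (r p) \<subseteq> snd (c p) ` fst (c p)"
      using disc_systemD [OF assms(2)] complex_structureD(1) [OF assms(1)] ball_subset_cball by blast+
  qed simp
  show "T \<subseteq> disc_union T c r"
  proof
    fix p assume p: "p \<in> T"
    have "chart_inv (c p) (snd (c p) p) = p"
      using disc_systemD [OF assms(2) p] complex_structureD(1) [OF assms(1)] by (simp add: chart_inv_snd)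
    then show "p \<in> disc_union T c r"
      unfolding disc_union_def using p disc_systemD(3) [OF assms(2) p]
      by (intro UN_I [of p] image_eqI [of _ _ "snd (c p) p"]) auto
  qed
qed

text \<open>A boundary point belongs to no other disc by disjointness, and not to its own open disc
  because the coordinate is injective.\<close>

lemma sphere_not_in_disc_union:
  assumes A: "complex_structure A" and D: "disc_system A T c r" and p: "p \<in> T"
    and w: "w \<in> sphere (snd (c p) p) (r p)"
  shows "chart_inv (c p) w \<notin> disc_union T c r"
proof
  assume "chart_inv (c p) w \<in> disc_union T c r"
  then obtain q y where q: "q \<in> T" "y \<in> ball (snd (c q) q) (r q)" "chart_inv (c p) w = chart_inv (c q) y"
    by (auto simp: disc_union_def)
  have "p = q"
    by (rule disc_system_disjoint [OF D p q(1) _ _ q(3)]) (use w q in auto)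
  note d = disc_systemD [OF D p] and ch = complex_structureD(1) [OF A, of "c p"]
  have "w \<in> snd (c p) ` fst (c p)" "y \<in> snd (c p) ` fst (c p)"
    using d(4) w q(2) \<open>p = q\<close> by auto
  then have "w = y"
    using snd_chart_inv [OF ch [OF d(1)]] q(3) \<open>p = q\<close> by metis
  then show False
    using w q \<open>p = q\<close> by (auto simp: sphere_def)
qed

text \<open>The centres \<open>T\<close> and the singularities \<open>S\<close> are independent of
  each other: the latter only have to lie in the discs. Thus the circles can stay fixed while the
  singularities move with a parameter.\<close>

lemma sum_residues_disc_system:
  fixes A :: "('a::t2_space) chart set"
  assumes A: "complex_structure A" and D: "disc_system A T c r" and T: "finite T"
    and S: "finite S" "S \<subseteq> disc_union T c r" and \<omega>: "meromorphic_form A S \<omega>"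
  shows "(\<Sum>p\<in>T. contour_integral (circlepath (snd (c p) p) (r p)) (\<omega> (c p) \<circ> chart_inv (c p))) =
    2 * pi * \<i> * (\<Sum>q\<in>S. residue_form A q \<omega>)"
proof -
  define B where "B p = chart_inv (c p) ` ball (snd (c p) p) (r p)" for p
  have each: "contour_integral (circlepath (snd (c p) p) (r p)) (\<omega> (c p) \<circ> chart_inv (c p)) =
      2 * pi * \<i> * (\<Sum>q\<in>S \<inter> B p. residue_form A q \<omega>)" if p: "p \<in> T" for p
  proof -
    note d = disc_systemD [OF D p]
    have ch: "is_chart (c p)"
      using complex_structureD(1) [OF A d(1)] .
    define E where "E = snd (c p) ` (fst (c p) \<inter> S)"
    have bV: "ball (snd (c p) p) (r p) \<subseteq> snd (c p) ` fst (c p)"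
      using d(4) ball_subset_cball by blast
    have "snd (c p) ` (fst (c p) - S) = snd (c p) ` fst (c p) - E"
      unfolding E_def by (auto simp: image_iff dest: arg_cong [of _ _ "chart_inv (c p)"] chart_inv_snd [OF ch])
        (metis chart_inv_snd [OF ch])
    then have hol: "(\<omega> (c p) \<circ> chart_inv (c p)) holomorphic_on snd (c p) ` fst (c p) - E"
      using \<omega> d(1) unfolding meromorphic_form_def by metis
    have sph: "sphere (snd (c p) p) (r p) \<inter> E = {}"
    proof -
      have False if w: "w \<in> sphere (snd (c p) p) (r p)" "w \<in> E" for w
      proof -
        have "chart_inv (c p) w \<in> S"
          using w(2) chart_inv_snd [OF ch] by (auto simp: E_def)
        then show False
          using sphere_not_in_disc_union [OF A D p w(1)] S(2) by blast
      qed
      then show ?thesis by blast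
    qed
    have "contour_integral (circlepath (snd (c p) p) (r p)) (\<omega> (c p) \<circ> chart_inv (c p)) =
        2 * pi * \<i> * (\<Sum>y\<in>E \<inter> ball (snd (c p) p) (r p). residue (\<omega> (c p) \<circ> chart_inv (c p)) y)"
      by (rule contour_integral_circlepath_residues [OF _ d(4,3) _ hol sph])
         (use ch S in \<open>auto simp: E_def is_chart_def\<close>)
    also have "(\<Sum>y\<in>E \<inter> ball (snd (c p) p) (r p). residue (\<omega> (c p) \<circ> chart_inv (c p)) y) =
        (\<Sum>q\<in>S \<inter> B p. residue_form A q \<omega>)"
    proof (rule sum.reindex_bij_witness [of _ "snd (c p)" "chart_inv (c p)"])
      fix y assume y: "y \<in> E \<inter> ball (snd (c p) p) (r p)"
      then have yV: "y \<in> snd (c p) ` fst (c p)" using bV by blast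
      show "snd (c p) (chart_inv (c p) y) = y"
        by (rule snd_chart_inv [OF ch yV])
      show "chart_inv (c p) y \<in> S \<inter> B p"
        using y chart_inv_snd [OF ch] by (auto simp: E_def B_def)
      show "residue_form A (chart_inv (c p) y) \<omega> = residue (\<omega> (c p) \<circ> chart_inv (c p)) y"
        using residue_form_eq [OF A S(1) \<omega> d(1) chart_inv_mem [OF ch yV]]
        by (simp add: snd_chart_inv [OF ch yV])
    next
      fix q assume q: "q \<in> S \<inter> B p"
      then obtain y where y: "y \<in> ball (snd (c p) p) (r p)" "q = chart_inv (c p) y"
        by (auto simp: B_def)
      then have yV: "y \<in> snd (c p) ` fst (c p)" using bV by blast
      have qf: "q \<in> fst (c p)" and sq: "snd (c p) q = y"
        using y(2) chart_inv_mem [OF ch yV] snd_chart_inv [OF ch yV] by auto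
      show "chart_inv (c p) (snd (c p) q) = q"
        using y sq by simp
      show "snd (c p) q \<in> E \<inter> ball (snd (c p) p) (r p)"
        using q qf sq y(1) unfolding E_def by blast
    qed
    finally show ?thesis .
  qed
  have "(\<Sum>q\<in>S. residue_form A q \<omega>) = (\<Sum>q\<in>(\<Union>p\<in>T. S \<inter> B p). residue_form A q \<omega>)"
  proof -
    have "(\<Union>p\<in>T. S \<inter> B p) = S"
      using S(2) by (auto simp: disc_union_def B_def)
    then show ?thesis by simp
  qed
  also have "\<dots> = (\<Sum>p\<in>T. \<Sum>q\<in>S \<inter> B p. residue_form A q \<omega>)"
  proof (rule sum.UNION_disjoint [OF T])
    show "\<forall>p\<in>T. \<forall>q\<in>T. p \<noteq> q \<longrightarrow> S \<inter> B p \<inter> (S \<inter> B q) = {}"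
    proof (intro ballI impI)
      fix p q assume pq: "p \<in> T" "q \<in> T" "p \<noteq> q"
      have "B p \<inter> B q = {}"
        using pq D ball_subset_cball unfolding B_def disc_system_def by blast
      then show "S \<inter> B p \<inter> (S \<inter> B q) = {}" by blast
    qed
  qed (use S in auto)
  finally show ?thesis
    by (simp add: each sum_distrib_left)
qed

section \<open>Level sets of meromorphic functions\<close>

lemma meromorphic_fun_continuous_on:
  fixes A :: "('a::t2_space) chart set"
  assumes A: "complex_structure A" and S: "finite S" and f: "meromorphic_fun A S f"
  shows "continuous_on (- S) f"
proof -
  have "continuous_on (\<Union>c\<in>A. fst c - S) f"
  proof (intro continuous_on_open_UN)
    fix c assume c: "c \<in> A"
    then have ch: "is_chart c" using complex_structureD(1) [OF A] by blast
    show "open (fst c - S)"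
      using ch S by (auto simp: is_chart_def intro: open_Diff finite_imp_closed)
    have "continuous_on (fst c - S) ((f \<circ> chart_inv c) \<circ> snd c)"
    proof (rule continuous_on_compose)
      show "continuous_on (fst c - S) (snd c)"
        using ch unfolding is_chart_def homeomorphism_def by (meson Diff_subset continuous_on_subset)
      show "continuous_on (snd c ` (fst c - S)) (f \<circ> chart_inv c)"
        using f c unfolding meromorphic_fun_def by (blast intro: holomorphic_on_imp_continuous_on)
    qed
    then show "continuous_on (fst c - S) f"
      by (rule continuous_on_eq) (use chart_inv_snd [OF ch] in auto)
  qed
  moreover have "(\<Union>c\<in>A. fst c - S) = - S"
    using complex_structureD(3) [OF A] by blast
  ultimately show ?thesis by simp
qed

text \<open>An identity theorem: by the Laurent expansion, near each point \<open>f\<close> is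
  either constantly \<open>v\<close> or never \<open>v\<close>, and both cases are open conditions,
  so connectedness leaves only one. In the second case the level set has no limit point and
  compactness makes it finite. Punctured neighbourhoods keep the dummy values on \<open>S\<close>
  out of the argument.\<close>

lemma finite_level_set:
  fixes A :: "('a::t2_space) chart set"
  assumes A: "complex_structure A" and X: "compact (UNIV :: 'a set)" "connected (UNIV :: 'a set)"
    and S: "finite S" and f: "meromorphic_fun A S f" and nc: "\<not> (\<exists>k. \<forall>p. p \<notin> S \<longrightarrow> f p = k)"
  shows "finite {p. f p = v}"
proof -
  have alt: "(\<forall>\<^sub>F y in at p. f y = v) \<or> (\<forall>\<^sub>F y in at p. f y \<noteq> v)" for p
  proof -
    obtain c where c: "c \<in> A" "p \<in> fst c" using complex_structureD(3) [OF A] by blast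
    then have ch: "is_chart c" using complex_structureD(1) [OF A] by blast
    have "(\<lambda>w. f (chart_inv c w) - v) meromorphic_on snd c ` fst c"
      using f c unfolding meromorphic_fun_def o_def by (auto intro!: meromorphic_intros)
    then obtain G where "(\<lambda>x. f (chart_inv c (snd c p + x)) - v) has_laurent_expansion G"
      using c unfolding meromorphic_on_def by blast
    then have "(\<forall>\<^sub>F w in at (snd c p). f (chart_inv c w) - v = 0) \<or>
        (\<forall>\<^sub>F w in at (snd c p). f (chart_inv c w) - v \<noteq> 0)"
      using has_laurent_expansion_eventually_zero_iff [of "\<lambda>w. f (chart_inv c w) - v"]
        has_laurent_expansion_eventually_nonzero_iff [of "\<lambda>w. f (chart_inv c w) - v"] by blast
    then show ?thesis
      unfolding eventually_at_chart [OF ch c(2)] by simp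
  qed
  \<comment> \<open>Validity on a punctured neighbourhood of a point is inherited by all nearby
    points; this makes \<open>Z\<close> and \<open>Z'\<close> open.\<close>
  have spread: "\<exists>W. open W \<and> p \<in> W \<and> (\<forall>y\<in>W. \<forall>\<^sub>F x in at y. R x)" if R: "\<forall>\<^sub>F x in at p. R x" for R and p :: 'a
  proof -
    obtain W where W: "open W" "p \<in> W" "\<And>y. y \<in> W \<Longrightarrow> y \<noteq> p \<Longrightarrow> R y"
      using R by (auto simp: eventually_at_topological)
    have "\<forall>\<^sub>F x in at y. R x" if y: "y \<in> W" for y
    proof (cases "y = p")
      case False
      have "\<forall>\<^sub>F x in at y. x \<in> W - {p}"
        by (rule eventually_at_in_open') (use W y False in \<open>auto intro: open_Diff\<close>)
      then show ?thesis by eventually_elim (use W in auto)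
    qed (use R in simp)
    then show ?thesis using W by blast
  qed
  define Z where "Z = {p. \<forall>\<^sub>F y in at p. f y = v}"
  define Z' where "Z' = {p. \<forall>\<^sub>F y in at p. f y \<noteq> v}"
  have oZ: "open Z" "open Z'"
    unfolding Z_def Z'_def by (subst open_subopen, use spread in fastforce)+
  have "Z \<inter> Z' = {}"
  proof -
    have False if "p \<in> Z" "p \<in> Z'" for p
    proof -
      have "\<forall>\<^sub>F y in at p. f y = v" "\<forall>\<^sub>F y in at p. f y \<noteq> v"
        using that by (auto simp: Z_def Z'_def)
      then have "\<forall>\<^sub>F y in at p. False"
        by eventually_elim simp
      then show False
        using at_neq_bot_surface [OF A, of p] by (simp add: trivial_limit_def)
    qed
    then show ?thesis by blast
  qed
  moreover have "Z \<union> Z' = UNIV"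
    using alt by (auto simp: Z_def Z'_def)
  ultimately have "Z = {} \<or> Z' = {}"
    using connectedD [OF X(2) oZ] by auto
  moreover have "Z' \<noteq> {}"
  proof
    assume "Z' = {}"
    with \<open>Z \<union> Z' = UNIV\<close> have Z: "Z = UNIV" by simp
    have "f p = v" if p: "p \<notin> S" for p
    proof -
      have "open (- S)"
        using S by (intro open_Compl finite_imp_closed)
      then have "isCont f p"
        using meromorphic_fun_continuous_on [OF A S f] p by (simp add: continuous_on_eq_continuous_at)
      then have "(f \<longlongrightarrow> f p) (at p)" by (simp add: isCont_def)
      moreover have "(f \<longlongrightarrow> v) (at p)"
        using Z by (intro tendsto_eventually) (auto simp: Z_def)
      ultimately show ?thesis
        using tendsto_unique [OF at_neq_bot_surface [OF A]] by blast
    qed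
    then show False using nc by blast
  qed
  ultimately have "Z' = UNIV"
    using \<open>Z \<union> Z' = UNIV\<close> by blast
  then have "\<not> p islimpt {p. f p = v}" for p
    by (auto simp: islimpt_iff_eventually Z'_def)
  then show ?thesis
    using finite_not_islimpt_in_compact [OF X(1), of "{p. f p = v}"] by simp
qed

text \<open>Differentiation under the integral sign, with \<open>v\<close> as the parameter. The
  Leibniz rule asks for a convex parameter set, hence the use on balls below.\<close>

lemma holomorphic_circlepath_quotient:
  assumes h: "continuous_on (sphere z0 r) h" and f: "continuous_on (sphere z0 r) f" and "r > 0"
    and U: "convex U" and ne: "\<And>v \<zeta>. v \<in> U \<Longrightarrow> \<zeta> \<in> sphere z0 r \<Longrightarrow> f \<zeta> \<noteq> v"
  shows "(\<lambda>v. contour_integral (circlepath z0 r) (\<lambda>\<zeta>. h \<zeta> / (f \<zeta> - v))) holomorphic_on U"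
proof -
  define g where "g = circlepath z0 r"
  define D where "D t = vector_derivative g (at t)" for t
  have gs: "g t \<in> sphere z0 r" if "t \<in> {0..1}" for t
    using that \<open>r > 0\<close> path_image_circlepath_nonneg [of r z0] unfolding g_def path_image_def by auto
  have cg: "continuous_on {0..1} g"
    unfolding g_def using path_circlepath by (simp add: path_def)
  have cD: "continuous_on {0..1} D"
    unfolding D_def g_def vector_derivative_circlepath by (intro continuous_intros)
  have ch: "continuous_on {0..1} (\<lambda>t. h (g t))" and cf: "continuous_on {0..1} (\<lambda>t. f (g t))"
    using gs by (auto intro!: continuous_on_compose2 [OF h cg] continuous_on_compose2 [OF f cg])
  have "(\<lambda>v. integral (cbox 0 1) (\<lambda>t. h (g t) / (f (g t) - v) * D t)) holomorphic_on U"
  proof (rule leibniz_rule_holomorphic [where fx = "\<lambda>v t. h (g t) / (f (g t) - v)\<^sup>2 * D t"])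
    fix v t assume v: "v \<in> U" "t \<in> cbox 0 (1::real)"
    then have "f (g t) - v \<noteq> 0" using ne [OF v(1) gs] by auto
    then show "((\<lambda>v. h (g t) / (f (g t) - v) * D t) has_field_derivative h (g t) / (f (g t) - v)\<^sup>2 * D t) (at v within U)"
      by (auto intro!: derivative_eq_intros simp: power2_eq_square)
  next
    fix v assume v: "v \<in> U"
    show "(\<lambda>t. h (g t) / (f (g t) - v) * D t) integrable_on cbox 0 1"
      using ne [OF v gs] by (intro integrable_continuous continuous_intros) (auto intro: ch cf cD)
  next
    have P: "continuous_on (U \<times> cbox 0 1) (\<lambda>x. k (snd x))" if "continuous_on {0..1} k" for k :: "real \<Rightarrow> complex"
      by (rule continuous_on_compose2 [OF that]) (auto intro!: continuous_intros)
    show "continuous_on (U \<times> cbox 0 1) (\<lambda>(v, t). h (g t) / (f (g t) - v)\<^sup>2 * D t)"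
      unfolding case_prod_beta
      by (intro continuous_intros P ch cf cD) (use ne gs in auto)
  qed (rule U)
  then show ?thesis
    by (simp add: contour_integral_integral g_def D_def)
qed


lemma meromorphic_form_quotient:
  assumes "meromorphic_form A S \<omega>" "meromorphic_fun A S f" "complex_structure A"
  shows "meromorphic_form A (S \<union> {p. f p = v}) (\<lambda>c p. \<omega> c p / (f p - v))"
  unfolding meromorphic_form_def
proof (intro conjI ballI)
  fix c assume c: "c \<in> A"
  let ?T = "S \<union> {p. f p = v}"
  have \<omega>: "(\<lambda>w. \<omega> c (chart_inv c w)) meromorphic_on snd c ` fst c"
    "(\<lambda>w. \<omega> c (chart_inv c w)) holomorphic_on snd c ` (fst c - S)"
    and f: "(\<lambda>w. f (chart_inv c w)) meromorphic_on snd c ` fst c"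
    "(\<lambda>w. f (chart_inv c w)) holomorphic_on snd c ` (fst c - S)"
    using assms c by (auto simp: meromorphic_form_def meromorphic_fun_def o_def)
  show "((\<lambda>p. \<omega> c p / (f p - v)) \<circ> chart_inv c) meromorphic_on snd c ` fst c"
    unfolding o_def by (intro meromorphic_intros \<omega> f)
  show "((\<lambda>p. \<omega> c p / (f p - v)) \<circ> chart_inv c) holomorphic_on snd c ` (fst c - ?T)"
    unfolding o_def
  proof (intro holomorphic_intros holomorphic_on_subset [OF \<omega>(2)] holomorphic_on_subset [OF f(2)])
    fix w assume "w \<in> snd c ` (fst c - ?T)"
    then show "f (chart_inv c w) - v \<noteq> 0"
      using complex_structureD(1) [OF assms(3) c] by (auto simp: chart_inv_snd)
  qed auto
next
  fix c d p assume "c \<in> A" "d \<in> A" "p \<in> fst c \<inter> fst d - (S \<union> {p. f p = v})"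
  then have "\<omega> c p = \<omega> d p * deriv (snd d \<circ> chart_inv c) (snd c p)"
    using assms(1) unfolding meromorphic_form_def by blast
  then show "\<omega> c p / (f p - v) = \<omega> d p / (f p - v) * deriv (snd d \<circ> chart_inv c) (snd c p)"
    by simp
qed


lemma contour_integral_cmult:
  "contour_integral g (\<lambda>x. c * f x) = c * contour_integral g f"
  by (simp add: contour_integral_integral mult.assoc)

theorem sum_residues_eq_0:
  fixes A :: "('a::t2_space) chart set"
  assumes A: "complex_structure A" and X: "compact (UNIV :: 'a set)" "connected (UNIV :: 'a set)"
    and S: "finite S" and f: "meromorphic_fun A S f" and nc: "\<not> (\<exists>k. \<forall>p. p \<notin> S \<longrightarrow> f p = k)"
    and \<omega>: "meromorphic_form A S \<omega>"
  shows "(\<Sum>p\<in>S. residue_form A p \<omega>) = 0"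
proof -
  define Sv where "Sv v = S \<union> {p. f p = v}" for v
  define \<omega>v where "\<omega>v v c p = \<omega> c p / (f p - v)" for v c p
  define R where "R v = (\<Sum>q\<in>Sv v. residue_form A q (\<omega>v v))" for v
  have finS: "finite (Sv v)" for v
    using S finite_level_set [OF A X S f nc] by (simp add: Sv_def)
  have form: "meromorphic_form A (Sv v) (\<omega>v v)" for v
    using meromorphic_form_quotient [OF \<omega> f A, of v] by (simp add: Sv_def \<omega>v_def [abs_def])
  have contf: "continuous_on (- S) f"
    by (rule meromorphic_fun_continuous_on [OF A S f])
  have cptK: "compact (- disc_union T c r)" if "disc_system A T c r" for T c r
    using compact_Int_closed [OF X(1), of "- disc_union T c r"] disc_union_open(1) [OF A that] by auto
  have R_eq: "(\<Sum>p\<in>T. contour_integral (circlepath (snd (c p) p) (r p))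
      (\<lambda>\<zeta>. (\<omega> (c p) \<circ> chart_inv (c p)) \<zeta> / ((f \<circ> chart_inv (c p)) \<zeta> - v))) = 2 * pi * \<i> * R v"
    if "disc_system A T c r" "finite T" "Sv v \<subseteq> disc_union T c r" for T c r v
    using sum_residues_disc_system [OF A that(1,2) finS that(3) form]
    by (simp add: R_def \<omega>v_def [abs_def] o_def)
  have cont: "continuous_on (sphere (snd (c p) p) (r p)) (\<omega> (c p) \<circ> chart_inv (c p))"
    "continuous_on (sphere (snd (c p) p) (r p)) (f \<circ> chart_inv (c p))"
    if D: "disc_system A T c r" and ST: "S \<subseteq> T" and p: "p \<in> T" for T c r p
  proof -
    note d = disc_systemD [OF D p]
    have "sphere (snd (c p) p) (r p) \<subseteq> snd (c p) ` (fst (c p) - S)"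
    proof
      fix w assume w: "w \<in> sphere (snd (c p) p) (r p)"
      then have "w \<in> snd (c p) ` fst (c p)" using d(4) by (auto simp: sphere_def)
      moreover have "chart_inv (c p) w \<notin> S"
        using sphere_not_in_disc_union [OF A D p w] disc_union_open(2) [OF A D] ST by blast
      ultimately show "w \<in> snd (c p) ` (fst (c p) - S)"
        using complex_structureD(1) [OF A d(1)] by (auto simp: chart_inv_snd)
    qed
    then show "continuous_on (sphere (snd (c p) p) (r p)) (\<omega> (c p) \<circ> chart_inv (c p))"
      "continuous_on (sphere (snd (c p) p) (r p)) (f \<circ> chart_inv (c p))"
      using \<omega> f d(1) unfolding meromorphic_form_def meromorphic_fun_def
      by (meson holomorphic_on_imp_continuous_on continuous_on_subset)+
  qed
  have "R analytic_on {v0}" for v0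
  proof -
    define T where "T = Sv v0"
    have T: "finite T" "S \<subseteq> T" using finS by (auto simp: T_def Sv_def)
    obtain c r where D: "disc_system A T c r"
      using disc_system_exists [OF A T(1)] by blast
    \<comment> \<open>The discs surround \<open>S\<close> and the whole level set of
      \<open>v0\<close>, so \<open>v0\<close> is not a value of \<open>f\<close> on the compact set
      \<open>K\<close>. Neither are the values in a ball around it, and there the level sets stay
      inside these discs.\<close>
    define K where "K = - disc_union T c r"
    have KT: "K \<inter> T = {}"
      using disc_union_open(2) [OF A D] by (auto simp: K_def)
    have "compact (f ` K)"
      using KT T(2) cptK [OF D] by (intro compact_continuous_image continuous_on_subset [OF contf]) (auto simp: K_def)
    moreover have "v0 \<notin> f ` K"
      using KT by (auto simp: T_def Sv_def)
    ultimately have "open (- (f ` K))" "v0 \<in> - (f ` K)"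
      by (auto intro: compact_imp_closed)
    then obtain e where e: "e > 0" "ball v0 e \<subseteq> - (f ` K)"
      by (meson open_contains_ball)
    define F where "F v = (\<Sum>p\<in>T. contour_integral (circlepath (snd (c p) p) (r p))
      (\<lambda>\<zeta>. (\<omega> (c p) \<circ> chart_inv (c p)) \<zeta> / ((f \<circ> chart_inv (c p)) \<zeta> - v))) / (2 * pi * \<i>)" for v
    have "F holomorphic_on ball v0 e"
      unfolding F_def
    proof (intro holomorphic_intros holomorphic_circlepath_quotient cont [OF D T(2)])
      fix p v \<zeta> assume p: "p \<in> T" and v: "v \<in> ball v0 e" and \<zeta>: "\<zeta> \<in> sphere (snd (c p) p) (r p)"
      have "chart_inv (c p) \<zeta> \<in> K"
        using sphere_not_in_disc_union [OF A D p \<zeta>] by (simp add: K_def)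
      then show "(f \<circ> chart_inv (c p)) \<zeta> \<noteq> v"
        using v e(2) by auto
    qed (use disc_systemD [OF D] in auto)
    moreover have "F v = R v" if v: "v \<in> ball v0 e" for v
    proof -
      have "Sv v \<subseteq> disc_union T c r"
        using v e(2) disc_union_open(2) [OF A D] T(2) by (auto simp: Sv_def K_def)
      from R_eq [OF D T(1) this] show ?thesis by (simp add: F_def)
    qed
    ultimately have "R holomorphic_on ball v0 e"
      by (rule holomorphic_transform)
    then show "R analytic_on {v0}"
      using e(1) unfolding analytic_at by (intro exI [of _ "ball v0 e"]) auto
  qed
  then have "R analytic_on UNIV"
    using analytic_on_analytic_at by blast
  then have holR: "R holomorphic_on UNIV"
    by (rule analytic_imp_holomorphic)
  \<comment> \<open>Now the discs surround \<open>S\<close> only. Since \<open>f\<close> is bounded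
    by \<open>M\<close> on their complement, all level sets of values larger than \<open>M\<close>
    lie inside them.\<close>
  obtain c r where D: "disc_system A S c r"
    using disc_system_exists [OF A S] by blast
  define K where "K = - disc_union S c r"
  have KS: "K \<subseteq> - S"
    using disc_union_open(2) [OF A D] by (auto simp: K_def)
  have "compact (f ` K)"
    using KS cptK [OF D] by (intro compact_continuous_image continuous_on_subset [OF contf]) (auto simp: K_def)
  then obtain M where M: "M > 0" "\<And>q. q \<in> K \<Longrightarrow> norm (f q) \<le> M"
    using compact_imp_bounded bounded_pos by (metis image_eqI)
  have sphK: "norm ((f \<circ> chart_inv (c p)) \<zeta>) \<le> M" if "p \<in> S" "\<zeta> \<in> sphere (snd (c p) p) (r p)" for p \<zeta>
    using M(2) sphere_not_in_disc_union [OF A D that] by (simp add: K_def)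
  have large: "\<forall>\<^sub>F v in at_infinity. norm v > B" for B :: real
    unfolding eventually_at_infinity by (rule exI [of _ "B + 1"]) auto
  \<comment> \<open>On the circles \<open>f\<close> is bounded, so v / (f - v) tends to -1
    uniformly.\<close>
  have lim: "((\<lambda>v. contour_integral (circlepath (snd (c p) p) (r p))
      (\<lambda>\<zeta>. v * ((\<omega> (c p) \<circ> chart_inv (c p)) \<zeta> / ((f \<circ> chart_inv (c p)) \<zeta> - v)))) \<longlongrightarrow>
      contour_integral (circlepath (snd (c p) p) (r p)) (\<lambda>\<zeta>. - (\<omega> (c p) \<circ> chart_inv (c p)) \<zeta>)) at_infinity"
    if p: "p \<in> S" for p
  proof (rule contour_integral_uniform_limit_circlepath)
    let ?s = "sphere (snd (c p) p) (r p)"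
    define h k where "h = \<omega> (c p) \<circ> chart_inv (c p)" and "k = f \<circ> chart_inv (c p)"
    have hk: "continuous_on ?s h" "continuous_on ?s k"
      using cont [OF D order_refl p] by (simp_all add: h_def k_def)
    have kM: "norm (k \<zeta>) \<le> M" if "\<zeta> \<in> ?s" for \<zeta>
      using sphK [OF p that] by (simp add: k_def)
    have "\<forall>\<^sub>F v in at_infinity. (\<lambda>\<zeta>. v * (h \<zeta> / (k \<zeta> - v))) contour_integrable_on circlepath (snd (c p) p) (r p)"
      using large [of M]
    proof eventually_elim
      case (elim v)
      have "continuous_on ?s (\<lambda>\<zeta>. v * (h \<zeta> / (k \<zeta> - v)))"
        using kM elim by (intro continuous_intros hk) fastforce
      then show ?case
        using disc_systemD(3) [OF D p] by (intro contour_integrable_continuous_circlepath) auto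
    qed
    then show "\<forall>\<^sub>F v in at_infinity. (\<lambda>\<zeta>. v * ((\<omega> (c p) \<circ> chart_inv (c p)) \<zeta> / ((f \<circ> chart_inv (c p)) \<zeta> - v)))
        contour_integrable_on circlepath (snd (c p) p) (r p)"
      by (simp add: h_def k_def)
    have "uniform_limit ?s (\<lambda>v \<zeta>. v * (h \<zeta> / (k \<zeta> - v))) (\<lambda>\<zeta>. - h \<zeta>) at_infinity"
    proof (rule uniform_limitI)
      fix e :: real assume e: "e > 0"
      have "compact (h ` ?s)"
        by (intro compact_continuous_image hk) auto
      then obtain H where H: "H > 0" "\<And>\<zeta>. \<zeta> \<in> ?s \<Longrightarrow> norm (h \<zeta>) \<le> H"
        using compact_imp_bounded bounded_pos by (metis image_eqI)
      show "\<forall>\<^sub>F v in at_infinity. \<forall>\<zeta>\<in>?s. dist (v * (h \<zeta> / (k \<zeta> - v))) (- h \<zeta>) < e"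
        \<comment> \<open>The error is h k / (k - v), bounded by H M / |k - v|. Beyond this
          threshold the denominator exceeds H M / e, because |k| is at most M.\<close>
        using large [of "M + H * M / e"]
      proof eventually_elim
        case (elim v)
        show ?case
        proof
          fix \<zeta> assume \<zeta>: "\<zeta> \<in> ?s"
          have "H * M / e > 0" using H M e by simp
          have n: "norm (k \<zeta> - v) > H * M / e"
            using norm_triangle_ineq2 [of v "k \<zeta>"] kM [OF \<zeta>] elim by (simp add: norm_minus_commute)
          then have nz: "k \<zeta> - v \<noteq> 0" using \<open>H * M / e > 0\<close> by auto
          have "v * (h \<zeta> / (k \<zeta> - v)) - - h \<zeta> = h \<zeta> * k \<zeta> / (k \<zeta> - v)"
            using nz by (simp add: field_simps)
          then have "dist (v * (h \<zeta> / (k \<zeta> - v))) (- h \<zeta>) = norm (h \<zeta>) * norm (k \<zeta>) / norm (k \<zeta> - v)"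
            by (simp add: dist_norm norm_mult norm_divide)
          also have "\<dots> \<le> H * M / norm (k \<zeta> - v)"
            using H kM [OF \<zeta>] \<zeta> by (intro divide_right_mono mult_mono) auto
          also have "\<dots> < e"
            using n nz e by (simp add: field_simps)
          finally show "dist (v * (h \<zeta> / (k \<zeta> - v))) (- h \<zeta>) < e" .
        qed
      qed
    qed
    then show "uniform_limit ?s (\<lambda>v \<zeta>. v * ((\<omega> (c p) \<circ> chart_inv (c p)) \<zeta> / ((f \<circ> chart_inv (c p)) \<zeta> - v)))
        (\<lambda>\<zeta>. - (\<omega> (c p) \<circ> chart_inv (c p)) \<zeta>) at_infinity"
      by (simp add: h_def k_def)
  qed (use disc_systemD(3) [OF D p] trivial_limit_at_infinity in auto)
  define \<rho> where "\<rho> = (\<Sum>q\<in>S. residue_form A q \<omega>)"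
  have \<rho>: "(\<Sum>p\<in>S. contour_integral (circlepath (snd (c p) p) (r p)) (\<lambda>\<zeta>. - (\<omega> (c p) \<circ> chart_inv (c p)) \<zeta>)) =
      2 * pi * \<i> * (- \<rho>)"
    using sum_residues_disc_system [OF A D S S disc_union_open(2) [OF A D] \<omega>]
    by (simp add: \<rho>_def sum_negf contour_integral_cmult [of _ "-1", simplified] o_def)
  have "((\<lambda>v. 2 * pi * \<i> * (v * R v)) \<longlongrightarrow> 2 * pi * \<i> * (- \<rho>)) at_infinity"
    unfolding \<rho> [symmetric]
  proof (rule Lim_transform_eventually [OF tendsto_sum [OF lim]])
    show "\<forall>\<^sub>F v in at_infinity. (\<Sum>p\<in>S. contour_integral (circlepath (snd (c p) p) (r p))
      (\<lambda>\<zeta>. v * ((\<omega> (c p) \<circ> chart_inv (c p)) \<zeta> / ((f \<circ> chart_inv (c p)) \<zeta> - v)))) = 2 * pi * \<i> * (v * R v)"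
      using large [of M]
    proof eventually_elim
      case (elim v)
      have "Sv v \<subseteq> disc_union S c r"
        using elim M(2) disc_union_open(2) [OF A D] by (fastforce simp: Sv_def K_def)
      from R_eq [OF D S this] show ?case
        by (simp only: contour_integral_cmult sum_distrib_left [symmetric]) (simp only: mult_ac)
    qed
  qed
  then have lim1: "((\<lambda>v. v * R v) \<longlongrightarrow> - \<rho>) at_infinity"
    by (subst (asm) tendsto_mult_left_iff) auto
  have "((\<lambda>v. inverse v * (v * R v)) \<longlongrightarrow> 0 * - \<rho>) at_infinity"
    by (intro tendsto_mult lim1 tendsto_inverse_0)
  moreover have "\<forall>\<^sub>F v in at_infinity. inverse v * (v * R v) = R v"
    using large [of 0] by eventually_elim auto
  ultimately have "(R \<longlongrightarrow> 0) at_infinity"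
    by (simp add: tendsto_cong)
  then have "R v = 0" for v
    by (rule Liouville_weak [OF holR])
  then have "((\<lambda>v :: complex. 0) \<longlongrightarrow> - \<rho>) at_infinity"
    using lim1 by simp
  then have "- \<rho> = 0"
    using tendsto_unique [OF trivial_limit_at_infinity] tendsto_const by blast
  then show ?thesis by (simp add: \<rho>_def)
qed

section \<open>Expansions of matrix-valued functions\<close>

text \<open>Like \<open>has_laurent_expansion\<close>, it ignores the value at the centre, so the
  dummy values at singular points do no harm.\<close>

definition has_expansion :: "(complex \<Rightarrow> complex^'n^'m) \<Rightarrow> complex \<Rightarrow> complex fls^'n^'m \<Rightarrow> bool" where
  "has_expansion M z F \<longleftrightarrow> (\<forall>i j. (\<lambda>x. M (z + x) $ i $ j) has_laurent_expansion F $ i $ j)"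

lemma has_expansion_unique: "has_expansion M z F \<Longrightarrow> has_expansion M z G \<Longrightarrow> F = G"
  unfolding has_expansion_def vec_eq_iff using has_laurent_expansion_unique by blast

lemma has_expansion_cong:
  assumes "\<forall>\<^sub>F w in at z. M w = M' w"
  shows "has_expansion M z F \<longleftrightarrow> has_expansion M' z F"
proof -
  have "((\<lambda>x. M (z + x) $ i $ j) has_laurent_expansion G) \<longleftrightarrow>
      ((\<lambda>x. M' (z + x) $ i $ j) has_laurent_expansion G)" for i j G
    by (rule has_laurent_expansion_cong' [where f = "\<lambda>x. M x $ i $ j" and g = "\<lambda>x. M' x $ i $ j"])
       (use assms in \<open>auto elim: eventually_mono\<close>)
  then show ?thesis by (simp add: has_expansion_def)
qed

lemma has_expansion_add: "has_expansion M z F \<Longrightarrow> has_expansion M' z F' \<Longrightarrow> has_expansion (\<lambda>w. M w + M' w) z (F + F')"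
  by (simp add: has_expansion_def laurent_expansion_intros)

lemma has_expansion_diff: "has_expansion M z F \<Longrightarrow> has_expansion M' z F' \<Longrightarrow> has_expansion (\<lambda>w. M w - M' w) z (F - F')"
  by (simp add: has_expansion_def laurent_expansion_intros)

lemma has_expansion_minus: "has_expansion M z F \<Longrightarrow> has_expansion (\<lambda>w. - M w) z (- F)"
  by (simp add: has_expansion_def laurent_expansion_intros)

lemma has_expansion_mult: "has_expansion M z F \<Longrightarrow> has_expansion M' z F' \<Longrightarrow> has_expansion (\<lambda>w. M w ** M' w) z (F ** F')"
  by (simp add: has_expansion_def matrix_matrix_mult_def laurent_expansion_intros)

lemma has_expansion_const: "has_expansion (\<lambda>w. M) z (mconst M)"
  by (simp add: has_expansion_def mconst_def)

lemma has_expansion_transpose: "has_expansion M z F \<Longrightarrow> has_expansion (\<lambda>w. transpose (M w)) z (transpose F)"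
  by (simp add: has_expansion_def transpose_def)

lemma has_expansion_commutator:
  "has_expansion M z F \<Longrightarrow> has_expansion M' z F' \<Longrightarrow> has_expansion (\<lambda>w. commutator (M w) (M' w)) z (mcomm F F')"
  unfolding commutator_def mcomm_def by (intro has_expansion_diff has_expansion_mult)

lemma has_expansion_cscale: "has_expansion M z F \<Longrightarrow> has_expansion (\<lambda>w. cscale a (M w)) z (smul (fls_const a) F)"
  by (simp add: has_expansion_def cscale_smul smul_def laurent_expansion_intros)

lemma has_laurent_expansion_trace:
  "has_expansion M z F \<Longrightarrow> (\<lambda>x. trace (M (z + x))) has_laurent_expansion trace F"
  by (simp add: has_expansion_def trace_def laurent_expansion_intros)

lemma has_expansion_deriv:
  assumes "has_expansion M z F"
  shows "has_expansion (\<lambda>w. \<chi> i j. deriv (\<lambda>w. M w $ i $ j) w) z (mderiv F)"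
  unfolding has_expansion_def
proof (intro allI)
  fix i j
  have "deriv (\<lambda>x. M (z + x) $ i $ j) has_laurent_expansion fls_deriv (F $ i $ j)"
    using assms by (intro laurent_expansion_intros) (simp add: has_expansion_def)
  moreover have "deriv (\<lambda>x. M (z + x) $ i $ j) = (\<lambda>x. deriv (\<lambda>w. M w $ i $ j) (z + x))"
    by (rule ext, subst (1 2) deriv_shift_0) (simp add: o_def add.assoc)
  ultimately show "(\<lambda>x. (\<chi> i j. deriv (\<lambda>w. M w $ i $ j) (z + x)) $ i $ j) has_laurent_expansion mderiv F $ i $ j"
    by (simp add: mderiv_def)
qed

lemma has_expansion_exists:
  assumes "\<And>i j. (\<lambda>w. M w $ i $ j) meromorphic_on {z}"
  obtains F where "has_expansion M z F"
proof
  show "has_expansion M z (\<chi> i j. laurent_expansion (\<lambda>w. M w $ i $ j) z)"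
    unfolding has_expansion_def
    using meromorphic_on_imp_has_laurent_expansion [OF assms] by simp
qed

section \<open>The symplectic Lie algebra and its Laurent coefficients\<close>

lemma mem_sp_iff:
  assumes "invertible \<sigma>"
  shows "X \<in> sp \<sigma> \<longleftrightarrow> sp_like \<sigma> X"
proof
  have inv: "\<sigma> ** matrix_inv \<sigma> = mat 1" "matrix_inv \<sigma> ** \<sigma> = mat 1"
    using assms unfolding invertible_def matrix_inv_def by (metis (mono_tags, lifting) someI_ex)+
  show "sp_like \<sigma> X" if "X \<in> sp \<sigma>"
  proof -
    have "transpose X ** \<sigma> = - (\<sigma> ** X ** (matrix_inv \<sigma> ** \<sigma>))"
      using that by (simp add: sp_def matrix_uminus_left matrix_mul_assoc)
    then show ?thesis by (simp add: sp_like_def inv matrix_mul_rid)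
  qed
  show "X \<in> sp \<sigma>" if "sp_like \<sigma> X"
  proof -
    have "transpose X ** \<sigma> ** matrix_inv \<sigma> = - (\<sigma> ** X ** matrix_inv \<sigma>)"
      using that by (simp add: sp_like_def matrix_uminus_left)
    then show ?thesis
      by (simp add: sp_def inv matrix_mul_assoc [symmetric] matrix_mul_rid)
  qed
qed

lemma sp_like_0: "sp_like \<sigma> 0"
  by (simp add: sp_like_def transpose_def matrix_matrix_mult_def vec_eq_iff)

lemma sp_like_add: "sp_like \<sigma> X \<Longrightarrow> sp_like \<sigma> Y \<Longrightarrow> sp_like \<sigma> (X + Y)"
proof -
  have "transpose (X + Y) = transpose X + transpose Y" by (simp add: transpose_def vec_eq_iff)
  then show "sp_like \<sigma> X \<Longrightarrow> sp_like \<sigma> Y \<Longrightarrow> sp_like \<sigma> (X + Y)"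
    by (simp add: sp_like_def matrix_add_left matrix_add_right)
qed

lemma sp_like_cscale: "sp_like \<sigma> X \<Longrightarrow> sp_like \<sigma> (cscale a X)"
proof -
  have "transpose (smul a X) = smul a (transpose X)" by (simp add: transpose_def smul_def vec_eq_iff)
  then show "sp_like \<sigma> X \<Longrightarrow> sp_like \<sigma> (cscale a X)"
    by (simp add: sp_like_def cscale_smul smul_mult_left smul_mult_right smul_minus_right)
qed

lemma sp_like_commutator:
  assumes "sp_like \<sigma> X" "sp_like \<sigma> Y"
  shows "sp_like \<sigma> (commutator X Y)"
proof -
  have t: "transpose (commutator X Y) = transpose Y ** transpose X - transpose X ** transpose Y"
    unfolding commutator_def matrix_transpose_mul [symmetric] by (simp add: transpose_def vec_eq_iff)
  have "transpose Y ** transpose X ** \<sigma> = \<sigma> ** Y ** X"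
    using assms unfolding sp_like_def
    by (metis matrix_mul_assoc matrix_uminus_left matrix_uminus_right minus_minus)
  moreover have "transpose X ** transpose Y ** \<sigma> = \<sigma> ** X ** Y"
    using assms unfolding sp_like_def
    by (metis matrix_mul_assoc matrix_uminus_left matrix_uminus_right minus_minus)
  ultimately show ?thesis
    unfolding sp_like_def t
    by (simp add: commutator_def matrix_diff_left matrix_diff_right matrix_mul_assoc)
qed

text \<open>Both sides of the defining relation have expansions, which agree by uniqueness;
  comparing coefficients gives the relation for each of them.\<close>

lemma sp_like_mnth:
  assumes M: "has_expansion M z F" and sp: "\<forall>\<^sub>F w in at z. sp_like \<sigma> (M w)"
  shows "sp_like \<sigma> (mnth F k)"
proof -
  have 1: "has_expansion (\<lambda>w. transpose (M w) ** \<sigma>) z (transpose F ** mconst \<sigma>)"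
    by (intro has_expansion_mult has_expansion_transpose has_expansion_const M)
  have 2: "has_expansion (\<lambda>w. - (\<sigma> ** M w)) z (- (mconst \<sigma> ** F))"
    by (intro has_expansion_minus has_expansion_mult has_expansion_const M)
  have "has_expansion (\<lambda>w. transpose (M w) ** \<sigma>) z (- (mconst \<sigma> ** F))"
    by (subst has_expansion_cong [OF _]) (rule eventually_mono [OF sp], simp add: sp_like_def, rule 2)
  then have "transpose F ** mconst \<sigma> = - (mconst \<sigma> ** F)"
    using has_expansion_unique [OF 1] by blast
  then have "mnth (transpose F ** mconst \<sigma>) k = mnth (- (mconst \<sigma> ** F)) k"
    by simp
  moreover have "mnth (transpose F) k = transpose (mnth F k)"
    by (simp add: mnth_def transpose_def)
  moreover have "mnth (- (mconst \<sigma> ** F)) k = - mnth (mconst \<sigma> ** F) k"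
    by (simp add: mnth_def vec_eq_iff)
  ultimately show ?thesis
    by (simp add: sp_like_def mnth_mconst_mult_right mnth_mconst_mult_left)
qed

section \<open>Closure of the Lax conditions and regularity of the cocycle series\<close>

lemma lax_series_mcomm:
  assumes "symp_pair \<sigma> a b" "\<And>k. sp_like \<sigma> (mnth F k)" "\<And>k. sp_like \<sigma> (mnth G k)"
    "\<And>k. sp_like \<sigma> (mnth (mcomm F G) k)" "lax_series \<sigma> a F" "lax_series \<sigma> a G"
  shows "lax_series \<sigma> a (mcomm F G)"
proof (rule gauged_regular_imp_lax_series [OF assms(1,4)])
  have "mat_ord_ge 0 (gauged \<sigma> a b F)" "mat_ord_ge 0 (gauged \<sigma> a b G)"
    using lax_series_imp_gauged_regular assms by blast+
  then show "mat_ord_ge 0 (gauged \<sigma> a b (mcomm F G))"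
    unfolding gauged_mcomm [OF assms(1)] unfolding mcomm_def
    using mat_ord_ge_mult [of 0 _ 0] by (intro mat_ord_ge_diff) auto
qed

lemma lax_series_add:
  assumes "symp_pair \<sigma> a b" "\<And>k. sp_like \<sigma> (mnth F k)" "\<And>k. sp_like \<sigma> (mnth G k)"
    "lax_series \<sigma> a F" "lax_series \<sigma> a G"
  shows "lax_series \<sigma> a (F + G)"
proof (rule gauged_regular_imp_lax_series [OF assms(1)])
  show "sp_like \<sigma> (mnth (F + G) k)" for k
    using assms by (simp add: mnth_add sp_like_add)
  show "mat_ord_ge 0 (gauged \<sigma> a b (F + G))"
    unfolding gauged_add using lax_series_imp_gauged_regular assms by (intro mat_ord_ge_add) blast+
qed

lemma lax_series_smul:
  assumes "symp_pair \<sigma> a b" "\<And>k. sp_like \<sigma> (mnth F k)" "lax_series \<sigma> a F"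
  shows "lax_series \<sigma> a (smul (fls_const c) F)"
proof (rule gauged_regular_imp_lax_series [OF assms(1)])
  have "mnth (smul (fls_const c) F) k = cscale c (mnth F k)" for k
    by (simp add: mnth_def cscale_smul smul_def)
  then show "sp_like \<sigma> (mnth (smul (fls_const c) F) k)" for k
    using assms by (simp add: sp_like_cscale)
  have "gauged \<sigma> a b (smul (fls_const c) F) = smul (fls_const c) (gauged \<sigma> a b F)"
    by (simp add: gauged_def smul_mult_left smul_mult_right)
  moreover have "mat_ord_ge (0 + 0) (smul (fls_const c) (gauged \<sigma> a b F))"
    by (intro mat_ord_ge_smul lax_series_imp_gauged_regular assms) (simp add: fls_ord_ge_def)
  ultimately show "mat_ord_ge 0 (gauged \<sigma> a b (smul (fls_const c) F))" by simp
qed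

lemma outer_0_right: "outer u 0 = 0"
  by (simp add: outer_def vec_eq_iff)

text \<open>The polar part of \<open>N\<close> is exactly that of \<open>- H\<close>. So
  \<open>N + H\<close> has no pole and satisfies \<open>lax_series\<close> with \<open>\<nu>\<close>
  and \<open>\<beta>\<close> equal to 0. Gauging therefore makes all three arguments regular, and
  derivatives, products and traces of regular series are regular.\<close>

lemma cocycle_series_regular:
  assumes sp: "symp_pair \<sigma> a b" and F: "\<And>k. sp_like \<sigma> (mnth F k)" "lax_series \<sigma> a F"
    and G: "\<And>k. sp_like \<sigma> (mnth G k)" "lax_series \<sigma> a G"
    and N: "\<And>k. sp_like \<sigma> (mnth N k)" "\<And>k. k < -1 \<Longrightarrow> mnth N k = 0"
      "mnth N (-1) = (outer a b + outer b a) ** \<sigma>" "mnth N 0 *v a = \<kappa> *s a"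
      "bilin (\<sigma> ** mnth N 1) a a = 0"
  shows "fls_ord_ge 0 (cocycle_series N F G)"
proof -
  define H where "H = smul fls_X_inv (mconst (proj_pos \<sigma> a b - proj_neg \<sigma> a b))"
  have H: "mnth H k = (if k = -1 then proj_pos \<sigma> a b - proj_neg \<sigma> a b else 0)" for k
    unfolding H_def mnth_smul_X_inv by (auto simp: mnth_def mconst_def vec_eq_iff)
  have N1: "mnth N (-1) = - (proj_pos \<sigma> a b - proj_neg \<sigma> a b)"
    unfolding N(3) by (simp add: matrix_add_left outer_mult proj_pos_def proj_neg_def)
  have NH: "mnth (N + H) k = (if k < 0 then 0 else mnth N k)" for k
    using N(2) by (auto simp: mnth_add H N1)
  have "lax_series \<sigma> a (N + H)"
    unfolding lax_series_def NH
    by (intro conjI exI [of _ 0] exI [of _ \<kappa>])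
       (simp_all add: N cscale_smul outer_0_left outer_0_right bilin_def [of _ 0] scalar_product_def [of 0])
  then have reg: "mat_ord_ge 0 (gauged \<sigma> a b (N + H))"
    by (intro lax_series_imp_gauged_regular sp) (auto simp: NH sp_like_0 N)
  define F' G' N' where "F' = gauged \<sigma> a b F" and "G' = gauged \<sigma> a b G" and "N' = gauged \<sigma> a b (N + H)"
  have r: "mat_ord_ge 0 F'" "mat_ord_ge 0 G'" "mat_ord_ge 0 N'"
    using lax_series_imp_gauged_regular sp F G reg by (auto simp: F'_def G'_def N'_def)
  note m = mat_ord_ge_mult [of 0 _ 0, simplified]
  have "fls_ord_ge 0 (cocycle_series N' F' G')"
    unfolding cocycle_series_def mcomm_def
    by (intro fls_ord_ge_trace mat_ord_ge_diff m mat_ord_ge_mderiv_0 r)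
  then show ?thesis
    unfolding cocycle_series_gauged [OF sp, of N] F'_def G'_def N'_def H_def .
qed

lemma mat_ord_ge_exists: "\<exists>n. mat_ord_ge n F"
proof -
  define n where "n = Min (range (\<lambda>(i, j). fls_subdegree (F $ i $ j)))"
  have "n \<le> fls_subdegree (F $ i $ j)" for i j
    unfolding n_def by (rule Min_le) (auto intro!: image_eqI [of _ _ "(i, j)"])
  then have "mat_ord_ge n F"
    unfolding mat_ord_ge_def fls_ord_ge_def by (meson fls_eq0_below_subdegree order_less_le_trans)
  then show ?thesis ..
qed

section \<open>The cocycle form in a chart\<close>

text \<open>The bridge from the form on the surface to \<open>cocycle_series\<close>. The two
  coefficients are compared where \<open>snd c\<close> inverts \<open>chart_inv c\<close>, that is,
  near \<open>snd c p\<close>, which is enough for an expansion.\<close>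

lemma cocycle_form_expansion:
  assumes ch: "is_chart c" "p \<in> fst c"
    and F: "has_expansion (\<lambda>w. L (chart_inv c w)) (snd c p) F"
    and G: "has_expansion (\<lambda>w. L' (chart_inv c w)) (snd c p) G"
    and N: "has_expansion (\<lambda>w. \<L> c (chart_inv c w)) (snd c p) N"
  shows "(\<lambda>x. cocycle_form \<L> L L' c (chart_inv c (snd c p + x))) has_laurent_expansion cocycle_series N F G"
proof -
  define D where "D w = (\<chi> i j. deriv (\<lambda>w. L' (chart_inv c w) $ i $ j) w)" for w
  define M where "M w = L (chart_inv c w) ** D w - commutator (L (chart_inv c w)) (L' (chart_inv c w)) ** \<L> c (chart_inv c w)" for w
  have "has_expansion M (snd c p) (F ** mderiv G - mcomm F G ** N)"
    unfolding M_def D_def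
    by (intro has_expansion_diff has_expansion_mult has_expansion_commutator has_expansion_deriv F G N)
  then have 1: "(\<lambda>x. trace (M (snd c p + x))) has_laurent_expansion cocycle_series N F G"
    unfolding cocycle_series_def by (rule has_laurent_expansion_trace)
  have "\<forall>\<^sub>F w in at (snd c p). w \<in> snd c ` fst c"
    by (rule eventually_at_in_open') (use ch in \<open>auto simp: is_chart_def\<close>)
  then have "\<forall>\<^sub>F w in at (snd c p). trace (M w) = cocycle_form \<L> L L' c (chart_inv c w)"
    by eventually_elim (simp add: cocycle_form_def M_def D_def dform_def bracket_def snd_chart_inv [OF ch(1)])
  then show ?thesis
    using 1 has_laurent_expansion_cong' [where f = "\<lambda>w. trace (M w)"
        and g = "\<lambda>w. cocycle_form \<L> L L' c (chart_inv c w)"] by blast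
qed

text \<open>Collects all the \<open>laurent_coeff\<close> of a matrix function at a point, so that
  the calculus of formal series applies to them.\<close>

definition chart_series :: "'a chart \<Rightarrow> 'a \<Rightarrow> ('a \<Rightarrow> complex^'n^'m) \<Rightarrow> complex fls^'n^'m" where
  "chart_series c p X = (\<chi> i j. laurent_expansion (\<lambda>w. X (chart_inv c w) $ i $ j) (snd c p))"

lemma laurent_coeff_eq_mnth_chart_series: "laurent_coeff c p X k = mnth (chart_series c p X) k"
  by (simp add: laurent_coeff_def mnth_def chart_series_def)

lemma chart_series_eqI:
  assumes "has_expansion (\<lambda>w. X (chart_inv c w)) (snd c p) F"
  shows "chart_series c p X = F"
proof -
  have "laurent_expansion (\<lambda>w. X (chart_inv c w) $ i $ j) (snd c p) = F $ i $ j" for i j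
    using assms by (intro laurent_expansion_eqI) (simp add: has_expansion_def)
  then show ?thesis by (simp add: chart_series_def vec_eq_iff)
qed

lemma has_expansion_chart_series:
  assumes "\<And>i j. (\<lambda>w. X (chart_inv c w) $ i $ j) meromorphic_on snd c ` fst c" "p \<in> fst c"
  shows "has_expansion (\<lambda>w. X (chart_inv c w)) (snd c p) (chart_series c p X)"
proof -
  obtain F where "has_expansion (\<lambda>w. X (chart_inv c w)) (snd c p) F"
    by (rule has_expansion_exists [of "\<lambda>w. X (chart_inv c w)" "snd c p"])
       (rule meromorphic_on_subset [OF assms(1)], use assms(2) in auto)
  then show ?thesis using chart_series_eqI by metis
qed

lemma matrix_fun_chart_series:
  assumes "\<forall>i j. meromorphic_fun A S (\<lambda>p. L p $ i $ j)" "c \<in> A" "p \<in> fst c"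
  shows "has_expansion (\<lambda>w. L (chart_inv c w)) (snd c p) (chart_series c p L)"
  using assms by (intro has_expansion_chart_series) (auto simp: meromorphic_fun_def o_def)

lemma matrix_form_chart_series:
  assumes "\<forall>i j. meromorphic_form A S (\<lambda>c p. \<L> c p $ i $ j)" "c \<in> A" "p \<in> fst c"
  shows "has_expansion (\<lambda>w. \<L> c (chart_inv c w)) (snd c p) (chart_series c p (\<L> c))"
  using assms by (intro has_expansion_chart_series) (auto simp: meromorphic_form_def o_def)

text \<open>Under a change of coordinate the given form and the differential of \<open>L'\<close>
  acquire the same factor, by hypothesis and by the chain rule, while \<open>L\<close> and the
  bracket are functions.\<close>

lemma cocycle_form_meromorphic_form:
  fixes A :: "('a::t2_space) chart set"
  assumes A: "complex_structure A" and S: "finite S"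
    and L: "\<forall>i j. meromorphic_fun A S (\<lambda>p. L p $ i $ j)"
    and L': "\<forall>i j. meromorphic_fun A S (\<lambda>p. L' p $ i $ j)"
    and \<L>: "\<forall>i j. meromorphic_form A S (\<lambda>c p. \<L> c p $ i $ j)"
  shows "meromorphic_form A S (cocycle_form \<L> L L')"
  unfolding meromorphic_form_def
proof (intro conjI ballI)
  fix c assume c: "c \<in> A"
  then have ch: "is_chart c" using complex_structureD(1) [OF A] by blast
  show "(cocycle_form \<L> L L' c \<circ> chart_inv c) meromorphic_on snd c ` fst c"
    unfolding meromorphic_on_def o_def
  proof
    fix w assume "w \<in> snd c ` fst c"
    then obtain p where p: "p \<in> fst c" "w = snd c p" by blast
    show "\<exists>F. (\<lambda>x. cocycle_form \<L> L L' c (chart_inv c (w + x))) has_laurent_expansion F"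
      unfolding p(2)
      by (rule exI, rule cocycle_form_expansion [where \<L> = \<L>, OF ch p(1) matrix_fun_chart_series [OF L c p(1)]
            matrix_fun_chart_series [OF L' c p(1)] matrix_form_chart_series [OF \<L> c p(1)]])
  qed
  define W where "W = snd c ` (fst c - S)"
  have "open W"
    unfolding W_def using S open_snd_image [OF ch, of "- S"]
    by (simp add: Diff_eq open_Compl finite_imp_closed)
  have hol: "(\<lambda>w. L (chart_inv c w) $ i $ j) holomorphic_on W"
    "(\<lambda>w. L' (chart_inv c w) $ i $ j) holomorphic_on W"
    "(\<lambda>w. \<L> c (chart_inv c w) $ i $ j) holomorphic_on W" for i j
    using L L' \<L> c unfolding meromorphic_fun_def meromorphic_form_def W_def o_def by blast+
  \<comment> \<open>The trace is written out in entries to reduce to sums and products of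
    holomorphic functions and their derivatives.\<close>
  have "(\<lambda>w. \<Sum>i\<in>UNIV. (\<Sum>k\<in>UNIV. L (chart_inv c w) $ i $ k * deriv (\<lambda>w. L' (chart_inv c w) $ k $ i) w) -
      (\<Sum>k\<in>UNIV. ((\<Sum>l\<in>UNIV. L (chart_inv c w) $ i $ l * L' (chart_inv c w) $ l $ k) -
        (\<Sum>l\<in>UNIV. L' (chart_inv c w) $ i $ l * L (chart_inv c w) $ l $ k)) * \<L> c (chart_inv c w) $ k $ i))
      holomorphic_on W"
    by (intro holomorphic_intros hol \<open>open W\<close>)
  then show "(cocycle_form \<L> L L' c \<circ> chart_inv c) holomorphic_on snd c ` (fst c - S)"
    unfolding W_def [symmetric]
  proof (rule holomorphic_transform)
    fix w assume "w \<in> W"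
    then have "snd c (chart_inv c w) = w"
      using ch by (auto simp: W_def chart_inv_snd)
    then show "(\<Sum>i\<in>UNIV. (\<Sum>k\<in>UNIV. L (chart_inv c w) $ i $ k * deriv (\<lambda>w. L' (chart_inv c w) $ k $ i) w) -
      (\<Sum>k\<in>UNIV. ((\<Sum>l\<in>UNIV. L (chart_inv c w) $ i $ l * L' (chart_inv c w) $ l $ k) -
        (\<Sum>l\<in>UNIV. L' (chart_inv c w) $ i $ l * L (chart_inv c w) $ l $ k)) * \<L> c (chart_inv c w) $ k $ i)) =
      (cocycle_form \<L> L L' c \<circ> chart_inv c) w"
      by (simp add: cocycle_form_def dform_def bracket_def commutator_def trace_def matrix_matrix_mult_def)
  qed
next
  fix c d p assume c: "c \<in> A" and d: "d \<in> A" and p: "p \<in> fst c \<inter> fst d - S"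
  let ?\<kappa> = "deriv (snd d \<circ> chart_inv c) (snd c p)"
  have ch: "is_chart c" "is_chart d" using c d complex_structureD(1) [OF A] by auto
  have pc: "p \<in> fst c" and pd: "p \<in> fst d" using p by auto
  note t = transition_chart [OF A c d pc pd]
  have "\<L> c p $ i $ j = \<L> d p $ i $ j * ?\<kappa>" for i j
    using \<L> c d p unfolding meromorphic_form_def by blast
  then have 1: "\<L> c p = smul ?\<kappa> (\<L> d p)"
    by (simp add: smul_def vec_eq_iff mult.commute)
  have D: "deriv (\<lambda>w. L' (chart_inv c w) $ i $ j) (snd c p) =
      deriv (\<lambda>w. L' (chart_inv d w) $ i $ j) (snd d p) * ?\<kappa>" for i j
  proof -
    have op: "open (snd c ` (fst c \<inter> fst d))" "open (snd d ` (fst d - S))"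
      using ch S open_snd_image [OF ch(1), of "fst d"] open_snd_image [OF ch(2), of "- S"]
      by (auto simp: Diff_eq open_Compl finite_imp_closed is_chart_def)
    have "\<forall>\<^sub>F w in nhds (snd c p). w \<in> snd c ` (fst c \<inter> fst d)"
      using op(1) pc pd by (intro eventually_nhds_in_open) auto
    then have "\<forall>\<^sub>F w in nhds (snd c p). L' (chart_inv c w) $ i $ j =
        ((\<lambda>w. L' (chart_inv d w) $ i $ j) \<circ> transition c d) w"
      by eventually_elim (auto simp: transition_def chart_inv_snd [OF ch(1)] chart_inv_snd [OF ch(2)])
    then have "deriv (\<lambda>w. L' (chart_inv c w) $ i $ j) (snd c p) =
        deriv ((\<lambda>w. L' (chart_inv d w) $ i $ j) \<circ> transition c d) (snd c p)"
      by (rule deriv_cong_ev) simp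
    also have "\<dots> = deriv (\<lambda>w. L' (chart_inv d w) $ i $ j) (transition c d (snd c p)) * deriv (transition c d) (snd c p)"
    proof (rule deriv_chain)
      show "transition c d field_differentiable at (snd c p)"
        using t(2) by (simp add: analytic_on_imp_differentiable_at)
      have "(\<lambda>w. L' (chart_inv d w) $ i $ j) holomorphic_on snd d ` (fst d - S)"
        using L' d unfolding meromorphic_fun_def o_def by blast
      then show "(\<lambda>w. L' (chart_inv d w) $ i $ j) field_differentiable at (transition c d (snd c p))"
        unfolding t(1) by (rule holomorphic_on_imp_differentiable_at [OF _ op(2)]) (use p in auto)
    qed
    finally show ?thesis by (simp add: t(1)) (simp add: transition_def)
  qed
  have 2: "dform L' c p = smul ?\<kappa> (dform L' d p)"
    by (simp add: dform_def smul_def vec_eq_iff D mult.commute)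
  show "cocycle_form \<L> L L' c p = cocycle_form \<L> L L' d p * ?\<kappa>"
    unfolding cocycle_form_def 1 2
    by (simp add: smul_mult_right trace_sub trace_smul right_diff_distrib mult.commute)
qed

text \<open>One chart decides: in any other the coefficient is composed with an analytic transition
  map and multiplied by its analytic derivative.\<close>

lemma regular_atI:
  fixes A :: "('a::t2_space) chart set"
  assumes A: "complex_structure A" and S: "finite S" and \<omega>: "meromorphic_form A S \<omega>"
    and d: "d \<in> A" "p \<in> fst d"
    and h: "h analytic_on {snd d p}" "\<forall>\<^sub>F w in at (snd d p). \<omega> d (chart_inv d w) = h w"
  shows "regular_at A \<omega> p"
  unfolding regular_at_def
proof (intro ballI impI)
  fix c assume c: "c \<in> A" "p \<in> fst c"
  note t = transition_chart [OF A c(1) d(1) c(2) d(2)]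
  have ch: "is_chart c" "is_chart d" using c d complex_structureD(1) [OF A] by auto
  have 1: "\<forall>\<^sub>F w in at (snd c p). \<omega> c (chart_inv c w) =
      \<omega> d (chart_inv d (transition c d w)) * deriv (transition c d) w"
    by (rule eventually_form_transition [OF A S c(1) d(1) c(2) d(2)])
       (use \<omega> c(1) d(1) in \<open>unfold meromorphic_form_def, blast\<close>)
  have "\<forall>\<^sub>F y in at p. \<omega> d y = h (snd d y)"
    unfolding eventually_at_chart [OF ch(2) d(2), of "\<lambda>y. \<omega> d y = h (snd d y)"]
  proof -
    have "\<forall>\<^sub>F w in at (snd d p). w \<in> snd d ` fst d"
      by (rule eventually_at_in_open') (use ch d in \<open>auto simp: is_chart_def\<close>)
    then show "\<forall>\<^sub>F w in at (snd d p). \<omega> d (chart_inv d w) = h (snd d (chart_inv d w))"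
      using h(2) by eventually_elim (simp add: snd_chart_inv [OF ch(2)])
  qed
  then have "\<forall>\<^sub>F w in at (snd c p). \<omega> d (chart_inv c w) = h (snd d (chart_inv c w))"
    by (simp add: eventually_at_chart [OF ch(1) c(2)])
  moreover have "\<forall>\<^sub>F w in at (snd c p). w \<in> snd c ` (fst c \<inter> fst d)"
    by (rule eventually_at_in_open', rule open_snd_image [OF ch(1)])
       (use ch c d in \<open>auto simp: is_chart_def\<close>)
  ultimately have "\<forall>\<^sub>F w in at (snd c p). \<omega> c (chart_inv c w) = (h \<circ> transition c d) w * deriv (transition c d) w"
    using 1
    by eventually_elim (auto simp: transition_def chart_inv_snd [OF ch(1)] chart_inv_snd [OF ch(2)])
  moreover have "(\<lambda>w. (h \<circ> transition c d) w * deriv (transition c d) w) analytic_on {snd c p}"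
    by (intro analytic_intros analytic_on_compose t(2) analytic_deriv) (use h(1) t(1) in auto)
  ultimately show "\<exists>h. h analytic_on {snd c p} \<and> (\<forall>\<^sub>F w in at (snd c p). \<omega> c (chart_inv c w) = h w)"
    by blast
qed

lemma residue_form_regular:
  fixes A :: "('a::t2_space) chart set"
  assumes A: "complex_structure A" and "regular_at A \<omega> p"
  shows "residue_form A p \<omega> = 0"
proof -
  define c where "c = (SOME c. c \<in> A \<and> p \<in> fst c)"
  have c: "c \<in> A" "p \<in> fst c"
    using someI_ex [of "\<lambda>c. c \<in> A \<and> p \<in> fst c"] complex_structureD(3) [OF A, of p]
    unfolding c_def by blast+
  obtain h where h: "h analytic_on {snd c p}" "\<forall>\<^sub>F w in at (snd c p). \<omega> c (chart_inv c w) = h w"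
    using assms(2) c unfolding regular_at_def by blast
  obtain B where B: "open B" "snd c p \<in> B" "h holomorphic_on B"
    using h(1) unfolding analytic_at by blast
  have "residue (\<omega> c \<circ> chart_inv c) (snd c p) = residue h (snd c p)"
    by (rule residue_cong) (use h(2) in simp_all)
  also have "\<dots> = 0"
    by (rule residue_holo [OF B])
  finally show ?thesis
    by (simp add: residue_form_def Let_def c_def [symmetric])
qed

lemma regular_at_laurent_expansion:
  fixes A :: "('a::t2_space) chart set"
  assumes A: "complex_structure A" and S: "finite S" and \<omega>: "meromorphic_form A S \<omega>"
    and d: "d \<in> A" "p \<in> fst d"
    and F: "(\<lambda>x. \<omega> d (chart_inv d (snd d p + x))) has_laurent_expansion F" "fls_ord_ge 0 F"
  shows "regular_at A \<omega> p"
proof (rule regular_atI [OF A S \<omega> d])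
  have sub: "fls_subdegree F \<ge> 0"
    using F(2) by (cases "F = 0") (auto simp: fls_ord_ge_iff)
  have "eval_fls F analytic_on {0}"
    by (rule analytic_on_eval_fls) (use F(1) sub in \<open>auto simp: has_laurent_expansion_def zero_ereal_def [symmetric]\<close>)
  then have "eval_fls F \<circ> (\<lambda>w. w - snd d p) analytic_on {snd d p}"
    by (intro analytic_on_compose) (auto intro!: analytic_intros)
  then show "(\<lambda>w. eval_fls F (w - snd d p)) analytic_on {snd d p}"
    by (simp add: o_def)
  have "\<forall>\<^sub>F x in at 0. eval_fls F x = \<omega> d (chart_inv d (snd d p + x))"
    using F(1) by (simp add: has_laurent_expansion_def)
  then show "\<forall>\<^sub>F w in at (snd d p). \<omega> d (chart_inv d w) = eval_fls F (w - snd d p)"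
    unfolding at_to_0 [of "snd d p"] eventually_filtermap
    by eventually_elim (simp add: add.commute)
qed


section \<open>The Lie algebra structure\<close>

lemma meromorphic_fun_intros:
  assumes "meromorphic_fun A S f" "meromorphic_fun A S g"
  shows "meromorphic_fun A S (\<lambda>p. f p + g p)" "meromorphic_fun A S (\<lambda>p. f p - g p)"
    "meromorphic_fun A S (\<lambda>p. f p * g p)" "meromorphic_fun A S (\<lambda>p. a * f p)"
  using assms unfolding meromorphic_fun_def o_def
  by (auto intro!: meromorphic_intros holomorphic_intros)

lemma meromorphic_fun_sum:
  assumes "\<And>i. i \<in> I \<Longrightarrow> meromorphic_fun A S (f i)"
  shows "meromorphic_fun A S (\<lambda>p. \<Sum>i\<in>I. f i p)"
  using assms unfolding meromorphic_fun_def o_def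
  by (auto intro!: meromorphic_intros holomorphic_intros)

lemma chart_series_ops:
  assumes X: "\<forall>i j. meromorphic_fun A S (\<lambda>p. X p $ i $ j)" and Y: "\<forall>i j. meromorphic_fun A S (\<lambda>p. Y p $ i $ j)"
    and c: "c \<in> A" "p \<in> fst c"
  shows "chart_series c p (\<lambda>p. X p + Y p) = chart_series c p X + chart_series c p Y"
    "chart_series c p (bracket X Y) = mcomm (chart_series c p X) (chart_series c p Y)"
    "chart_series c p (\<lambda>p. cscale a (X p)) = smul (fls_const a) (chart_series c p X)"
  unfolding bracket_def
  by (intro chart_series_eqI has_expansion_add has_expansion_commutator has_expansion_cscale
      matrix_fun_chart_series [OF X c] matrix_fun_chart_series [OF Y c])+

text \<open>The vectors \<open>b s\<close> do not enter the algebra itself; they provide the gauge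
  transformations by which closure is proved.\<close>

lemma lie_algebra_lax_algebra:
  fixes A :: "('a::t2_space) chart set"
  assumes A: "complex_structure A" and \<sigma>: "invertible \<sigma>"
    and z: "\<And>s. s \<in> {1..N} \<Longrightarrow> z s \<in> A \<and> \<gamma> s \<in> fst (z s)"
    and pair: "\<And>s. s \<in> {1..N} \<Longrightarrow> symp_pair \<sigma> (\<alpha> s) (b s)"
  shows "lie_algebra_of_functions (lax_algebra A N P Q \<gamma> z \<alpha> \<sigma>)"
proof -
  let ?V = "lax_algebra A N P Q \<gamma> z \<alpha> \<sigma>" and ?S = "sing_points N P Q \<gamma>"
  have V: "L \<in> ?V \<longleftrightarrow> (\<forall>i j. meromorphic_fun A ?S (\<lambda>p. L p $ i $ j)) \<and> (\<forall>p. sp_like \<sigma> (L p)) \<and>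
      (\<forall>s\<in>{1..N}. lax_series \<sigma> (\<alpha> s) (chart_series (z s) (\<gamma> s) L))" for L
    unfolding lax_algebra_def mem_Collect_eq mem_sp_iff [OF \<sigma>]
    by (auto simp: lax_at_def lax_series_def laurent_coeff_eq_mnth_chart_series)
  have spm: "sp_like \<sigma> (mnth (chart_series c p L) k)"
    if "\<forall>i j. meromorphic_fun A ?S (\<lambda>p. L p $ i $ j)" "\<forall>p. sp_like \<sigma> (L p)" "c \<in> A" "p \<in> fst c" for L c p k
    by (rule sp_like_mnth [OF matrix_fun_chart_series [OF that(1,3,4)]]) (use that(2) in simp)
  show ?thesis
    unfolding lie_algebra_of_functions_def
  proof (intro conjI ballI allI)
    show "(\<lambda>p. 0) \<in> ?V"
    proof -
      have "chart_series c p (\<lambda>p. 0 :: complex^'b^'b) = 0" for c and p :: 'a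
        by (rule chart_series_eqI) (simp add: has_expansion_def)
      moreover have "lax_series \<sigma> a 0" for a
        unfolding lax_series_def
        by (intro conjI exI [of _ 0])
           (simp_all add: cscale_smul outer_0_left outer_0_right bilin_def scalar_product_def)
      ultimately show ?thesis
        unfolding V by (auto simp: sp_like_0 meromorphic_fun_def o_def)
    qed
  next
    fix X Y assume XY: "X \<in> ?V" "Y \<in> ?V"
    note X = XY(1) [unfolded V] and Y = XY(2) [unfolded V]
    have mero: "\<forall>i j. meromorphic_fun A ?S (\<lambda>p. (X p + Y p) $ i $ j)"
      "\<forall>i j. meromorphic_fun A ?S (\<lambda>p. bracket X Y p $ i $ j)"
      using X Y unfolding bracket_def commutator_def matrix_matrix_mult_def
      by (auto intro!: meromorphic_fun_intros meromorphic_fun_sum)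
    have spl: "\<forall>p. sp_like \<sigma> (X p + Y p)" "\<forall>p. sp_like \<sigma> (bracket X Y p)"
      using X Y by (auto simp: sp_like_add bracket_def sp_like_commutator)
    note ser = chart_series_ops [OF conjunct1 [OF X] conjunct1 [OF Y]]
    show "(\<lambda>p. X p + Y p) \<in> ?V"
      unfolding V using mero(1) spl(1) X Y z
      by (auto simp: ser intro!: lax_series_add [OF pair] spm)
    have "lax_series \<sigma> (\<alpha> s) (chart_series (z s) (\<gamma> s) (bracket X Y))" if s: "s \<in> {1..N}" for s
      unfolding ser(2) [OF conjunct1 [OF z [OF s]] conjunct2 [OF z [OF s]]]
    proof (rule lax_series_mcomm [OF pair [OF s]])
      show "sp_like \<sigma> (mnth (mcomm (chart_series (z s) (\<gamma> s) X) (chart_series (z s) (\<gamma> s) Y)) k)" for k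
        using spm [OF mero(2) spl(2), of "z s" "\<gamma> s" k] z [OF s] ser(2) by simp
    qed (use X Y z s spm in blast)+
    then show "bracket X Y \<in> ?V"
      unfolding V using mero(2) spl(2) by blast
  next
    fix a X assume "X \<in> ?V"
    note X = this [unfolded V]
    note ser = chart_series_ops(3) [OF conjunct1 [OF X] conjunct1 [OF X]]
    have "\<forall>i j. meromorphic_fun A ?S (\<lambda>p. cscale a (X p) $ i $ j)"
      using X by (auto simp: cscale_smul smul_def intro!: meromorphic_fun_intros)
    then show "(\<lambda>p. cscale a (X p)) \<in> ?V"
      unfolding V using X z by (auto simp: ser sp_like_cscale intro!: lax_series_smul [OF pair] spm)
  qed
qed


text \<open>Away from the dummy zeros on \<open>S\<close> the expansion at \<open>p\<close> is that
  of the constant \<open>M\<close>, so positive order forces \<open>M = 0\<close>. Together with the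
  zeros on \<open>S\<close> this would make \<open>X\<close> vanish everywhere.\<close>

lemma constant_order_bound:
  fixes A :: "('a::t2_space) chart set"
  assumes A: "complex_structure A" and S: "finite S"
    and X0: "\<forall>p\<in>S. X p = 0" and const: "\<forall>p. p \<notin> S \<longrightarrow> X p = M" and nz: "\<exists>p. X p \<noteq> 0"
    and ord: "order_ge A X p m"
  shows "m \<le> 0"
proof (rule ccontr)
  assume "\<not> m \<le> 0"
  obtain c where c: "c \<in> A" "p \<in> fst c" using complex_structureD(3) [OF A] by blast
  then have ch: "is_chart c" using complex_structureD(1) [OF A] by blast
  have "\<forall>\<^sub>F q in at p. X q = M"
    using eventually_at_not_in_finite [OF S, of p] by eventually_elim (use const in auto)
  then have "\<forall>\<^sub>F w in at (snd c p). X (chart_inv c w) = M"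
    by (simp add: eventually_at_chart [OF ch c(2), of "\<lambda>q. X q = M"])
  then have "has_expansion (\<lambda>w. X (chart_inv c w)) (snd c p) (mconst M)"
    by (subst has_expansion_cong) (auto intro: has_expansion_const)
  then have "laurent_coeff c p X 0 = mnth (mconst M) 0"
    by (simp add: laurent_coeff_eq_mnth_chart_series chart_series_eqI)
  also have "\<dots> = M"
    by (simp add: mnth_def mconst_def)
  finally have "M = 0"
    using ord c \<open>\<not> m \<le> 0\<close> by (simp add: order_ge_def)
  then show False using nz X0 const by metis
qed

section \<open>Regularity, cocycle identities and locality of the residue pairing\<close>

theorem theorem4p9:
  fixes A :: "('a::t2_space) chart set" and g n :: nat
    and P Q :: 'a and \<gamma> :: "nat \<Rightarrow> 'a" and z :: "nat \<Rightarrow> 'a chart"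
    and \<alpha> :: "nat \<Rightarrow> complex^'m" and \<sigma> :: "complex^'m^'m"
    and \<L> :: "('a, complex^'m^'m) form"
  assumes "compact_riemann_surface A g"
    and "CARD('m) = 2 * n"
    and "transpose \<sigma> = - \<sigma>" and "invertible \<sigma>"
    and "P \<noteq> Q"
    and "inj_on \<gamma> {1..n * g}" and "\<forall>s\<in>{1..n * g}. \<gamma> s \<notin> {P, Q}"
    and "\<forall>s\<in>{1..n * g}. \<alpha> s \<noteq> 0"
    and "\<forall>s\<in>{1..n * g}. z s \<in> A \<and> \<gamma> s \<in> fst (z s) \<and> snd (z s) (\<gamma> s) = 0"
    and "lax_form A (n * g) P Q \<gamma> z \<alpha> \<sigma> \<L>"
  shows "(\<forall>L \<in> lax_algebra A (n * g) P Q \<gamma> z \<alpha> \<sigma>. \<forall>L' \<in> lax_algebra A (n * g) P Q \<gamma> z \<alpha> \<sigma>.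
            meromorphic_form A (sing_points (n * g) P Q \<gamma>) (cocycle_form \<L> L L') \<and>
            (\<forall>p. p \<notin> {P, Q} \<longrightarrow> regular_at A (cocycle_form \<L> L L') p)) \<and>
         two_cocycle (lax_algebra A (n * g) P Q \<gamma> z \<alpha> \<sigma>)
           (\<lambda>L L'. residue_form A P (cocycle_form \<L> L L')) \<and>
         local_wrt (lax_homogeneous A g (n * g) P Q \<gamma> z \<alpha> \<sigma>)
           (\<lambda>L L'. residue_form A P (cocycle_form \<L> L L'))"
proof -
  define S where "S = sing_points (n * g) P Q \<gamma>"
  define V where "V = lax_algebra A (n * g) P Q \<gamma> z \<alpha> \<sigma>"
  have A: "complex_structure A" and X: "compact (UNIV :: 'a set)" "connected (UNIV :: 'a set)"
    using assms(1) by (auto simp: compact_riemann_surface_def)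
  have S: "finite S" by (simp add: S_def sing_points_def)
  have z: "z s \<in> A" "\<gamma> s \<in> fst (z s)" if "s \<in> {1..n * g}" for s
    using assms(9) that by auto
  have Vm: "\<forall>i j. meromorphic_fun A S (\<lambda>p. L p $ i $ j)" and Vsp: "sp_like \<sigma> (L p)"
    and Vlax: "s \<in> {1..n * g} \<Longrightarrow> lax_series \<sigma> (\<alpha> s) (chart_series (z s) (\<gamma> s) L)"
    if "L \<in> V" for L p s
    using that unfolding V_def lax_algebra_def S_def mem_Collect_eq mem_sp_iff [OF assms(4)]
    by (auto simp: lax_at_def lax_series_def laurent_coeff_eq_mnth_chart_series)
  have Lm: "\<forall>i j. meromorphic_form A S (\<lambda>c p. \<L> c p $ i $ j)"
    and Lsp: "\<And>c p. c \<in> A \<Longrightarrow> p \<in> fst c - S \<Longrightarrow> sp_like \<sigma> (\<L> c p)"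
    and Llax: "\<And>s. s \<in> {1..n * g} \<Longrightarrow> lax_form_at \<sigma> (z s) (\<gamma> s) (\<alpha> s) \<L>"
    using assms(10) unfolding lax_form_def S_def mem_sp_iff [OF assms(4)] by auto
  have "\<forall>s. \<exists>b k. s \<in> {1..n * g} \<longrightarrow>
      laurent_coeff (z s) (\<gamma> s) (\<L> (z s)) (-1) = (outer (\<alpha> s) b + outer b (\<alpha> s)) ** \<sigma> \<and>
      bilin \<sigma> b (\<alpha> s) = 1 \<and>
      laurent_coeff (z s) (\<gamma> s) (\<L> (z s)) 0 *v \<alpha> s = k *s \<alpha> s"
    using Llax unfolding lax_form_at_def by meson
  then obtain b \<kappa> where b: "\<And>s. s \<in> {1..n * g} \<Longrightarrow>
      laurent_coeff (z s) (\<gamma> s) (\<L> (z s)) (-1) = (outer (\<alpha> s) (b s) + outer (b s) (\<alpha> s)) ** \<sigma> \<and>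
      bilin \<sigma> (b s) (\<alpha> s) = 1 \<and>
      laurent_coeff (z s) (\<gamma> s) (\<L> (z s)) 0 *v \<alpha> s = \<kappa> s *s \<alpha> s"
    by metis
  have pair: "symp_pair \<sigma> (\<alpha> s) (b s)" if "s \<in> {1..n * g}" for s
    using b [OF that] assms(3) by (simp add: symp_pair_def)
  have expansion: "(\<lambda>x. cocycle_form \<L> L L' c (chart_inv c (snd c p + x))) has_laurent_expansion
      cocycle_series (chart_series c p (\<L> c)) (chart_series c p L) (chart_series c p L')"
    if "L \<in> V" "L' \<in> V" "c \<in> A" "p \<in> fst c" for L L' c p
    using cocycle_form_expansion [where \<L> = \<L>, OF complex_structureD(1) [OF A that(3)] that(4)
        matrix_fun_chart_series [OF Vm [OF that(1)] that(3,4)]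
        matrix_fun_chart_series [OF Vm [OF that(2)] that(3,4)] matrix_form_chart_series [OF Lm that(3,4)]] .
  have form: "meromorphic_form A S (cocycle_form \<L> L L')" if "L \<in> V" "L' \<in> V" for L L'
    by (rule cocycle_form_meromorphic_form [OF A S Vm [OF that(1)] Vm [OF that(2)] Lm])
  have regular: "regular_at A (cocycle_form \<L> L L') p" if L: "L \<in> V" "L' \<in> V" and p: "p \<notin> {P, Q}" for L L' p
  proof (cases "p \<in> S")
    case False
    obtain c where c: "c \<in> A" "p \<in> fst c" using complex_structureD(3) [OF A] by blast
    have "open (snd c ` (fst c - S))"
      using open_snd_image [OF complex_structureD(1) [OF A c(1)], of "- S"] S
      by (simp add: Diff_eq open_Compl finite_imp_closed)
    moreover have "(cocycle_form \<L> L L' c \<circ> chart_inv c) holomorphic_on snd c ` (fst c - S)"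
      using form [OF L] c(1) unfolding meromorphic_form_def by blast
    ultimately have "(cocycle_form \<L> L L' c \<circ> chart_inv c) analytic_on {snd c p}"
      unfolding analytic_at using c(2) False by blast
    then show ?thesis
      by (rule regular_atI [OF A S form [OF L] c]) simp
  next
    case True
    then obtain s where s: "s \<in> {1..n * g}" "p = \<gamma> s"
      using p by (auto simp: S_def sing_points_def)
    have spV: "sp_like \<sigma> (mnth (chart_series (z s) (\<gamma> s) L) k)" if "L \<in> V" for L k
      by (rule sp_like_mnth [OF matrix_fun_chart_series [OF Vm [OF that] z [OF s(1)]]])
         (use Vsp [OF that] in simp)
    have ch: "is_chart (z s)" using complex_structureD(1) [OF A] z [OF s(1)] by blast
    \<comment> \<open>The values of the form on \<open>S\<close> are arbitrary, so membership in the
      symplectic algebra is available on a punctured neighbourhood only.\<close>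
    have "\<forall>\<^sub>F q in at (\<gamma> s). sp_like \<sigma> (\<L> (z s) q)"
      using eventually_at_chart_domain [OF ch z(2) [OF s(1)] ch z(2) [OF s(1)] S]
      by eventually_elim (use Lsp z(1) [OF s(1)] in auto)
    then have "\<forall>\<^sub>F w in at (snd (z s) (\<gamma> s)). sp_like \<sigma> (\<L> (z s) (chart_inv (z s) w))"
      by (simp add: eventually_at_chart [OF ch z(2) [OF s(1)]])
    then have spL: "sp_like \<sigma> (mnth (chart_series (z s) (\<gamma> s) (\<L> (z s))) k)" for k
      by (rule sp_like_mnth [OF matrix_form_chart_series [OF Lm z [OF s(1)]]])
    have "fls_ord_ge 0 (cocycle_series (chart_series (z s) (\<gamma> s) (\<L> (z s)))
        (chart_series (z s) (\<gamma> s) L) (chart_series (z s) (\<gamma> s) L'))"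
      by (rule cocycle_series_regular [OF pair [OF s(1)] spV [OF L(1)] Vlax [OF L(1) s(1)]
            spV [OF L(2)] Vlax [OF L(2) s(1)] spL])
         (use Llax [OF s(1)] b [OF s(1)] in \<open>auto simp: lax_form_at_def laurent_coeff_eq_mnth_chart_series\<close>)
    then show ?thesis
      unfolding s(2)
      by (rule regular_at_laurent_expansion [OF A S form [OF L] z [OF s(1)] expansion [OF L z [OF s(1)]]])
  qed
  define \<eta> where "\<eta> L L' = residue_form A P (cocycle_form \<L> L L')" for L L'
  \<comment> \<open>The same choice as in \<open>residue_form\<close>, so that residues unfold to
    coefficients of these series.\<close>
  define c where "c p = (SOME c. c \<in> A \<and> p \<in> fst c)" for p :: 'a
  define E where "E p L = chart_series (c p) p L" for p and L :: "'a \<Rightarrow> complex^'m^'m"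
  define N where "N p = E p (\<L> (c p))" for p
  have c: "c p \<in> A" "p \<in> fst (c p)" for p
    using someI_ex [of "\<lambda>c. c \<in> A \<and> p \<in> fst c"] complex_structureD(3) [OF A, of p]
    unfolding c_def by blast+
  have res: "residue_form A p (cocycle_form \<L> L L') = fls_residue (cocycle_series (N p) (E p L) (E p L'))"
    if "L \<in> V" "L' \<in> V" for L L' p
    using has_laurent_expansion_residue [OF expansion [OF that c, of p]]
    by (simp add: residue_form_def Let_def c_def [symmetric] o_def N_def E_def)
  have lie: "lie_algebra_of_functions V"
    unfolding V_def by (rule lie_algebra_lax_algebra [OF A assms(4) _ pair]) (use z in auto)
  have closed: "(\<lambda>p. L p + L' p) \<in> V" "bracket L L' \<in> V" "(\<lambda>p. cscale a (L p)) \<in> V"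
    if "L \<in> V" "L' \<in> V" for L L' a
    using lie that unfolding lie_algebra_of_functions_def by blast+
  have E: "E p (\<lambda>p. L p + L' p) = E p L + E p L'" "E p (bracket L L') = mcomm (E p L) (E p L')"
    "E p (\<lambda>p. cscale a (L p)) = smul (fls_const a) (E p L)" if "L \<in> V" "L' \<in> V" for p L L' a
    unfolding E_def by (rule chart_series_ops [OF Vm [OF that(1)] Vm [OF that(2)] c])+
  have cocycle: "two_cocycle V \<eta>"
    unfolding two_cocycle_def
  proof (intro conjI ballI allI lie)
    fix X Y Z assume V: "X \<in> V" "Y \<in> V" "Z \<in> V"
    show "\<eta> (\<lambda>p. X p + Y p) Z = \<eta> X Z + \<eta> Y Z" "\<eta> Z (\<lambda>p. X p + Y p) = \<eta> Z X + \<eta> Z Y"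
      using V by (simp_all add: \<eta>_def res closed E cocycle_series_add_left cocycle_series_add_right)
    show "\<eta> (bracket X Y) Z + \<eta> (bracket Y Z) X + \<eta> (bracket Z X) Y = 0"
      using V cocycle_series_jacobi [of "N P" "E P X" "E P Y" "E P Z"]
      by (simp add: \<eta>_def res closed E)
  next
    fix a X Y assume V: "X \<in> V" "Y \<in> V"
    show "\<eta> (\<lambda>p. cscale a (X p)) Y = a * \<eta> X Y" "\<eta> X (\<lambda>p. cscale a (Y p)) = a * \<eta> X Y"
      using V by (simp_all add: \<eta>_def res closed E cocycle_series_scale_left cocycle_series_scale_right
          fls_residue_fls_const_times)
    show "\<eta> X Y = - \<eta> Y X"
      using V cocycle_series_antisym by (simp add: \<eta>_def res)
  qed
  \<comment> \<open>Here \<open>k\<close> bounds the order of the form at \<open>p\<close> from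
    below. A series of order at least 0 has no residue.\<close>
  have ord: "residue_form A p (cocycle_form \<L> L L') = 0"
    if "L \<in> V" "L' \<in> V" "order_ge A L p i" "order_ge A L' p j" "mat_ord_ge k (N p)" "k \<le> -1" "0 \<le> i + j + k"
    for L L' p i j k
  proof -
    have "mat_ord_ge i (E p L)" "mat_ord_ge j (E p L')"
      using that(3,4) c unfolding order_ge_def mat_ord_ge_iff E_def
      by (auto simp: laurent_coeff_eq_mnth_chart_series)
    then have "fls_ord_ge (i + j + k) (cocycle_series (N p) (E p L) (E p L'))"
      using that(5,6) by (rule cocycle_series_ord_ge)
    then show ?thesis
      using that(1,2,7) by (simp add: res fls_ord_ge_def)
  qed
  \<comment> \<open>By regularity the weak singularities contribute nothing to the sum of residues,
    which leaves the two marked points.\<close>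
  have res_PQ: "residue_form A P (cocycle_form \<L> L L') = - residue_form A Q (cocycle_form \<L> L L')"
    if L: "L \<in> V" "L' \<in> V" and f: "meromorphic_fun A S f" "\<not> (\<exists>k. \<forall>p. p \<notin> S \<longrightarrow> f p = k)" for L L' f
  proof -
    have "0 = (\<Sum>p\<in>S. residue_form A p (cocycle_form \<L> L L'))"
      using sum_residues_eq_0 [OF A X S f form [OF L]] by simp
    also have "\<dots> = (\<Sum>p\<in>{P, Q}. residue_form A p (cocycle_form \<L> L L'))"
      by (rule sum.mono_neutral_right [OF S])
         (use residue_form_regular [OF A regular [OF L]] in \<open>auto simp: S_def sing_points_def\<close>)
    also have "\<dots> = residue_form A P (cocycle_form \<L> L L') + residue_form A Q (cocycle_form \<L> L L')"
      using assms(5) by simp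
    finally show ?thesis by (simp add: eq_neg_iff_add_eq_0)
  qed
  have "\<exists>k. k \<le> -1 \<and> mat_ord_ge k (N p)" for p
    using mat_ord_ge_exists [of "N p"] mat_ord_ge_mono by (metis min.cobounded1 min.cobounded2)
  then obtain k where k: "\<And>p. k p \<le> -1" "\<And>p. mat_ord_ge (k p) (N p)"
    by metis
  have local: "local_wrt (lax_homogeneous A g (n * g) P Q \<gamma> z \<alpha> \<sigma>) \<eta>"
    unfolding local_wrt_def
  proof (intro exI allI impI ballI)
    fix m m' :: int and L L'
    \<comment> \<open>At \<open>P\<close> the orders add up to m + m' + k P, which is nonnegative
      from - k P on. At \<open>Q\<close> they add up to - m - m' - 2 g + k Q, nonnegative up to k Q
      - 2 g. The bound -2 g serves the constant case, where m and m' are each at least - g.\<close>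
    assume m: "\<not> (min (k Q - 2 * int g + 1) (- 2 * int g) \<le> m + m' \<and> m + m' \<le> max (- k P - 1) 0)"
      and hom: "L \<in> lax_homogeneous A g (n * g) P Q \<gamma> z \<alpha> \<sigma> m"
        "L' \<in> lax_homogeneous A g (n * g) P Q \<gamma> z \<alpha> \<sigma> m'"
    have L: "L \<in> V" "L' \<in> V"
      and o: "order_ge A L P m" "order_ge A L Q (- m - int g)" "order_ge A L' P m'" "order_ge A L' Q (- m' - int g)"
      using hom by (auto simp: lax_homogeneous_def V_def)
    show "\<eta> L L' = 0"
    proof (cases "m + m' > max (- k P - 1) 0")
      case True
      then show ?thesis
        unfolding \<eta>_def by (intro ord [OF L o(1,3) k(2,1)]) auto
    next
      case False
      then have less: "m + m' < k Q - 2 * int g + 1" "m + m' < - 2 * int g"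
        using m by auto
      have resQ: "residue_form A Q (cocycle_form \<L> L L') = 0"
        by (rule ord [OF L o(2,4) k(2,1)]) (use less in auto)
      show ?thesis
      proof (cases "\<exists>K\<in>{L, L'}. \<exists>i j. \<not> (\<exists>v. \<forall>p. p \<notin> S \<longrightarrow> K p $ i $ j = v)")
        case True
        then obtain K i j where K: "K \<in> {L, L'}" "\<not> (\<exists>v. \<forall>p. p \<notin> S \<longrightarrow> K p $ i $ j = v)"
          by blast
        then have "meromorphic_fun A S (\<lambda>p. K p $ i $ j)"
          using Vm L by blast
        then show ?thesis
          using res_PQ [OF L _ K(2)] resQ by (simp add: \<eta>_def)
      next
        case False
        \<comment> \<open>A nonzero constant has order 0 at \<open>Q\<close>, whereas membership in
          degree \<open>i\<close> demands order at least - i - g there.\<close>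
        have bound: "- int g \<le> i" if K: "K \<in> {L, L'}" "K \<noteq> (\<lambda>p. 0)" "order_ge A K Q (- i - int g)" for K i
        proof -
          obtain M where M: "\<And>i j p. p \<notin> S \<Longrightarrow> K p $ i $ j = M i j"
            using False K(1) by metis
          have "- i - int g \<le> 0"
          proof (rule constant_order_bound [OF A S _ _ _ K(3)])
            show "\<forall>p\<in>S. K p = 0"
              using Vm K(1) L by (auto simp: meromorphic_fun_def vec_eq_iff)
            show "\<forall>p. p \<notin> S \<longrightarrow> K p = (\<chi> i j. M i j)"
              using M by (simp add: vec_eq_iff)
            show "\<exists>p. K p \<noteq> 0"
              using K(2) by auto
          qed
          then show ?thesis by simp
        qed
        have zero: "\<eta> L L' = 0" if "L = (\<lambda>p. 0) \<or> L' = (\<lambda>p. 0)"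
        proof -
          have "E P (\<lambda>p. 0) = 0"
            unfolding E_def by (rule chart_series_eqI) (simp add: has_expansion_def)
          moreover have "mderiv 0 = (0 :: complex fls^'m^'m)"
            by (simp add: mderiv_def vec_eq_iff)
          moreover have "trace (0 :: complex fls^'m^'m) = 0"
            by (simp add: trace_def)
          ultimately show ?thesis
            using that L by (auto simp: \<eta>_def res cocycle_series_def mcomm_def)
        qed
        show ?thesis
        proof (rule ccontr)
          assume "\<eta> L L' \<noteq> 0"
          then have "- int g \<le> m" "- int g \<le> m'"
            using zero bound [of L m] bound [of L' m'] o by auto
          then show False using less by simp
        qed
      qed
    qed
  qed
  show ?thesis
    using form regular cocycle local unfolding V_def S_def \<eta>_def [abs_def] by blast
qed

end
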